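(* Let $(\mathfrak m_{s,t})_{s\le t}$ and $(\mathfrak m^n_{s,t})_{s\le t}$, $n\in\mathbb N$, be $\rhd$-convolution hemigroups with finite second moment. Let $(f_t)_t$ (resp. $(f^n_t)_t$) be the $\mathcal P^2$-DLC, $(f_{s,t})_{s\le t}$ (resp. $(f^n_{s,t})_{s\le t}$) the $\mathcal P^2$-REF, and $(m_t,\kappa_t)_t$ (resp. $(m^n_t,\kappa^n_t)_t$) the reduced generator of $(\mathfrak m_{s,t})$ (resp. $(\mathfrak m^n_{s,t})$). Suppose that, for each $t\in I$, $$\sup_{n\in\mathbb N}\mathrm V(\mathfrak m^n_{0,t})=\sup_{n\in\mathbb N}\mathrm r(f^n_t)<+\infty.$$ Then the following mutually equivalent conditions (1)--(4) (as $n\to\infty$) (1) $(\mathfrak m^n_{0,t})_t$ converges weakly to $(\mathfrak m_{0,t})_t$ locally uniformly on $I$; (2) $(\mathfrak m^n_{s,t})_{s\le t}$ converges weakly to $(\mathfrak m_{s,t})_{s\le t}$ locally uniformly on $I^2_\le$; (3) $f^n_t(z)$ converges to $f_t(z)$ locally uniformly on $\mathbb C^+\times I$; (4) $f^n_{s,t}(z)$ converges to $f_{s,t}(z)$ locally uniformly on $\mathbb C^+\times I^2_\le$; are satisfied if and only if (5) $(m^n_t)_t$ converges to $(m_t)_t$ locally uniformly on $I$, and $(\kappa^n_t)_t$ converges vaguely to $(\kappa_t)_t$ locally uniformly on $I$ as $n\to\infty$.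
   Context: $I$ is a fixed interval $[0,T_0)$ ($0<T_0\le+\infty$) or $[0,T_0]$ ($0<T_0<+\infty$), and $I^2_\le=\{(s,t)\in I^2:s\le t\}$. $\mathbb C^+$ is the open upper half-plane; $\mathbf P(\mathbb R)$, $\mathbf M(\mathbb R)$ are the sets of Borel probability measures and of finite nonnegative Borel measures on $\mathbb R$; $\mathrm V(\mu)$ is the variance of $\mu$. For $\mu\in\mathbf P(\mathbb R)$: $G_\mu(z)=\int\frac1{z-x}\mu(dx)$, $F_\mu=F[\mu]=1/G_\mu$ on $\mathbb C^+$; $\mathcal P^2=\{F_\mu:\mu\in\mathbf P(\mathbb R),\int x^2\mu(dx)<\infty\}$. Each $f\in\mathcal P^2$ is uniquely written $f(z)=z-\mathrm m(f)+\int\frac1{x-z}\rho_f(dx)$ with $\mathrm m(f)\in\mathbb R$, $\rho_f\in\mathbf M(\mathbb R)$, and $\mathrm r(f)=\rho_f(\mathbb R)$; one has $\mathrm r(F_\mu)=\mathrm V(\mu)$. Monotone convolution $\rhd$ is determined by $F_{\mu\rhd\nu}=F_\mu\circ F_\nu$. A $\rhd$-convolution hemigroup is a family $(\mathfrak m_{s,t})_{(s,t)\in I^2_\le}$ in $\mathbf P(\mathbb R)$ with $\mathfrak m_{s,s}=\delta_0$, $\mathfrak m_{s,t}\rhd\mathfrak m_{t,u}=\mathfrak m_{s,u}$ for $s\le t\le u$, and $(s,t)\mapsto\mathfrak m_{s,t}$ weakly continuous; "with finite second moment" means every $\mathfrak m_{s,t}$ has finite second moment. Its REF is $f_{s,t}=F[\mathfrak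 m_{s,t}]$ and its DLC is $f_t=f_{0,t}$. Its reduced generator is the unique pair consisting of a continuous function $t\mapsto m_t\in\mathbb R$ with $m_0=0$ and a Borel measure $\mathcal K$ on $\mathbb R\times I$ with $\mathcal K(\mathbb R\times[0,t])<\infty$, $\mathcal K(\mathbb R\times\{t\})=0$ for all $t\in I$, such that $f_{s,t}(z)=z-m_t+m_s+\int_{\mathbb R\times[s,t]}\frac1{x-f_{r,t}(z)}\,\mathcal K(dx\,dr)$ for $s\le t$, $z\in\mathbb C^+$ (existence and uniqueness hold); it is identified with $(m_t,\kappa_t)_t$, where $\kappa_t(\cdot)=\mathcal K(\cdot\times[0,t])$. For $\mathbb I=I$ or $I^2_\le$, $(\mu^n_\tau)_{\tau\in\mathbb I}$ converges weakly (resp. vaguely) to $(\mu_\tau)_{\tau\in\mathbb I}$ locally uniformly on $\mathbb I$ if $\lim_n\sup_{\tau\in K}|\int f\,d\mu^n_\tau-\int f\,d\mu_\tau|=0$ for every compact $K\subset\mathbb I$ and every bounded continuous (resp. compactly supported continuous) $f:\mathbb R\to\mathbb R$. *)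

theory Defs
  imports "HOL-Probability.Probability"
begin

definition time_interval :: "real set \<Rightarrow> bool" where
  "time_interval I \<longleftrightarrow> I = {0..} \<or> (\<exists>T>0. I = {0..<T} \<or> I = {0..T})"

definition ordered_pairs :: "real set \<Rightarrow> (real \<times> real) set" where
  "ordered_pairs I = {(s, t). s \<in> I \<and> t \<in> I \<and> s \<le> t}"

definition upper_half_plane :: "complex set" where
  "upper_half_plane = {z. Im z > 0}"

definition Cauchy_transform :: "real measure \<Rightarrow> complex \<Rightarrow> complex" where
  "Cauchy_transform \<mu> z = (LINT x|\<mu>. 1 / (z - of_real x))"

definition F_transform :: "real measure \<Rightarrow> complex \<Rightarrow> complex" where
  "F_transform \<mu> z = 1 / Cauchy_transform \<mu> z"

definition finite_second_moment :: "real measure \<Rightarrow> bool" where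
  "finite_second_moment \<mu> \<longleftrightarrow> integrable \<mu> (\<lambda>x. x\<^sup>2)"

definition variance_of :: "real measure \<Rightarrow> real" where
  "variance_of \<mu> = (LINT x|\<mu>. (x - (LINT y|\<mu>. y))\<^sup>2)"

text \<open>A probability measure is determined by the values of its reciprocal Cauchy transform on
  the upper half-plane, so the relation below determines \<open>\<eta>\<close> from \<open>\<mu>\<close> and \<open>\<nu>\<close>.\<close>

definition is_monotone_convolution :: "real measure \<Rightarrow> real measure \<Rightarrow> real measure \<Rightarrow> bool" where
  "is_monotone_convolution \<mu> \<nu> \<eta> \<longleftrightarrow>
     real_distribution \<mu> \<and> real_distribution \<nu> \<and> real_distribution \<eta> \<and>
     (\<forall>z\<in>upper_half_plane. F_transform \<eta> z = F_transform \<mu> (F_transform \<nu> z))"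

text \<open>Only the values \<open>M s t\<close> with \<open>(s, t) \<in> ordered_pairs I\<close> are meaningful.\<close>

definition monotone_hemigroup :: "real set \<Rightarrow> (real \<Rightarrow> real \<Rightarrow> real measure) \<Rightarrow> bool" where
  "monotone_hemigroup I M \<longleftrightarrow>
     (\<forall>(s, t)\<in>ordered_pairs I. real_distribution (M s t)) \<and>
     (\<forall>s\<in>I. M s s = return borel 0) \<and>
     (\<forall>s\<in>I. \<forall>t\<in>I. \<forall>u\<in>I. s \<le> t \<longrightarrow> t \<le> u \<longrightarrow>
        is_monotone_convolution (M s t) (M t u) (M s u)) \<and>
     (\<forall>\<phi>::real \<Rightarrow> real. continuous_on UNIV \<phi> \<longrightarrow> bounded (range \<phi>) \<longrightarrow>
        continuous_on (ordered_pairs I) (\<lambda>(s, t). LINT x|M s t. \<phi> x))"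

definition monotone_hemigroup_L2 :: "real set \<Rightarrow> (real \<Rightarrow> real \<Rightarrow> real measure) \<Rightarrow> bool" where
  "monotone_hemigroup_L2 I M \<longleftrightarrow> monotone_hemigroup I M \<and>
     (\<forall>(s, t)\<in>ordered_pairs I. finite_second_moment (M s t))"

text \<open>Reverse evolution family and decreasing Loewner chain of a hemigroup.\<close>

definition REF :: "(real \<Rightarrow> real \<Rightarrow> real measure) \<Rightarrow> real \<Rightarrow> real \<Rightarrow> complex \<Rightarrow> complex" where
  "REF M s t = F_transform (M s t)"

definition DLC :: "(real \<Rightarrow> real \<Rightarrow> real measure) \<Rightarrow> real \<Rightarrow> complex \<Rightarrow> complex" where
  "DLC M t = REF M 0 t"

text \<open>The measure \<open>K\<close> lives on the subspace \<open>UNIV \<times> I\<close> of the plane: both its space and its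
  \<open>\<sigma>\<close>-algebra are those of \<open>UNIV \<times> I\<close>.\<close>

definition reduced_generator ::
  "real set \<Rightarrow> (real \<Rightarrow> real \<Rightarrow> real measure) \<Rightarrow> (real \<Rightarrow> real) \<Rightarrow> (real \<times> real) measure \<Rightarrow> bool" where
  "reduced_generator I M m K \<longleftrightarrow>
     continuous_on I m \<and> m 0 = 0 \<and>
     sets K = sets (restrict_space borel (UNIV \<times> I)) \<and>
     (\<forall>t\<in>I. emeasure K (UNIV \<times> {0..t}) < \<infinity>) \<and>
     (\<forall>t\<in>I. emeasure K (UNIV \<times> {t}) = 0) \<and>
     (\<forall>(s, t)\<in>ordered_pairs I. \<forall>z\<in>upper_half_plane.
        REF M s t z = z - of_real (m t) + of_real (m s) +
          (LINT p:(UNIV \<times> {s..t})|K. 1 / (of_real (fst p) - REF M (snd p) t z)))"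

definition kappa :: "(real \<times> real) measure \<Rightarrow> real \<Rightarrow> real measure" where
  "kappa K t = distr (restrict_space K (UNIV \<times> {0..t})) borel fst"

lemma emeasure_kappa:
  assumes "sets K = sets (restrict_space borel (UNIV \<times> I))"
    and "{0..t} \<subseteq> I" and "B \<in> sets borel"
  shows "emeasure (kappa K t) B = emeasure K (B \<times> {0..t})"
proof -
  have sp: "space K = UNIV \<times> I"
    using sets_eq_imp_space_eq[OF assms(1)] by (simp add: space_restrict_space)
  have rect: "A \<times> {0..t} \<in> sets K" if "A \<in> sets borel" for A :: "real set"
  proof -
    have "A \<times> {0..t} \<in> sets (borel :: (real \<times> real) measure)"
      unfolding borel_prod[symmetric] using that by auto
    moreover have "A \<times> {0..t} = (UNIV \<times> I) \<inter> (A \<times> {0..t})"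
      using assms(2) by auto
    ultimately show ?thesis
      unfolding assms(1) sets_restrict_space by (metis image_eqI)
  qed
  have "fst \<in> measurable (borel :: (real \<times> real) measure) (borel :: real measure)"
    unfolding borel_prod[symmetric] by measurable
  then have "fst \<in> measurable K (borel :: real measure)"
    using measurable_restrict_space1 measurable_cong_sets[OF assms(1) refl] by metis
  then have meas: "fst \<in> measurable (restrict_space K (UNIV \<times> {0..t})) (borel :: real measure)"
    by (rule measurable_restrict_space1)
  have "emeasure (kappa K t) B =
      emeasure (restrict_space K (UNIV \<times> {0..t})) (fst -` B \<inter> space (restrict_space K (UNIV \<times> {0..t})))"
    unfolding kappa_def using meas assms(3) by (rule emeasure_distr)
  also have "fst -` B \<inter> space (restrict_space K (UNIV \<times> {0..t})) = B \<times> {0..t}"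
    using assms(2) unfolding space_restrict_space sp by auto
  also have "emeasure (restrict_space K (UNIV \<times> {0..t})) (B \<times> {0..t}) = emeasure K (B \<times> {0..t})"
  proof (rule emeasure_restrict_space)
    have "(UNIV \<times> {0..t}) \<inter> space K = UNIV \<times> {0..t}"
      using assms(2) unfolding sp by auto
    then show "(UNIV \<times> {0..t}) \<inter> space K \<in> sets K"
      using rect[of UNIV] by simp
  qed auto
  finally show ?thesis .
qed

definition locally_uniform_limit ::
  "'a::topological_space set \<Rightarrow> (nat \<Rightarrow> 'a \<Rightarrow> 'b::metric_space) \<Rightarrow> ('a \<Rightarrow> 'b) \<Rightarrow> bool" where
  "locally_uniform_limit S g h \<longleftrightarrow>
     (\<forall>C. compact C \<longrightarrow> C \<subseteq> S \<longrightarrow> uniform_limit C g h sequentially)"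

definition weak_limit_locally_uniform ::
  "'a::topological_space set \<Rightarrow> (nat \<Rightarrow> 'a \<Rightarrow> real measure) \<Rightarrow> ('a \<Rightarrow> real measure) \<Rightarrow> bool" where
  "weak_limit_locally_uniform S M N \<longleftrightarrow>
     (\<forall>\<phi>::real \<Rightarrow> real. continuous_on UNIV \<phi> \<longrightarrow> bounded (range \<phi>) \<longrightarrow>
        locally_uniform_limit S (\<lambda>n \<tau>. LINT x|M n \<tau>. \<phi> x) (\<lambda>\<tau>. LINT x|N \<tau>. \<phi> x))"

definition vague_limit_locally_uniform ::
  "'a::topological_space set \<Rightarrow> (nat \<Rightarrow> 'a \<Rightarrow> real measure) \<Rightarrow> ('a \<Rightarrow> real measure) \<Rightarrow> bool" where
  "vague_limit_locally_uniform S M N \<longleftrightarrow>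
     (\<forall>\<phi>::real \<Rightarrow> real. continuous_on UNIV \<phi> \<longrightarrow> compact (closure {x. \<phi> x \<noteq> 0}) \<longrightarrow>
        locally_uniform_limit S (\<lambda>n \<tau>. LINT x|M n \<tau>. \<phi> x) (\<lambda>\<tau>. LINT x|N \<tau>. \<phi> x))"

end

theory Submission
  imports Defs
begin

text \<open>Everything rests on the integral equation
  \<open>f s t z = z - m t + m s + \<integral> 1 / (x - f r t z) K(dx dr)\<close>, with the integral over \<open>\<real> \<times> [s, t]\<close>,
  on a compact time interval \<open>[0, T]\<close>. Since \<open>Im (f r t z) \<ge> Im z\<close>, its integrand is bounded by
  \<open>1 / Im z\<close> and Lipschitz in \<open>f r t z\<close> with constant \<open>1 / (Im z)\<^sup>2\<close>. The mass of \<open>K\<close> on \<open>\<real> \<times> [0, T]\<close> is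
  the variance of \<open>M 0 T\<close> (\<open>generator_mass_eq_variance\<close>), so the hypothesis on the variances makes
  all estimates below uniform in \<open>n\<close>.

  Convergence of measures is turned into convergence of holomorphic functions. Weak convergence of
  probability measures is pointwise convergence of the transforms \<open>F\<close>, and vague convergence of
  measures of bounded mass is pointwise convergence of the Cauchy transforms; the Poisson kernel leads
  back from the transforms to the measures. Because the limits are continuous, locally uniform
  convergence can be tested on sequences of parameters, which carries these facts over to families
  (\<open>test_limit_iff_transform_limit\<close>). Hence \<open>c1\<close> is equivalent to \<open>c3\<close> and \<open>c2\<close> to \<open>c4\<close>, and in \<open>c5\<close> the
  vague convergence of the marginals is that of \<open>J t w = \<integral> 1 / (x - w) \<kappa>\<^sub>t(dx)\<close>, the marginal transform.
  That \<open>c4\<close> implies \<open>c3\<close> is the case \<open>s = 0\<close>. Three implications remain.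

  From \<open>c3\<close> to \<open>c4\<close> and to the convergence of the drifts: as \<open>f 0 t z - z + m t\<close> is at most a constant
  divided by \<open>Im z\<close>, points high up in the half-plane show that the drifts converge. Then the values
  of the \<open>n\<close>-th evolution at \<open>(s, t, z)\<close> stay bounded, and every limit point \<open>w\<close> of them satisfies
  \<open>f 0 s w = f 0 t z = f 0 s (f s t z)\<close>. Injectivity of \<open>f 0 s\<close>, a consequence of Gronwall's
  inequality, identifies it.

  From \<open>c4\<close> to \<open>c5\<close>: over a fine grid \<open>0 = a\<^sub>0 \<le> \<dots> \<le> a\<^sub>N = t\<close>, the integral equation shows that \<open>J t z\<close> is
  close to \<open>m t\<close> plus the sum of the differences \<open>f a\<^sub>j a\<^sub>j\<^sub>+\<^sub>1 z - z\<close>. The error is at most the mass of \<open>K\<close>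
  times the largest \<open>|f r u z - z|\<close> with \<open>r, u\<close> in a common step, divided by \<open>(Im z)\<^sup>2\<close>. It is uniform
  in \<open>n\<close>, and the finite sum converges by \<open>c4\<close>.

  From \<open>c5\<close> to \<open>c4\<close>: put the limit \<open>f r t z\<close> into the integrals against both the \<open>n\<close>-th generator and
  \<open>K\<close>. After \<open>f r t z\<close> is frozen on the steps of a fine grid, the two integrals differ by finitely many
  increments of differences of marginal transforms, which are small by \<open>c5\<close>. Gronwall's inequality
  then bounds the difference of the evolutions.\<close>

section \<open>Locally uniform convergence by sequences\<close>

lemma locally_uniform_limitD:
  assumes "locally_uniform_limit S g h" "compact C" "C \<subseteq> S" "0 < e"
  shows "\<forall>\<^sub>F n in sequentially. \<forall>x\<in>C. dist (g n x) (h x) < e"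
  using assms unfolding locally_uniform_limit_def uniform_limit_iff by blast

text \<open>For a continuous limit, uniform convergence on compact sets is continuous convergence: bad
  points on a compact set accumulate, and a sequence of them contradicts convergence along
  sequences. The subsequence \<open>\<phi>\<close> of indices is there because failure of uniformity provides only
  infinitely many bad \<open>n\<close>.\<close>

lemma locally_uniform_limit_iff_sequences:
  fixes g :: "nat \<Rightarrow> 'a::heine_borel \<Rightarrow> 'b::metric_space"
  assumes cont: "continuous_on S h"
  shows "locally_uniform_limit S g h \<longleftrightarrow>
    (\<forall>\<phi> \<tau> l. strict_mono \<phi> \<longrightarrow> (\<forall>k. \<tau> k \<in> S) \<longrightarrow> l \<in> S \<longrightarrow> \<tau> \<longlonglongrightarrow> l \<longrightarrow>
       (\<lambda>k. g (\<phi> k) (\<tau> k)) \<longlonglongrightarrow> h l)"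
    (is "_ \<longleftrightarrow> ?seq")
proof
  assume lim: "locally_uniform_limit S g h"
  show ?seq
  proof (intro allI impI)
    fix \<phi> :: "nat \<Rightarrow> nat" and \<tau> l
    assume \<phi>: "strict_mono \<phi>" and \<tau>: "\<forall>k. \<tau> k \<in> S" "l \<in> S" "\<tau> \<longlonglongrightarrow> l"
    have C: "compact (insert l (range \<tau>))" "insert l (range \<tau>) \<subseteq> S"
      using compact_sequence_with_limit[OF \<tau>(3)] \<tau> by auto
    have h: "(\<lambda>k. h (\<tau> k)) \<longlonglongrightarrow> h l"
      using \<tau> by (intro continuous_on_tendsto_compose[OF cont \<tau>(3)]) auto
    show "(\<lambda>k. g (\<phi> k) (\<tau> k)) \<longlonglongrightarrow> h l"
    proof (rule metric_LIMSEQ_I)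
      fix e :: real assume "0 < e"
      then have "\<forall>\<^sub>F n in sequentially. \<forall>x\<in>insert l (range \<tau>). dist (g n x) (h x) < e / 2"
        using locally_uniform_limitD[OF lim C, of "e / 2"] by simp
      then have "\<forall>\<^sub>F k in sequentially. \<forall>x\<in>insert l (range \<tau>). dist (g (\<phi> k) x) (h x) < e / 2"
        using \<phi> by (rule eventually_subseq[rotated])
      moreover have "\<forall>\<^sub>F k in sequentially. dist (h (\<tau> k)) (h l) < e / 2"
        using tendstoD[OF h, of "e / 2"] \<open>0 < e\<close> by simp
      ultimately have "\<forall>\<^sub>F k in sequentially. dist (g (\<phi> k) (\<tau> k)) (h l) < e"
      proof eventually_elim
        case (elim k)
        then have "dist (g (\<phi> k) (\<tau> k)) (h (\<tau> k)) < e / 2" by blast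
        then show ?case using elim(2) dist_triangle_half_r by (metis dist_commute)
      qed
      then show "\<exists>no. \<forall>k\<ge>no. dist (g (\<phi> k) (\<tau> k)) (h l) < e"
        by (simp add: eventually_sequentially)
    qed
  qed
next
  assume seq: ?seq
  show "locally_uniform_limit S g h"
    unfolding locally_uniform_limit_def uniform_limit_iff
  proof (intro allI impI)
    fix C :: "'a set" and e :: real
    assume C: "compact C" "C \<subseteq> S" and "0 < e"
    show "\<forall>\<^sub>F n in sequentially. \<forall>x\<in>C. dist (g n x) (h x) < e"
    proof (rule ccontr)
      assume "\<not> ?thesis"
      then have "\<exists>\<^sub>F n in sequentially. \<exists>x\<in>C. e \<le> dist (g n x) (h x)"
        by (simp add: not_eventually not_less)
      then have "infinite {n. \<exists>x\<in>C. e \<le> dist (g n x) (h x)}"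
        by (simp add: cofinite_eq_sequentially[symmetric] frequently_cofinite)
      from infinite_enumerate[OF this] obtain \<phi> :: "nat \<Rightarrow> nat"
        where \<phi>: "strict_mono \<phi>" "\<And>k. \<exists>x\<in>C. e \<le> dist (g (\<phi> k) x) (h x)"
        by blast
      then obtain \<tau> where \<tau>: "\<And>k. \<tau> k \<in> C" "\<And>k. e \<le> dist (g (\<phi> k) (\<tau> k)) (h (\<tau> k))"
        by metis
      obtain l r where r: "l \<in> C" "strict_mono r" "(\<tau> \<circ> r) \<longlonglongrightarrow> l"
        using C(1) \<tau>(1) unfolding compact_def by blast
      have S: "\<forall>k. (\<tau> \<circ> r) k \<in> S" "l \<in> S"
        using \<tau>(1) r(1) C(2) by auto
      have "(\<lambda>k. g ((\<phi> \<circ> r) k) ((\<tau> \<circ> r) k)) \<longlonglongrightarrow> h l"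
        using seq S r(3) strict_mono_o[OF \<phi>(1) r(2)] by blast
      moreover have "(\<lambda>k. h ((\<tau> \<circ> r) k)) \<longlonglongrightarrow> h l"
        using S by (intro continuous_on_tendsto_compose[OF cont r(3)]) auto
      ultimately have "(\<lambda>k. dist (g ((\<phi> \<circ> r) k) ((\<tau> \<circ> r) k)) (h ((\<tau> \<circ> r) k))) \<longlonglongrightarrow> dist (h l) (h l)"
        by (rule tendsto_dist)
      then have "\<forall>\<^sub>F k in sequentially. dist (g ((\<phi> \<circ> r) k) ((\<tau> \<circ> r) k)) (h ((\<tau> \<circ> r) k)) < e"
        using \<open>0 < e\<close> by (simp add: order_tendsto_iff)
      then obtain k where "dist (g (\<phi> (r k)) (\<tau> (r k))) (h (\<tau> (r k))) < e"
        by (auto simp: eventually_sequentially)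
      with \<tau>(2) show False by (simp add: not_less[symmetric])
    qed
  qed
qed

lemma bounded_unique_limit_point:
  fixes w :: "nat \<Rightarrow> complex"
  assumes bdd: "bounded (range w)"
    and uniq: "\<And>r l'. strict_mono r \<Longrightarrow> (w \<circ> r) \<longlonglongrightarrow> l' \<Longrightarrow> l' = l"
  shows "w \<longlonglongrightarrow> l"
proof (rule ccontr)
  assume "\<not> w \<longlonglongrightarrow> l"
  then obtain e where e: "e > 0" "\<not> (\<forall>\<^sub>F k in sequentially. dist (w k) l < e)"
    by (auto simp: tendsto_iff)
  then have "infinite {n. e \<le> dist (w n) l}"
    by (simp add: cofinite_eq_sequentially[symmetric] eventually_cofinite not_less)
  from infinite_enumerate[OF this] obtain r :: "nat \<Rightarrow> nat"
    where r: "strict_mono r" "\<And>k. e \<le> dist (w (r k)) l"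
    by blast
  have "bounded (range (w \<circ> r))"
    using bdd by (rule bounded_subset) auto
  then obtain l' q where q: "strict_mono q" "((w \<circ> r) \<circ> q) \<longlonglongrightarrow> l'"
    using bounded_imp_convergent_subsequence by blast
  have "l' = l"
    using uniq[OF strict_mono_o[OF r(1) q(1)]] q(2) by (simp add: comp_assoc)
  then have "\<forall>\<^sub>F k in sequentially. dist (w (r (q k))) l < e"
    using q(2) e(1) by (simp add: tendsto_iff)
  then show False
    using r(2) by (auto simp: eventually_sequentially not_less[symmetric])
qed

section \<open>Vague convergence and Cauchy transforms\<close>

definition vague_conv :: "(nat \<Rightarrow> real measure) \<Rightarrow> real measure \<Rightarrow> bool" where
  "vague_conv \<nu> \<nu>' \<longleftrightarrow>
     (\<forall>\<phi>::real \<Rightarrow> real. continuous_on UNIV \<phi> \<longrightarrow> compact (closure {x. \<phi> x \<noteq> 0}) \<longrightarrow>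
        (\<lambda>k. LINT x|\<nu> k. \<phi> x) \<longlonglongrightarrow> (LINT x|\<nu>'. \<phi> x))"

lemma (in finite_measure) integrable_bounded:
  fixes f :: "'a \<Rightarrow> 'b::{banach,second_countable_topology}"
  assumes "f \<in> borel_measurable M" "\<And>x. norm (f x) \<le> B"
  shows "integrable M f"
  using assms by (intro integrable_const_bound[of _ B]) auto

lemma (in finite_measure) norm_integral_le_mass:
  fixes f :: "'a \<Rightarrow> 'b::{banach,second_countable_topology}"
  assumes "f \<in> borel_measurable M" "\<And>x. norm (f x) \<le> B"
  shows "norm (LINT x|M. f x) \<le> B * measure M (space M)"
proof -
  have "norm (LINT x|M. f x) \<le> (LINT x|M. norm (f x))"
    by (rule integral_norm_bound)
  also have "\<dots> \<le> (LINT x|M. B)"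
    using assms integrable_bounded[OF assms] by (intro integral_mono integrable_norm) auto
  finally show ?thesis by (simp add: mult.commute)
qed

text \<open>A uniform error in the test function costs at most that error times the mass. Bounded masses
  therefore allow a test function to be replaced by a nearby one.\<close>

lemma tendsto_integral_uniform_approx:
  fixes \<phi> :: "real \<Rightarrow> real"
  assumes \<nu>: "\<And>k. finite_borel_measure (\<nu> k)" "\<And>k. measure (\<nu> k) UNIV \<le> C"
    and \<nu>': "finite_borel_measure \<nu>'" "measure \<nu>' UNIV \<le> C"
    and \<phi>: "\<phi> \<in> borel_measurable borel" "\<And>x. \<bar>\<phi> x\<bar> \<le> B"
    and approx: "\<And>e. 0 < e \<Longrightarrow> \<exists>\<psi>. \<psi> \<in> borel_measurable borel \<and> (\<forall>x. \<bar>\<phi> x - \<psi> x\<bar> \<le> e) \<and>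
        (\<lambda>k. LINT x|\<nu> k. \<psi> x) \<longlonglongrightarrow> (LINT x|\<nu>'. \<psi> x)"
  shows "(\<lambda>k. LINT x|\<nu> k. \<phi> x) \<longlonglongrightarrow> (LINT x|\<nu>'. \<phi> x)"
proof (rule LIMSEQ_I)
  fix r :: real assume "0 < r"
  have C: "0 \<le> C" using \<nu>'(2) measure_nonneg order_trans by blast
  define e where "e = r / (3 * (C + 1))"
  have e: "0 < e" "e * C < r / 3"
    using \<open>0 < r\<close> C by (auto simp: e_def field_simps add_pos_nonneg)
  obtain \<psi> where \<psi>: "\<psi> \<in> borel_measurable borel" "\<And>x. \<bar>\<phi> x - \<psi> x\<bar> \<le> e"
    and lim: "(\<lambda>k. LINT x|\<nu> k. \<psi> x) \<longlonglongrightarrow> (LINT x|\<nu>'. \<psi> x)"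
    using approx[OF e(1)] by blast
  have near: "\<bar>(LINT x|\<mu>. \<phi> x) - (LINT x|\<mu>. \<psi> x)\<bar> < r / 3"
    if \<mu>: "finite_borel_measure \<mu>" "measure \<mu> UNIV \<le> C" for \<mu>
  proof -
    interpret finite_borel_measure \<mu> by fact
    have meas: "\<phi> \<in> borel_measurable \<mu>" "\<psi> \<in> borel_measurable \<mu>"
      using \<phi>(1) \<psi>(1) by (auto simp: measurable_cong_sets[OF M_is_borel refl])
    have "\<bar>\<psi> x\<bar> \<le> B + e" for x
      using \<phi>(2)[of x] \<psi>(2)[of x] by linarith
    then have "integrable \<mu> \<phi>" "integrable \<mu> \<psi>"
      using integrable_bounded[OF meas(1), of B] integrable_bounded[OF meas(2), of "B + e"] \<phi>(2) by auto
    then have "\<bar>(LINT x|\<mu>. \<phi> x) - (LINT x|\<mu>. \<psi> x)\<bar> = norm (LINT x|\<mu>. \<phi> x - \<psi> x)"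
      by simp
    also have "\<dots> \<le> e * measure \<mu> UNIV"
      using norm_integral_le_mass[of "\<lambda>x. \<phi> x - \<psi> x" e] meas \<psi>(2) by (simp add: borel_UNIV)
    also have "\<dots> \<le> e * C"
      using \<mu>(2) e(1) by simp
    finally show ?thesis using e(2) by simp
  qed
  obtain N where N: "\<And>k. k \<ge> N \<Longrightarrow> norm ((LINT x|\<nu> k. \<psi> x) - (LINT x|\<nu>'. \<psi> x)) < r / 3"
    using LIMSEQ_D[OF lim, of "r / 3"] \<open>0 < r\<close> by auto
  show "\<exists>no. \<forall>k\<ge>no. norm ((LINT x|\<nu> k. \<phi> x) - (LINT x|\<nu>'. \<phi> x)) < r"
  proof (intro exI allI impI)
    fix k assume "k \<ge> N"
    with N[OF this] near[OF \<nu>, of k] near[OF \<nu>'] show "norm ((LINT x|\<nu> k. \<phi> x) - (LINT x|\<nu>'. \<phi> x)) < r"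
      by (simp add: abs_if split: if_splits)
  qed
qed

definition cutoff :: "real \<Rightarrow> real \<Rightarrow> real" where
  "cutoff R x = max 0 (min 1 (R + 1 - \<bar>x\<bar>))"

lemma cutoff: "0 \<le> cutoff R x" "cutoff R x \<le> 1" "\<bar>x\<bar> \<le> R \<Longrightarrow> cutoff R x = 1"
  "continuous_on UNIV (cutoff R)"
  by (auto simp: cutoff_def intro!: continuous_intros)

lemma compact_support_cutoff: "compact (closure {x. cutoff R x * \<phi> x \<noteq> 0})"
proof -
  have "{x. cutoff R x * \<phi> x \<noteq> 0} \<subseteq> cball 0 (R + 1)"
    by (auto simp: cutoff_def max_def min_def split: if_splits)
  then show ?thesis
    using bounded_subset[OF bounded_cball] by (simp add: compact_closure)
qed

text \<open>Bounded masses extend vague convergence to test functions that vanish at infinity, which the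
  kernel \<open>1 / (z - x)\<close> does while failing to have compact support.\<close>

lemma vague_conv_vanishing_at_infinity:
  fixes \<phi> :: "real \<Rightarrow> real"
  assumes \<nu>: "\<And>k. finite_borel_measure (\<nu> k)" "\<And>k. measure (\<nu> k) UNIV \<le> C"
    and \<nu>': "finite_borel_measure \<nu>'" "measure \<nu>' UNIV \<le> C"
    and vague: "vague_conv \<nu> \<nu>'"
    and \<phi>: "continuous_on UNIV \<phi>" "\<And>x. \<bar>\<phi> x\<bar> \<le> B" "(\<phi> \<longlongrightarrow> 0) at_infinity"
  shows "(\<lambda>k. LINT x|\<nu> k. \<phi> x) \<longlonglongrightarrow> (LINT x|\<nu>'. \<phi> x)"
proof (rule tendsto_integral_uniform_approx[OF \<nu> \<nu>' _ \<phi>(2)])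
  show "\<phi> \<in> borel_measurable borel"
    using \<phi>(1) by (rule borel_measurable_continuous_onI)
next
  fix e :: real assume "0 < e"
  then have "\<forall>\<^sub>F x in at_infinity. \<bar>\<phi> x\<bar> < e"
    using \<phi>(3) by (auto simp: tendsto_iff)
  then obtain R where R: "\<And>x. R \<le> \<bar>x\<bar> \<Longrightarrow> \<bar>\<phi> x\<bar> < e"
    unfolding eventually_at_infinity by auto
  define \<psi> where "\<psi> x = cutoff R x * \<phi> x" for x
  have cont: "continuous_on UNIV \<psi>"
    unfolding \<psi>_def by (intro continuous_intros \<phi>(1) cutoff)
  have "\<bar>\<phi> x - \<psi> x\<bar> \<le> e" for x
  proof (cases "\<bar>x\<bar> \<le> R")
    case True then show ?thesis using \<open>0 < e\<close> by (simp add: \<psi>_def cutoff(3))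
  next
    case False
    have "\<phi> x - \<psi> x = (1 - cutoff R x) * \<phi> x"
      by (simp add: \<psi>_def left_diff_distrib)
    then have "\<bar>\<phi> x - \<psi> x\<bar> = (1 - cutoff R x) * \<bar>\<phi> x\<bar>"
      using cutoff(2)[of R x] by (simp add: abs_mult)
    also have "\<dots> \<le> 1 * \<bar>\<phi> x\<bar>"
      using cutoff(1)[of R x] by (intro mult_right_mono) auto
    finally show ?thesis using R[of x] False by simp
  qed
  moreover have "(\<lambda>k. LINT x|\<nu> k. \<psi> x) \<longlonglongrightarrow> (LINT x|\<nu>'. \<psi> x)"
    using vague cont compact_support_cutoff[of R \<phi>] unfolding vague_conv_def \<psi>_def by blast
  ultimately show "\<exists>\<psi>. \<psi> \<in> borel_measurable borel \<and> (\<forall>x. \<bar>\<phi> x - \<psi> x\<bar> \<le> e) \<and>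
        (\<lambda>k. LINT x|\<nu> k. \<psi> x) \<longlonglongrightarrow> (LINT x|\<nu>'. \<psi> x)"
    using borel_measurable_continuous_onI[OF cont] by blast
qed

lemma norm_diff_of_real_ge: "\<bar>Im z\<bar> \<le> norm (z - of_real x)"
  using abs_Im_le_cmod[of "z - of_real x"] by simp

lemma kernel_nonzero: "Im z > 0 \<Longrightarrow> z - of_real x \<noteq> 0"
  by (auto simp: complex_eq_iff)

lemma norm_kernel_le: "Im z > 0 \<Longrightarrow> norm (1 / (z - of_real x)) \<le> 1 / Im z"
  using norm_diff_of_real_ge[of z x] by (auto simp: norm_divide intro!: divide_left_mono mult_pos_pos)

lemma norm_kernel_diff_le:
  assumes "0 < y" "y \<le> Im z" "y \<le> Im w"
  shows "norm (1 / (z - of_real x) - 1 / (w - of_real x)) \<le> norm (z - w) / y\<^sup>2"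
proof -
  have nz: "z - of_real x \<noteq> 0" "w - of_real x \<noteq> 0"
    using assms by (auto intro: kernel_nonzero)
  have "y * y \<le> norm (z - of_real x) * norm (w - of_real x)"
    using assms norm_diff_of_real_ge[of z x] norm_diff_of_real_ge[of w x] by (intro mult_mono) auto
  then have "norm (w - z) / (norm (z - of_real x) * norm (w - of_real x)) \<le> norm (w - z) / (y * y)"
    using assms nz by (intro divide_left_mono) auto
  moreover have "1 / (z - of_real x) - 1 / (w - of_real x) = (w - z) / ((z - of_real x) * (w - of_real x))"
    using nz by (simp add: field_simps)
  ultimately show ?thesis
    by (simp add: norm_divide norm_mult norm_minus_commute power2_eq_square)
qed

lemma continuous_on_kernel: "Im z > 0 \<Longrightarrow> continuous_on UNIV (\<lambda>x. 1 / (z - complex_of_real x))"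
  using kernel_nonzero by (intro continuous_intros) auto

lemma kernel_measurable [measurable]: "Im z > 0 \<Longrightarrow> (\<lambda>x. 1 / (z - complex_of_real x)) \<in> borel_measurable borel"
  by (rule borel_measurable_continuous_onI[OF continuous_on_kernel])

lemma kernel_tendsto_0: "((\<lambda>x. 1 / (z - complex_of_real x)) \<longlongrightarrow> 0) at_infinity"
proof (rule Lim_null_comparison)
  show "\<forall>\<^sub>F x in at_infinity. norm (1 / (z - complex_of_real x)) \<le> 2 / norm x"
    unfolding eventually_at_infinity
  proof (intro exI[of _ "2 * norm z + 1"] allI impI)
    fix x :: real assume x: "2 * norm z + 1 \<le> norm x"
    have "norm x - norm z \<le> norm (z - of_real x)"
      using norm_triangle_ineq2[of "complex_of_real x" z] by (simp add: norm_minus_commute)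
    then have "norm x / 2 \<le> norm (z - of_real x)" "0 < norm x"
      using x norm_ge_zero[of z] by linarith+
    then have "1 / norm (z - of_real x) \<le> 1 / (norm x / 2)"
      by (intro divide_left_mono) (auto intro!: mult_pos_pos)
    then show "norm (1 / (z - complex_of_real x)) \<le> 2 / norm x"
      by (simp add: norm_divide)
  qed
  show "((\<lambda>x::real. 2 / norm x) \<longlongrightarrow> 0) at_infinity"
    by (rule real_tendsto_divide_at_top[OF tendsto_const filterlim_norm_at_top])
qed

context finite_borel_measure
begin

lemma integrable_kernel: "Im z > 0 \<Longrightarrow> integrable M (\<lambda>x. 1 / (z - complex_of_real x))"
  by (rule integrable_bounded[where B = "1 / Im z"])
    (auto simp: measurable_cong_sets[OF M_is_borel refl] intro: norm_kernel_le)

lemma Cauchy_transform_lipschitz: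
  assumes "0 < y" "y \<le> Im z" "y \<le> Im w"
  shows "norm (Cauchy_transform M z - Cauchy_transform M w) \<le> norm (z - w) / y\<^sup>2 * measure M UNIV"
proof -
  have "norm (LINT x|M. 1 / (z - complex_of_real x) - 1 / (w - of_real x)) \<le> norm (z - w) / y\<^sup>2 * measure M (space M)"
    using assms by (intro norm_integral_le_mass norm_kernel_diff_le)
      (auto simp: measurable_cong_sets[OF M_is_borel refl])
  then show ?thesis
    using assms integrable_kernel by (simp add: Cauchy_transform_def borel_UNIV)
qed

lemma norm_Cauchy_transform_le:
  assumes "Im z > 0"
  shows "norm (Cauchy_transform M z) \<le> measure M UNIV / Im z"
  using norm_integral_le_mass[of "\<lambda>x. 1 / (z - of_real x)", OF _ norm_kernel_le[OF assms]] assms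
  by (simp add: Cauchy_transform_def borel_UNIV measurable_cong_sets[OF M_is_borel refl])

lemma Re_Im_Cauchy_transform:
  assumes "Im z > 0"
  shows "Re (Cauchy_transform M z) = (LINT x|M. Re (1 / (z - of_real x)))"
    "Im (Cauchy_transform M z) = (LINT x|M. Im (1 / (z - of_real x)))"
  using integrable_kernel[OF assms] by (auto simp: Cauchy_transform_def)

end

text \<open>The point of evaluation may move with \<open>k\<close> because the Cauchy transforms of measures of
  bounded mass are equi-Lipschitz on \<open>Im z \<ge> y\<close>.\<close>

lemma vague_conv_imp_Cauchy_transform:
  assumes \<nu>: "\<And>k. finite_borel_measure (\<nu> k)" "\<And>k. measure (\<nu> k) UNIV \<le> C"
    and \<nu>': "finite_borel_measure \<nu>'" "measure \<nu>' UNIV \<le> C"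
    and vague: "vague_conv \<nu> \<nu>'"
    and z: "\<And>k. Im (\<zeta> k) > 0" "Im z > 0" "\<zeta> \<longlonglongrightarrow> z"
  shows "(\<lambda>k. Cauchy_transform (\<nu> k) (\<zeta> k)) \<longlonglongrightarrow> Cauchy_transform \<nu>' z"
proof -
  have C: "0 \<le> C" using \<nu>'(2) measure_nonneg order_trans by blast
  note bound = norm_kernel_le[OF z(2)]
  have lim: "(\<lambda>k. LINT x|\<nu> k. p (1 / (z - of_real x))) \<longlonglongrightarrow> (LINT x|\<nu>'. p (1 / (z - of_real x)))"
    if p: "continuous_on UNIV p" "\<And>w. \<bar>p w\<bar> \<le> norm w" for p :: "complex \<Rightarrow> real"
  proof (rule vague_conv_vanishing_at_infinity[OF \<nu> \<nu>' vague])
    show "continuous_on UNIV (\<lambda>x. p (1 / (z - of_real x)))"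
      by (rule continuous_on_compose2[OF p(1) continuous_on_kernel[OF z(2)]]) auto
    show "\<bar>p (1 / (z - complex_of_real x))\<bar> \<le> 1 / Im z" for x
      using bound p(2) order_trans by blast
    show "((\<lambda>x. p (1 / (z - complex_of_real x))) \<longlongrightarrow> 0) at_infinity"
      using tendsto_norm_zero[OF kernel_tendsto_0[of z]] by (rule Lim_null_comparison[rotated]) (simp add: p(2))
  qed
  have "(\<lambda>k. Complex (Re (Cauchy_transform (\<nu> k) z)) (Im (Cauchy_transform (\<nu> k) z))) \<longlonglongrightarrow>
      Complex (Re (Cauchy_transform \<nu>' z)) (Im (Cauchy_transform \<nu>' z))"
    unfolding finite_borel_measure.Re_Im_Cauchy_transform[OF \<nu>(1) z(2)]
      finite_borel_measure.Re_Im_Cauchy_transform[OF \<nu>'(1) z(2)]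
    by (intro tendsto_Complex lim) (auto intro!: continuous_intros abs_Re_le_cmod abs_Im_le_cmod)
  then have main: "(\<lambda>k. Cauchy_transform (\<nu> k) z) \<longlonglongrightarrow> Cauchy_transform \<nu>' z" by simp
  have "(\<lambda>k. Cauchy_transform (\<nu> k) (\<zeta> k) - Cauchy_transform (\<nu> k) z) \<longlonglongrightarrow> 0"
  proof (rule Lim_null_comparison)
    have "\<forall>\<^sub>F k in sequentially. Im z / 2 < Im (\<zeta> k)"
      using tendsto_Im[OF z(3)] z(2) by (intro order_tendstoD) auto
    then show "\<forall>\<^sub>F k in sequentially. norm (Cauchy_transform (\<nu> k) (\<zeta> k) - Cauchy_transform (\<nu> k) z)
        \<le> norm (\<zeta> k - z) / (Im z / 2)\<^sup>2 * C"
    proof eventually_elim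
      case (elim k)
      have "norm (Cauchy_transform (\<nu> k) (\<zeta> k) - Cauchy_transform (\<nu> k) z)
          \<le> norm (\<zeta> k - z) / (Im z / 2)\<^sup>2 * measure (\<nu> k) UNIV"
        using elim z(2) by (intro finite_borel_measure.Cauchy_transform_lipschitz[OF \<nu>(1)]) auto
      also have "\<dots> \<le> norm (\<zeta> k - z) / (Im z / 2)\<^sup>2 * C"
        using \<nu>(2)[of k] by (intro mult_left_mono) auto
      finally show ?case .
    qed
    have "(\<lambda>k. norm (\<zeta> k - z)) \<longlonglongrightarrow> 0"
      using z(3) by (simp add: LIM_zero_iff tendsto_norm_zero_iff)
    then have "(\<lambda>k. norm (\<zeta> k - z) * (C / (Im z / 2)\<^sup>2)) \<longlonglongrightarrow> 0"
      by (rule tendsto_mult_left_zero)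
    then show "(\<lambda>k. norm (\<zeta> k - z) / (Im z / 2)\<^sup>2 * C) \<longlonglongrightarrow> 0" by (simp add: mult.commute)
  qed
  from tendsto_add[OF this main] show ?thesis by simp
qed

lemma continuous_on_Cauchy_transform:
  assumes "finite_borel_measure \<mu>"
  shows "continuous_on upper_half_plane (Cauchy_transform \<mu>)"
  unfolding continuous_on_sequentially comp_def
proof (intro allI impI ballI)
  fix \<zeta> z assume *: "z \<in> upper_half_plane" "(\<forall>k. \<zeta> k \<in> upper_half_plane) \<and> \<zeta> \<longlonglongrightarrow> z"
  have "vague_conv (\<lambda>_. \<mu>) \<mu>" by (simp add: vague_conv_def)
  then show "(\<lambda>k. Cauchy_transform \<mu> (\<zeta> k)) \<longlonglongrightarrow> Cauchy_transform \<mu> z"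
    using * assms by (intro vague_conv_imp_Cauchy_transform[where \<nu> = "\<lambda>_. \<mu>" and C = "measure \<mu> UNIV"])
      (auto simp: upper_half_plane_def)
qed

lemma uniformly_continuous_of_compact_support:
  fixes \<phi> :: "real \<Rightarrow> real"
  assumes "continuous_on UNIV \<phi>" "compact (closure {x. \<phi> x \<noteq> 0})"
  shows "uniformly_continuous_on UNIV \<phi>"
proof -
  obtain R where R: "\<And>x. \<phi> x \<noteq> 0 \<Longrightarrow> \<bar>x\<bar> \<le> R"
    using compact_imp_bounded[OF assms(2)] closure_subset[of "{x. \<phi> x \<noteq> 0}"] unfolding bounded_iff by force
  have uc: "uniformly_continuous_on (cball 0 (R + 1)) \<phi>"
    using assms(1) by (intro compact_uniformly_continuous) (auto intro: continuous_on_subset)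
  show ?thesis
    unfolding uniformly_continuous_on_def
  proof (intro allI impI)
    fix e :: real assume "0 < e"
    then obtain d where d: "0 < d"
      "\<And>x x'. x \<in> cball 0 (R + 1) \<Longrightarrow> x' \<in> cball 0 (R + 1) \<Longrightarrow> dist x' x < d \<Longrightarrow> dist (\<phi> x') (\<phi> x) < e"
      using uc unfolding uniformly_continuous_on_def by blast
    have "dist (\<phi> x') (\<phi> x) < e" if "dist x' x < min d 1" for x x'
    proof (cases "x \<in> cball 0 (R + 1) \<and> x' \<in> cball 0 (R + 1)")
      case True then show ?thesis using d(2) that by auto
    next
      case False
      then have "\<bar>x\<bar> > R" "\<bar>x'\<bar> > R" using that by (auto simp: dist_real_def)
      then have "\<phi> x = 0" "\<phi> x' = 0" using R by force+
      then show ?thesis using \<open>0 < e\<close> by simp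
    qed
    then show "\<exists>d>0. \<forall>x\<in>UNIV. \<forall>x'\<in>UNIV. dist x' x < d \<longrightarrow> dist (\<phi> x') (\<phi> x) < e"
      using d(1) by (intro exI[of _ "min d 1"]) auto
  qed
qed

lemma bounded_of_compact_support:
  fixes \<phi> :: "real \<Rightarrow> real"
  assumes "continuous_on UNIV \<phi>" "compact (closure {x. \<phi> x \<noteq> 0})"
  obtains B where "0 \<le> B" "\<And>x. \<bar>\<phi> x\<bar> \<le> B"
proof -
  have "bounded (\<phi> ` closure {x. \<phi> x \<noteq> 0})"
    using assms by (intro compact_imp_bounded compact_continuous_image) (auto intro: continuous_on_subset)
  then obtain B where B: "\<And>x. x \<in> closure {x. \<phi> x \<noteq> 0} \<Longrightarrow> \<bar>\<phi> x\<bar> \<le> B"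
    unfolding bounded_iff by auto
  have "\<bar>\<phi> x\<bar> \<le> max 0 B" for x
    using B[of x] closure_subset[of "{x. \<phi> x \<noteq> 0}"] by (cases "\<phi> x = 0") (auto simp: max_def)
  then show ?thesis by (intro that[of "max 0 B"]) auto
qed

lemma compact_support_integrable:
  fixes \<phi> :: "real \<Rightarrow> real"
  assumes "continuous_on UNIV \<phi>" "compact (closure {x. \<phi> x \<noteq> 0})"
  shows "integrable lborel \<phi>"
proof -
  have "set_integrable lborel (closure {x. \<phi> x \<noteq> 0}) \<phi>"
    using assms unfolding set_integrable_def
    by (intro borel_integrable_compact) (auto intro: continuous_on_subset)
  moreover have "(\<lambda>x. indicator (closure {x. \<phi> x \<noteq> 0}) x *\<^sub>R \<phi> x) = \<phi>"
    using closure_subset[of "{x. \<phi> x \<noteq> 0}"] by (auto simp: fun_eq_iff indicator_def)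
  ultimately show ?thesis by (simp add: set_integrable_def)
qed

text \<open>The convolution of \<open>\<phi>\<close> with the Poisson kernel of height \<open>y\<close>. The kernel is written as an
  imaginary part so that integrating the average against a measure produces its Cauchy transform.\<close>

definition poisson_average :: "real \<Rightarrow> (real \<Rightarrow> real) \<Rightarrow> real \<Rightarrow> real" where
  "poisson_average y \<phi> x = (LBINT u. \<phi> u * - Im (1 / (Complex u y - of_real x))) / pi"

lemma Cauchy_density_integrable: "integrable lborel (\<lambda>v::real. 1 / (1 + v\<^sup>2))"
  using integrable_inverse_1_plus_square by (simp add: set_integrable_def inverse_eq_divide)

lemma Cauchy_density_integral: "(LBINT v::real. 1 / (1 + v\<^sup>2)) = pi"
  using LBINT_inverse_1_plus_square
  by (simp add: interval_lebesgue_integral_def set_lebesgue_integral_def inverse_eq_divide)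

lemma poisson_kernel: "- Im (1 / (Complex u y - of_real x)) = y / ((u - x)\<^sup>2 + y\<^sup>2)"
  by (simp add: Im_divide)

text \<open>Scaling by \<open>u = x + y v\<close> moves the dependence on \<open>x\<close> and \<open>y\<close> from the kernel into \<open>\<phi>\<close>.\<close>

lemma poisson_average_substitution:
  assumes "0 < y" "\<phi> \<in> borel_measurable borel"
  shows "poisson_average y \<phi> x = (LBINT v. \<phi> (x + y * v) * (1 / (1 + v\<^sup>2))) / pi"
proof -
  have "(LBINT u. \<phi> u * (y / ((u - x)\<^sup>2 + y\<^sup>2))) =
      \<bar>y\<bar> *\<^sub>R (LBINT v. \<phi> (x + y * v) * (y / ((x + y * v - x)\<^sup>2 + y\<^sup>2)))"
    using assms(1) by (intro lborel_integral_real_affine) auto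
  also have "\<dots> = (LBINT v. y * (\<phi> (x + y * v) * (y / ((x + y * v - x)\<^sup>2 + y\<^sup>2))))"
    unfolding integral_mult_right_zero using assms(1) by simp
  also have "\<dots> = (LBINT v. \<phi> (x + y * v) * (1 / (1 + v\<^sup>2)))"
  proof (rule Bochner_Integration.integral_cong[OF refl])
    fix v
    have "y * (y / ((x + y * v - x)\<^sup>2 + y\<^sup>2)) = (y * y) / ((y * y) * (1 + v\<^sup>2))"
      by (simp add: power2_eq_square algebra_simps)
    also have "\<dots> = 1 / (1 + v\<^sup>2)"
      using mult_divide_mult_cancel_left[of "y * y" 1 "1 + v\<^sup>2"] assms(1) by simp
    finally show "y * (\<phi> (x + y * v) * (y / ((x + y * v - x)\<^sup>2 + y\<^sup>2))) = \<phi> (x + y * v) * (1 / (1 + v\<^sup>2))"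
      by (metis (no_types, opaque_lifting) mult.left_commute)
  qed
  finally show ?thesis
    by (simp add: poisson_average_def poisson_kernel)
qed

lemma Cauchy_density_tail:
  assumes "0 < e"
  obtains R where "0 < R" "(LBINT v. indicator {v::real. R \<le> \<bar>v\<bar>} v * (1 / (1 + v\<^sup>2))) < e"
proof -
  have "(\<lambda>n. LBINT v. indicator {v::real. real (Suc n) \<le> \<bar>v\<bar>} v * (1 / (1 + v\<^sup>2))) \<longlonglongrightarrow> (LBINT v::real. 0)"
  proof (rule integral_dominated_convergence[where w = "\<lambda>v. 1 / (1 + v\<^sup>2)"])
    show "AE v::real in lborel. (\<lambda>n. indicator {v. real (Suc n) \<le> \<bar>v\<bar>} v * (1 / (1 + v\<^sup>2))) \<longlonglongrightarrow> 0"
    proof (intro AE_I2 tendsto_eventually)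
      fix v :: real
      obtain N where "\<bar>v\<bar> < real N" using reals_Archimedean2 by blast
      then show "\<forall>\<^sub>F n in sequentially. indicator {v. real (Suc n) \<le> \<bar>v\<bar>} v * (1 / (1 + v\<^sup>2)) = (0::real)"
        unfolding eventually_sequentially by (intro exI[of _ N]) (auto simp: indicator_def)
    qed
  qed (use Cauchy_density_integrable in \<open>auto simp: indicator_def\<close>)
  then have "\<forall>\<^sub>F n in sequentially. (LBINT v. indicator {v::real. real (Suc n) \<le> \<bar>v\<bar>} v * (1 / (1 + v\<^sup>2))) < e"
    using assms by (intro order_tendstoD) auto
  then obtain n where "(LBINT v. indicator {v::real. real (Suc n) \<le> \<bar>v\<bar>} v * (1 / (1 + v\<^sup>2))) < e"
    by (auto simp: eventually_sequentially)
  then show ?thesis by (intro that[of "real (Suc n)"]) auto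
qed

text \<open>The fixed density \<open>1 / (1 + v\<^sup>2)\<close> has little mass on \<open>|v| \<ge> R\<close>; for \<open>|v| < R\<close> and \<open>y = \<delta> /
  R\<close> the argument of \<open>\<phi>\<close> moves by less than the \<open>\<delta>\<close> of uniform continuity.\<close>

lemma poisson_average_uniform_approx:
  fixes \<phi> :: "real \<Rightarrow> real"
  assumes uc: "uniformly_continuous_on UNIV \<phi>" and B: "0 \<le> B" "\<And>x. \<bar>\<phi> x\<bar> \<le> B" and "0 < e"
  obtains y where "0 < y" "\<And>x. \<bar>\<phi> x - poisson_average y \<phi> x\<bar> \<le> e"
proof -
  obtain d where d: "0 < d" "\<And>x x'. \<bar>x' - x\<bar> < d \<Longrightarrow> \<bar>\<phi> x' - \<phi> x\<bar> < e / 2"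
    using uc \<open>0 < e\<close> unfolding uniformly_continuous_on_def dist_real_def by (metis half_gt_zero UNIV_I)
  obtain R where R: "0 < R" "(LBINT v. indicator {v::real. R \<le> \<bar>v\<bar>} v * (1 / (1 + v\<^sup>2))) < e / (2 * B + 1)"
    using Cauchy_density_tail[of "e / (2 * B + 1)"] \<open>0 < e\<close> B(1) by auto
  define y where "y = d / R"
  have y: "0 < y" using d(1) R(1) by (simp add: y_def)
  have [measurable]: "\<phi> \<in> borel_measurable borel"
    using uniformly_continuous_imp_continuous[OF uc] by (rule borel_measurable_continuous_onI)
  note int = Cauchy_density_integrable
  have int\<phi>: "integrable lborel (\<lambda>v. \<phi> (x + y * v) * (1 / (1 + v\<^sup>2)))" for x
    by (rule Bochner_Integration.integrable_bound[OF integrable_mult_right[OF int, of B]])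
      (use B in \<open>auto intro!: divide_right_mono\<close>)
  have intI: "integrable lborel (\<lambda>v. indicator {v::real. R \<le> \<bar>v\<bar>} v * (1 / (1 + v\<^sup>2)))"
    by (rule Bochner_Integration.integrable_bound[OF int]) (auto simp: indicator_def)
  have "\<bar>\<phi> x - poisson_average y \<phi> x\<bar> \<le> e" for x
  proof -
    have "pi * (\<phi> x - poisson_average y \<phi> x) = (LBINT v. \<phi> x * (1 / (1 + v\<^sup>2))) - (LBINT v. \<phi> (x + y * v) * (1 / (1 + v\<^sup>2)))"
      unfolding integral_mult_right_zero Cauchy_density_integral
      by (simp add: poisson_average_substitution[OF y] right_diff_distrib)
    also have "\<dots> = (LBINT v. \<phi> x * (1 / (1 + v\<^sup>2)) - \<phi> (x + y * v) * (1 / (1 + v\<^sup>2)))"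
      by (rule Bochner_Integration.integral_diff[symmetric, OF integrable_mult_right[OF int] int\<phi>])
    finally have "\<bar>pi * (\<phi> x - poisson_average y \<phi> x)\<bar>
        \<le> (LBINT v. norm (\<phi> x * (1 / (1 + v\<^sup>2)) - \<phi> (x + y * v) * (1 / (1 + v\<^sup>2))))"
      using integral_norm_bound[of lborel "\<lambda>v. \<phi> x * (1 / (1 + v\<^sup>2)) - \<phi> (x + y * v) * (1 / (1 + v\<^sup>2))"]
      by simp
    also have "\<dots> \<le> (LBINT v. e / 2 * (1 / (1 + v\<^sup>2)) + 2 * B * (indicator {v::real. R \<le> \<bar>v\<bar>} v * (1 / (1 + v\<^sup>2))))"
    proof (rule integral_mono)
      fix v :: real
      have "\<bar>\<phi> x - \<phi> (x + y * v)\<bar> \<le> e / 2 + 2 * B * indicator {v::real. R \<le> \<bar>v\<bar>} v"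
      proof (cases "R \<le> \<bar>v\<bar>")
        case True
        then show ?thesis using B(2)[of x] B(2)[of "x + y * v"] \<open>0 < e\<close> by (simp add: indicator_def)
      next
        case False
        then have "\<bar>x - (x + y * v)\<bar> < d"
          using R(1) d(1) by (simp add: y_def abs_mult field_simps)
        then show ?thesis using d(2) False by (simp add: indicator_def less_imp_le)
      qed
      then have "\<bar>\<phi> x - \<phi> (x + y * v)\<bar> * (1 / (1 + v\<^sup>2))
          \<le> (e / 2 + 2 * B * indicator {v::real. R \<le> \<bar>v\<bar>} v) * (1 / (1 + v\<^sup>2))"
        by (rule mult_right_mono) simp
      then show "norm (\<phi> x * (1 / (1 + v\<^sup>2)) - \<phi> (x + y * v) * (1 / (1 + v\<^sup>2)))
          \<le> e / 2 * (1 / (1 + v\<^sup>2)) + 2 * B * (indicator {v::real. R \<le> \<bar>v\<bar>} v * (1 / (1 + v\<^sup>2)))"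
        by (simp only: left_diff_distrib[symmetric] real_norm_def abs_mult distrib_right mult.assoc) simp
    qed (intro integrable_norm Bochner_Integration.integrable_diff Bochner_Integration.integrable_add
        integrable_mult_right int int\<phi> intI)+
    also have "\<dots> = e / 2 * pi + 2 * B * (LBINT v. indicator {v::real. R \<le> \<bar>v\<bar>} v * (1 / (1 + v\<^sup>2)))"
      unfolding Bochner_Integration.integral_add[OF integrable_mult_right[OF int] integrable_mult_right[OF intI]]
        integral_mult_right_zero Cauchy_density_integral ..
    also have "\<dots> \<le> e / 2 * pi + 2 * B * (e / (2 * B + 1))"
      using R(2) B(1) by (intro add_left_mono mult_left_mono) auto
    also have "\<dots> \<le> e / 2 * pi + e"
      using B(1) \<open>0 < e\<close> by (simp add: field_simps)
    also have "\<dots> \<le> pi * e"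
    proof -
      have "e * 2 \<le> e * pi" using pi_ge_two \<open>0 < e\<close> by (intro mult_left_mono) auto
      then show ?thesis by (simp add: field_simps)
    qed
    finally show ?thesis using pi_gt_zero by (simp add: abs_mult)
  qed
  with y show ?thesis by (rule that)
qed

lemma poisson_average_measurable:
  assumes [measurable]: "\<phi> \<in> borel_measurable borel"
  shows "poisson_average y \<phi> \<in> borel_measurable borel"
  unfolding poisson_average_def[abs_def] poisson_kernel by measurable

text \<open>By Fubini, a Poisson average sees the measure only through its Cauchy transform on the line
  \<open>Im z = y\<close>.\<close>

lemma (in finite_borel_measure) integral_poisson_average:
  fixes \<phi> :: "real \<Rightarrow> real"
  assumes "0 < y" and \<phi>: "continuous_on UNIV \<phi>" "compact (closure {x. \<phi> x \<noteq> 0})"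
  shows "(LINT x|M. poisson_average y \<phi> x) = (LBINT u. \<phi> u * - Im (Cauchy_transform M (Complex u y))) / pi"
proof -
  interpret pair_sigma_finite M lborel
    by (intro pair_sigma_finite.intro sigma_finite_measure_axioms sigma_finite_lborel)
  define h where "h x u = \<phi> u * - Im (1 / (Complex u y - of_real x))" for x u
  have [measurable]: "\<phi> \<in> borel_measurable borel"
    using \<phi>(1) by (rule borel_measurable_continuous_onI)
  have [measurable]: "id \<in> measurable M borel"
    by (simp add: measurable_cong_sets[OF M_is_borel refl])
  have h: "h = (\<lambda>x u. \<phi> u * (y / ((u - id x)\<^sup>2 + y\<^sup>2)))"
    unfolding h_def poisson_kernel by simp
  have meas [measurable]: "case_prod h \<in> borel_measurable (M \<Otimes>\<^sub>M lborel)"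
    unfolding h by measurable
  have bound: "norm (h x u) \<le> \<bar>\<phi> u\<bar> / y" for x u
  proof -
    have "y / ((u - x)\<^sup>2 + y\<^sup>2) \<le> y / y\<^sup>2"
      using assms(1) by (intro divide_left_mono) (auto intro!: mult_pos_pos add_nonneg_pos)
    then have "\<bar>\<phi> u\<bar> * (y / ((u - x)\<^sup>2 + y\<^sup>2)) \<le> \<bar>\<phi> u\<bar> * (1 / y)"
      using assms(1) by (intro mult_left_mono) (auto simp: power2_eq_square)
    moreover have "\<bar>y / ((u - x)\<^sup>2 + y\<^sup>2)\<bar> = y / ((u - x)\<^sup>2 + y\<^sup>2)"
      using assms(1) by simp
    ultimately show ?thesis by (simp only: h abs_mult real_norm_def id_apply) simp
  qed
  have int_\<phi>: "integrable lborel (\<lambda>u. \<bar>\<phi> u\<bar> / y)"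
    using compact_support_integrable[OF \<phi>] by simp
  have int_h: "integrable lborel (h x)" for x
  proof (rule Bochner_Integration.integrable_bound[OF int_\<phi>])
    show "h x \<in> borel_measurable lborel" unfolding h by measurable
    show "AE u in lborel. norm (h x u) \<le> norm (\<bar>\<phi> u\<bar> / y)"
      using bound assms(1) by simp
  qed
  have int: "integrable (M \<Otimes>\<^sub>M lborel) (case_prod h)"
  proof (rule Fubini_integrable[OF meas])
    show "AE x in M. integrable lborel (\<lambda>u. case_prod h (x, u))"
      using int_h by simp
    show "integrable M (\<lambda>x. LBINT u. norm (case_prod h (x, u)))"
    proof (rule integrable_bounded)
      show "(\<lambda>x. LBINT u. norm (case_prod h (x, u))) \<in> borel_measurable M" by measurable
      show "norm (LBINT u. norm (case_prod h (x, u))) \<le> (LBINT u. \<bar>\<phi> u\<bar> / y)" for x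
      proof -
        have "(LBINT u. norm (h x u)) \<le> (LBINT u. \<bar>\<phi> u\<bar> / y)"
          using int_h int_\<phi> by (intro integral_mono bound integrable_norm)
        then show ?thesis by simp
      qed
    qed
  qed
  have "(LINT x|M. (LBINT u. h x u)) = (LBINT u. (LINT x|M. h x u))"
    using Fubini_integral[OF int] by simp
  then show ?thesis
    using assms(1) by (simp add: poisson_average_def h_def Re_Im_Cauchy_transform(2))
qed

text \<open>Stieltjes inversion: Poisson averages approximate a test function uniformly, and their
  integrals converge by dominated convergence, as the Cauchy transforms are bounded by \<open>C / y\<close> on
  \<open>Im z = y\<close>.\<close>

lemma Cauchy_transform_imp_vague_conv:
  assumes \<nu>: "\<And>k. finite_borel_measure (\<nu> k)" "\<And>k. measure (\<nu> k) UNIV \<le> C"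
    and \<nu>': "finite_borel_measure \<nu>'" "measure \<nu>' UNIV \<le> C"
    and lim: "\<And>z. Im z > 0 \<Longrightarrow> (\<lambda>k. Cauchy_transform (\<nu> k) z) \<longlonglongrightarrow> Cauchy_transform \<nu>' z"
  shows "vague_conv \<nu> \<nu>'"
  unfolding vague_conv_def
proof (intro allI impI)
  fix \<phi> :: "real \<Rightarrow> real"
  assume \<phi>: "continuous_on UNIV \<phi>" "compact (closure {x. \<phi> x \<noteq> 0})"
  obtain B where B: "0 \<le> B" "\<And>x. \<bar>\<phi> x\<bar> \<le> B"
    using bounded_of_compact_support[OF \<phi>] by blast
  have meas: "\<phi> \<in> borel_measurable borel"
    using \<phi>(1) by (rule borel_measurable_continuous_onI)
  note int = compact_support_integrable[OF \<phi>]
  show "(\<lambda>k. LINT x|\<nu> k. \<phi> x) \<longlonglongrightarrow> (LINT x|\<nu>'. \<phi> x)"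
  proof (rule tendsto_integral_uniform_approx[OF \<nu> \<nu>' meas B(2)])
    fix e :: real assume "0 < e"
    obtain y where y: "0 < y" "\<And>x. \<bar>\<phi> x - poisson_average y \<phi> x\<bar> \<le> e"
      using poisson_average_uniform_approx[OF uniformly_continuous_of_compact_support[OF \<phi>] B \<open>0 < e\<close>] by blast
    have "poisson_average y \<phi> \<in> borel_measurable borel"
      using meas by (rule poisson_average_measurable)
    moreover have "(\<lambda>k. LINT x|\<nu> k. poisson_average y \<phi> x) \<longlonglongrightarrow> (LINT x|\<nu>'. poisson_average y \<phi> x)"
      unfolding finite_borel_measure.integral_poisson_average[OF \<nu>(1) y(1) \<phi>]
        finite_borel_measure.integral_poisson_average[OF \<nu>'(1) y(1) \<phi>]
    proof (intro tendsto_divide tendsto_const integral_dominated_convergence[where w = "\<lambda>u. \<bar>\<phi> u\<bar> * (C / y)"])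
      show "integrable lborel (\<lambda>u. \<bar>\<phi> u\<bar> * (C / y))"
        using int by simp
      show "AE u in lborel. (\<lambda>k. \<phi> u * - Im (Cauchy_transform (\<nu> k) (Complex u y))) \<longlonglongrightarrow>
          \<phi> u * - Im (Cauchy_transform \<nu>' (Complex u y))"
        using lim y(1) by (intro AE_I2 tendsto_intros) auto
      have "norm (\<phi> u * - Im (Cauchy_transform (\<nu> k) (Complex u y))) \<le> \<bar>\<phi> u\<bar> * (C / y)" for k u
      proof -
        have "\<bar>Im (Cauchy_transform (\<nu> k) (Complex u y))\<bar> \<le> measure (\<nu> k) UNIV / y"
          using finite_borel_measure.norm_Cauchy_transform_le[OF \<nu>(1), of "Complex u y" k] y(1)
            abs_Im_le_cmod order_trans by fastforce
        also have "\<dots> \<le> C / y" using \<nu>(2) y(1) by (intro divide_right_mono) auto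
        finally have "\<bar>\<phi> u\<bar> * \<bar>Im (Cauchy_transform (\<nu> k) (Complex u y))\<bar> \<le> \<bar>\<phi> u\<bar> * (C / y)"
          by (rule mult_left_mono) simp
        then show ?thesis by (simp only: abs_mult real_norm_def abs_minus)
      qed
      then show "AE u in lborel. norm (\<phi> u * - Im (Cauchy_transform (\<nu> k) (Complex u y))) \<le> \<bar>\<phi> u\<bar> * (C / y)" for k
        by simp
      have "continuous_on UNIV (\<lambda>u. Cauchy_transform \<mu> (Complex u y))" if "finite_borel_measure \<mu>" for \<mu>
        by (rule continuous_on_compose2[OF continuous_on_Cauchy_transform[OF that]])
          (use y(1) in \<open>auto simp: upper_half_plane_def Complex_eq intro!: continuous_intros\<close>)
      then have G: "(\<lambda>u. Im (Cauchy_transform \<mu> (Complex u y))) \<in> borel_measurable lborel"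
        if "finite_borel_measure \<mu>" for \<mu>
        using that by (auto intro!: borel_measurable_continuous_onI continuous_intros)
      show "(\<lambda>u. \<phi> u * - Im (Cauchy_transform \<nu>' (Complex u y))) \<in> borel_measurable lborel"
        "(\<lambda>u. \<phi> u * - Im (Cauchy_transform (\<nu> k) (Complex u y))) \<in> borel_measurable lborel" for k
        using G[OF \<nu>(1)] G[OF \<nu>'(1)] meas by auto
    qed (use pi_gt_zero in auto)
    ultimately show "\<exists>\<psi>. \<psi> \<in> borel_measurable borel \<and> (\<forall>x. \<bar>\<phi> x - \<psi> x\<bar> \<le> e) \<and>
        (\<lambda>k. LINT x|\<nu> k. \<psi> x) \<longlonglongrightarrow> (LINT x|\<nu>'. \<psi> x)"
      using y(2) by blast
  qed
qed

text \<open>Between probability measures no mass escapes: a cutoff function that captures almost all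
  mass of the limit also captures almost all mass of \<open>\<mu> k\<close> for large \<open>k\<close>.\<close>

lemma vague_conv_imp_weak:
  fixes \<phi> :: "real \<Rightarrow> real"
  assumes \<mu>: "\<And>k. real_distribution (\<mu> k)" and \<mu>': "real_distribution \<mu>'"
    and vague: "vague_conv \<mu> \<mu>'" and \<phi>: "continuous_on UNIV \<phi>" "bounded (range \<phi>)"
  shows "(\<lambda>k. LINT x|\<mu> k. \<phi> x) \<longlonglongrightarrow> (LINT x|\<mu>'. \<phi> x)"
proof (rule LIMSEQ_I)
  fix r :: real assume "0 < r"
  obtain B where B: "0 < B" "\<And>x. \<bar>\<phi> x\<bar> \<le> B"
    using \<phi>(2) unfolding bounded_pos by auto
  \<comment> \<open>\<open>r = 4 B e\<close>: one \<open>B e\<close> for each of the two tails, one for the integrals with cutoff, one to spare\<close>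
  define e where "e = r / (4 * B)"
  have e: "0 < e" "4 * (B * e) = r" using \<open>0 < r\<close> B(1) by (auto simp: e_def)
  interpret \<mu>': real_distribution \<mu>' by fact
  have [measurable]: "cutoff R \<in> borel_measurable borel" "\<phi> \<in> borel_measurable borel" for R
    using cutoff(4) \<phi>(1) by (auto intro: borel_measurable_continuous_onI)
  have "(\<lambda>n. LINT x|\<mu>'. cutoff (real n) x) \<longlonglongrightarrow> (LINT x|\<mu>'. 1)"
  proof (rule integral_dominated_convergence[where w = "\<lambda>_. 1"])
    show "AE x in \<mu>'. (\<lambda>n. cutoff (real n) x) \<longlonglongrightarrow> 1"
    proof (intro AE_I2 tendsto_eventually)
      fix x :: real
      obtain N where "\<bar>x\<bar> < real N" using reals_Archimedean2 by blast
      then show "\<forall>\<^sub>F n in sequentially. cutoff (real n) x = 1"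
        unfolding eventually_sequentially by (intro exI[of _ N]) (auto intro: cutoff(3))
    qed
  qed (use cutoff in auto)
  then have "\<forall>\<^sub>F n in sequentially. 1 - e < (LINT x|\<mu>'. cutoff (real n) x)"
    using e(1) \<mu>'.prob_space by (intro order_tendstoD) auto
  then obtain R where R: "1 - e < (LINT x|\<mu>'. cutoff R x)"
    by (auto simp: eventually_sequentially)
  have lim_cut: "(\<lambda>k. LINT x|\<mu> k. cutoff R x) \<longlonglongrightarrow> (LINT x|\<mu>'. cutoff R x)"
    using vague cutoff(4) compact_support_cutoff[of R "\<lambda>_. 1"] by (auto simp: vague_conv_def)
  have lim_\<phi>: "(\<lambda>k. LINT x|\<mu> k. cutoff R x * \<phi> x) \<longlonglongrightarrow> (LINT x|\<mu>'. cutoff R x * \<phi> x)"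
    using vague continuous_on_mult[OF cutoff(4) \<phi>(1)] compact_support_cutoff[of R \<phi>]
    unfolding vague_conv_def by blast
  have tail: "\<bar>(LINT x|\<eta>. \<phi> x) - (LINT x|\<eta>. cutoff R x * \<phi> x)\<bar> \<le> B * (1 - (LINT x|\<eta>. cutoff R x))"
    if "real_distribution \<eta>" for \<eta>
  proof -
    interpret real_distribution \<eta> by fact
    have int: "integrable \<eta> \<phi>" "integrable \<eta> (\<lambda>x. cutoff R x * \<phi> x)" "integrable \<eta> (cutoff R)"
      using B cutoff[of R] mult_mono[OF cutoff(2)[of R] B(2)]
      by (auto intro: integrable_bounded[of _ B] integrable_bounded[of _ 1] simp: abs_mult)
    have "\<bar>(LINT x|\<eta>. \<phi> x) - (LINT x|\<eta>. cutoff R x * \<phi> x)\<bar> = norm (LINT x|\<eta>. (1 - cutoff R x) * \<phi> x)"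
      using int by (simp add: left_diff_distrib)
    also have "\<dots> \<le> (LINT x|\<eta>. norm ((1 - cutoff R x) * \<phi> x))"
      by (rule integral_norm_bound)
    also have "\<dots> \<le> (LINT x|\<eta>. B * (1 - cutoff R x))"
    proof (rule integral_mono)
      show "norm ((1 - cutoff R x) * \<phi> x) \<le> B * (1 - cutoff R x)" for x
        using cutoff(2)[of R x] B(2)[of x] by (simp add: abs_mult mult.commute mult_right_mono)
    qed (use int in \<open>auto simp: left_diff_distrib\<close>)
    also have "\<dots> = B * (1 - (LINT x|\<eta>. cutoff R x))"
      using int prob_space by simp
    finally show ?thesis .
  qed
  have "\<forall>\<^sub>F k in sequentially. 1 - e < (LINT x|\<mu> k. cutoff R x)"
    using R by (intro order_tendstoD[OF lim_cut])
  moreover have "\<forall>\<^sub>F k in sequentially. dist (LINT x|\<mu> k. cutoff R x * \<phi> x) (LINT x|\<mu>'. cutoff R x * \<phi> x) < B * e"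
    using lim_\<phi> B(1) e(1) by (simp add: tendsto_iff)
  ultimately have "\<forall>\<^sub>F k in sequentially. norm ((LINT x|\<mu> k. \<phi> x) - (LINT x|\<mu>'. \<phi> x)) < r"
  proof eventually_elim
    case (elim k)
    have "B * (1 - (LINT x|\<mu> k. cutoff R x)) \<le> B * e" "B * (1 - (LINT x|\<mu>'. cutoff R x)) \<le> B * e"
      using elim(1) R B(1) by auto
    with tail[OF \<mu>, of k] tail[OF \<mu>'] elim(2) e(2) \<open>0 < r\<close> show ?case
      by (simp add: dist_real_def abs_if split: if_splits)
  qed
  then show "\<exists>no. \<forall>k\<ge>no. norm ((LINT x|\<mu> k. \<phi> x) - (LINT x|\<mu>'. \<phi> x)) < r"
    by (simp add: eventually_sequentially)
qed

section \<open>Reciprocal Cauchy transforms of probability measures\<close>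

lemma real_distribution_imp_finite_borel: "real_distribution \<mu> \<Longrightarrow> finite_borel_measure \<mu>"
  by (rule real_distribution.finite_borel_measure_M)

lemma real_distribution_mass: "real_distribution \<mu> \<Longrightarrow> measure \<mu> UNIV = 1"
  using prob_space.prob_space[of \<mu>] real_distribution.space_eq_univ[of \<mu>]
  by (simp add: real_distribution_def)

context real_distribution
begin

lemma integrable_kernel_parts:
  assumes "Im z > 0"
  shows "integrable M (\<lambda>x. Re (1 / (z - of_real x)))" "integrable M (\<lambda>x. Im (1 / (z - of_real x)))"
    "integrable M (\<lambda>x. (Re (1 / (z - of_real x)))\<^sup>2)" "integrable M (\<lambda>x. (Im (1 / (z - of_real x)))\<^sup>2)"
proof -
  have [measurable]: "(\<lambda>x. 1 / (z - complex_of_real x)) \<in> borel_measurable M"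
    using assms by (simp add: kernel_measurable measurable_cong_sets[OF events_eq_borel refl])
  have b: "\<bar>Re (1 / (z - of_real x))\<bar> \<le> 1 / Im z" "\<bar>Im (1 / (z - of_real x))\<bar> \<le> 1 / Im z" for x
    using norm_kernel_le[OF assms, of x] abs_Re_le_cmod abs_Im_le_cmod order_trans by blast+
  have int: "integrable M X" "integrable M (\<lambda>x. (X x)\<^sup>2)"
    if [measurable]: "X \<in> borel_measurable M" and X: "\<And>x. \<bar>X x\<bar> \<le> c" for X :: "real \<Rightarrow> real" and c
  proof -
    show "integrable M X" using X by (intro integrable_bounded[where B = c]) auto
    show "integrable M (\<lambda>x. (X x)\<^sup>2)"
      using power_mono[OF X abs_ge_zero, where n = 2] by (intro integrable_bounded[where B = "c\<^sup>2"]) auto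
  qed
  show "integrable M (\<lambda>x. Re (1 / (z - of_real x)))" "integrable M (\<lambda>x. Im (1 / (z - of_real x)))"
    "integrable M (\<lambda>x. (Re (1 / (z - of_real x)))\<^sup>2)" "integrable M (\<lambda>x. (Im (1 / (z - of_real x)))\<^sup>2)"
    by (intro int[OF _ b(1)] int[OF _ b(2)]; measurable)+
qed

lemma Im_Cauchy_transform_neg:
  assumes "Im z > 0"
  shows "Im (Cauchy_transform M z) < 0"
proof -
  have "Im (1 / (z - of_real x)) < 0" for x
  proof -
    have "0 < (Re z - x)\<^sup>2 + (Im z)\<^sup>2"
      using assms by (simp add: add_nonneg_pos)
    then show ?thesis using assms by (simp add: Im_divide)
  qed
  then have "(LINT x|M. Im (1 / (z - of_real x))) < 0"
    using integrable_kernel_parts(2)[OF assms] by (intro expectation_less) auto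
  then show ?thesis
    using finite_borel_measure.Re_Im_Cauchy_transform(2)[OF finite_borel_measure_M assms] by simp
qed

lemma Cauchy_transform_nonzero: "Im z > 0 \<Longrightarrow> Cauchy_transform M z \<noteq> 0"
  using Im_Cauchy_transform_neg by fastforce

text \<open>With \<open>G\<close> the Cauchy transform, the variance of \<open>1 / (z - x)\<close> being nonnegative gives \<open>|G|\<^sup>2
  \<le> \<integral> |1 / (z - x)|\<^sup>2 \<mu>(dx) = - Im G / Im z\<close>, and \<open>Im (1 / G) = - Im G / |G|\<^sup>2\<close>.\<close>

lemma Im_F_transform_ge:
  assumes "Im z > 0"
  shows "Im z \<le> Im (F_transform M z)"
proof -
  define G where "G = Cauchy_transform M z"
  note G_parts = finite_borel_measure.Re_Im_Cauchy_transform[OF finite_borel_measure_M assms]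
  note int = integrable_kernel_parts[OF assms]
  have square: "(expectation X)\<^sup>2 \<le> expectation (\<lambda>x. (X x)\<^sup>2)"
    if "integrable M X" "integrable M (\<lambda>x. (X x)\<^sup>2)" for X :: "real \<Rightarrow> real"
    using variance_positive[of X] variance_eq[OF that] by simp
  have "(Re G)\<^sup>2 + (Im G)\<^sup>2 \<le> (LINT x|M. (Re (1 / (z - of_real x)))\<^sup>2) + (LINT x|M. (Im (1 / (z - of_real x)))\<^sup>2)"
    unfolding G_def G_parts using int by (intro add_mono square)
  also have "\<dots> = (LINT x|M. (Re (1 / (z - of_real x)))\<^sup>2 + (Im (1 / (z - of_real x)))\<^sup>2)"
    using int by simp
  also have "\<dots> = (LINT x|M. - Im (1 / (z - of_real x)) / Im z)"
  proof (rule Bochner_Integration.integral_cong[OF refl])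
    fix x
    have "(Re (1 / (z - of_real x)))\<^sup>2 + (Im (1 / (z - of_real x)))\<^sup>2 = (norm (1 / (z - of_real x)))\<^sup>2"
      by (simp add: cmod_power2)
    also have "\<dots> = 1 / (norm (z - of_real x))\<^sup>2"
      by (simp add: norm_divide power_divide)
    also have "\<dots> = - Im (1 / (z - of_real x)) / Im z"
      using assms by (simp add: Im_divide cmod_power2)
    finally show "(Re (1 / (z - of_real x)))\<^sup>2 + (Im (1 / (z - of_real x)))\<^sup>2 = - Im (1 / (z - of_real x)) / Im z" .
  qed
  also have "\<dots> = - Im G / Im z"
    unfolding G_def G_parts by simp
  finally have "(norm G)\<^sup>2 * Im z \<le> - Im G"
    using assms by (simp add: cmod_power2 field_simps)
  moreover have "0 < (norm G)\<^sup>2"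
    using Cauchy_transform_nonzero[OF assms] by (simp add: G_def)
  moreover have "Im (F_transform M z) = - Im G / (norm G)\<^sup>2"
    by (simp add: F_transform_def G_def Im_divide cmod_power2)
  ultimately show ?thesis
    by (metis pos_le_divide_eq mult.commute)
qed

end

lemma weak_imp_F_transform:
  assumes \<mu>: "\<And>k. real_distribution (\<mu> k)" and \<mu>': "real_distribution \<mu>'"
    and weak: "\<And>\<phi>::real \<Rightarrow> real. continuous_on UNIV \<phi> \<Longrightarrow> bounded (range \<phi>) \<Longrightarrow>
      (\<lambda>k. LINT x|\<mu> k. \<phi> x) \<longlonglongrightarrow> (LINT x|\<mu>'. \<phi> x)"
    and z: "\<And>k. Im (\<zeta> k) > 0" "Im z > 0" "\<zeta> \<longlonglongrightarrow> z"
  shows "(\<lambda>k. F_transform (\<mu> k) (\<zeta> k)) \<longlonglongrightarrow> F_transform \<mu>' z"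
proof -
  have "bounded (range \<phi>)" if "continuous_on UNIV \<phi>" "compact (closure {x. \<phi> x \<noteq> 0})" for \<phi> :: "real \<Rightarrow> real"
    using bounded_of_compact_support[OF that] unfolding bounded_iff by auto
  then have "vague_conv \<mu> \<mu>'"
    using weak by (simp add: vague_conv_def)
  then have "(\<lambda>k. Cauchy_transform (\<mu> k) (\<zeta> k)) \<longlonglongrightarrow> Cauchy_transform \<mu>' z"
    using \<mu> \<mu>' z
    by (intro vague_conv_imp_Cauchy_transform[where C = 1])
      (auto simp: real_distribution_mass intro: real_distribution_imp_finite_borel)
  then show ?thesis
    unfolding F_transform_def
    by (intro tendsto_divide tendsto_const real_distribution.Cauchy_transform_nonzero \<mu>' z(2))
qed

lemma F_transform_imp_weak:
  fixes \<phi> :: "real \<Rightarrow> real"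
  assumes \<mu>: "\<And>k. real_distribution (\<mu> k)" and \<mu>': "real_distribution \<mu>'"
    and lim: "\<And>z. Im z > 0 \<Longrightarrow> (\<lambda>k. F_transform (\<mu> k) z) \<longlonglongrightarrow> F_transform \<mu>' z"
    and \<phi>: "continuous_on UNIV \<phi>" "bounded (range \<phi>)"
  shows "(\<lambda>k. LINT x|\<mu> k. \<phi> x) \<longlonglongrightarrow> (LINT x|\<mu>'. \<phi> x)"
proof -
  have "(\<lambda>k. Cauchy_transform (\<mu> k) z) \<longlonglongrightarrow> Cauchy_transform \<mu>' z" if "Im z > 0" for z
  proof -
    have "(\<lambda>k. 1 / F_transform (\<mu> k) z) \<longlonglongrightarrow> 1 / F_transform \<mu>' z"
      using lim[OF that] real_distribution.Cauchy_transform_nonzero[OF \<mu>' that]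
      by (intro tendsto_divide tendsto_const) (auto simp: F_transform_def)
    then show ?thesis by (simp add: F_transform_def)
  qed
  then have "vague_conv \<mu> \<mu>'"
    using \<mu> \<mu>' by (intro Cauchy_transform_imp_vague_conv[where C = 1])
      (auto simp: real_distribution_mass intro: real_distribution_imp_finite_borel)
  then show ?thesis using vague_conv_imp_weak \<mu> \<mu>' \<phi> by blast
qed

text \<open>Weak convergence of probability measures with the transform \<open>F\<close>, and vague convergence of
  measures of bounded mass with the Cauchy transform, are related to pointwise convergence in the
  same way. The two lemmas below lift such a relation from sequences of measures to families: here
  \<open>P\<close> selects the admissible measures, \<open>A\<close> the test functions, and \<open>H\<close> is the transform.\<close>

lemma continuous_on_transform_family:
  fixes M :: "'a::metric_space \<Rightarrow> real measure" and A :: "(real \<Rightarrow> real) set"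
    and H :: "real measure \<Rightarrow> complex \<Rightarrow> complex"
  assumes direct: "\<And>\<mu> \<mu>' \<zeta> z. (\<And>k. P (\<mu> k)) \<Longrightarrow> P \<mu>' \<Longrightarrow>
      (\<And>\<phi>. \<phi> \<in> A \<Longrightarrow> (\<lambda>k. LINT x|\<mu> k. \<phi> x) \<longlonglongrightarrow> (LINT x|\<mu>'. \<phi> x)) \<Longrightarrow>
      (\<And>k. 0 < Im (\<zeta> k)) \<Longrightarrow> 0 < Im z \<Longrightarrow> \<zeta> \<longlonglongrightarrow> z \<Longrightarrow> (\<lambda>k. H (\<mu> k) (\<zeta> k)) \<longlonglongrightarrow> H \<mu>' z"
    and M: "\<And>\<tau>. \<tau> \<in> S \<Longrightarrow> P (M \<tau>)"
    and cont: "\<And>\<phi>. \<phi> \<in> A \<Longrightarrow> continuous_on S (\<lambda>\<tau>. LINT x|M \<tau>. \<phi> x)"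
  shows "continuous_on (upper_half_plane \<times> S) (\<lambda>(z, \<tau>). H (M \<tau>) z)"
  unfolding continuous_on_sequentially
proof (intro allI ballI impI)
  fix \<sigma> :: "nat \<Rightarrow> complex \<times> 'a" and l
  assume l: "l \<in> upper_half_plane \<times> S"
    and \<sigma>: "(\<forall>k. \<sigma> k \<in> upper_half_plane \<times> S) \<and> \<sigma> \<longlonglongrightarrow> l"
  have mem: "0 < Im (fst (\<sigma> k))" "snd (\<sigma> k) \<in> S" "0 < Im (fst l)" "snd l \<in> S" for k
    using \<sigma> l by (auto simp: mem_Times_iff upper_half_plane_def)
  have lim: "(\<lambda>k. fst (\<sigma> k)) \<longlonglongrightarrow> fst l" "(\<lambda>k. snd (\<sigma> k)) \<longlonglongrightarrow> snd l"
    using \<sigma> by (auto intro: tendsto_fst tendsto_snd)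
  have "(\<lambda>k. H (M (snd (\<sigma> k))) (fst (\<sigma> k))) \<longlonglongrightarrow> H (M (snd l)) (fst l)"
  proof (rule direct[OF _ _ _ mem(1,3) lim(1)])
    show "(\<lambda>k. LINT x|M (snd (\<sigma> k)). \<phi> x) \<longlonglongrightarrow> (LINT x|M (snd l). \<phi> x)" if "\<phi> \<in> A" for \<phi>
      using mem(2) by (intro continuous_on_tendsto_compose[OF cont[OF that] lim(2) mem(4)]) simp
  qed (use mem M in auto)
  then show "((\<lambda>(z, \<tau>). H (M \<tau>) z) \<circ> \<sigma>) \<longlonglongrightarrow> (case l of (z, \<tau>) \<Rightarrow> H (M \<tau>) z)"
    by (simp add: comp_def case_prod_unfold)
qed

lemma test_limit_iff_transform_limit:
  fixes M :: "'a::heine_borel \<Rightarrow> real measure" and A :: "(real \<Rightarrow> real) set"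
    and H :: "real measure \<Rightarrow> complex \<Rightarrow> complex"
  assumes direct: "\<And>\<mu> \<mu>' \<zeta> z. (\<And>k. P (\<mu> k)) \<Longrightarrow> P \<mu>' \<Longrightarrow>
      (\<And>\<phi>. \<phi> \<in> A \<Longrightarrow> (\<lambda>k. LINT x|\<mu> k. \<phi> x) \<longlonglongrightarrow> (LINT x|\<mu>'. \<phi> x)) \<Longrightarrow>
      (\<And>k. 0 < Im (\<zeta> k)) \<Longrightarrow> 0 < Im z \<Longrightarrow> \<zeta> \<longlonglongrightarrow> z \<Longrightarrow> (\<lambda>k. H (\<mu> k) (\<zeta> k)) \<longlonglongrightarrow> H \<mu>' z"
    and inverse: "\<And>\<mu> \<mu>' \<phi>. (\<And>k. P (\<mu> k)) \<Longrightarrow> P \<mu>' \<Longrightarrow>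
      (\<And>z. 0 < Im z \<Longrightarrow> (\<lambda>k. H (\<mu> k) z) \<longlonglongrightarrow> H \<mu>' z) \<Longrightarrow> \<phi> \<in> A \<Longrightarrow>
      (\<lambda>k. LINT x|\<mu> k. \<phi> x) \<longlonglongrightarrow> (LINT x|\<mu>'. \<phi> x)"
    and N: "\<And>n \<tau>. \<tau> \<in> S \<Longrightarrow> P (N n \<tau>)" and M: "\<And>\<tau>. \<tau> \<in> S \<Longrightarrow> P (M \<tau>)"
    and cont: "\<And>\<phi>. \<phi> \<in> A \<Longrightarrow> continuous_on S (\<lambda>\<tau>. LINT x|M \<tau>. \<phi> x)"
  shows "(\<forall>\<phi>\<in>A. locally_uniform_limit S (\<lambda>n \<tau>. LINT x|N n \<tau>. \<phi> x) (\<lambda>\<tau>. LINT x|M \<tau>. \<phi> x)) \<longleftrightarrow>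
    locally_uniform_limit (upper_half_plane \<times> S) (\<lambda>n (z, \<tau>). H (N n \<tau>) z) (\<lambda>(z, \<tau>). H (M \<tau>) z)"
    (is "?test \<longleftrightarrow> ?H")
proof -
  have cont_H: "continuous_on (upper_half_plane \<times> S) (\<lambda>(z, \<tau>). H (M \<tau>) z)"
    by (rule continuous_on_transform_family[where P = P and A = A and H = H]) (fact direct M cont)+
  show ?thesis
  proof
    assume test: ?test
    show ?H
      unfolding locally_uniform_limit_iff_sequences[OF cont_H]
    proof (intro allI impI)
      fix \<psi> :: "nat \<Rightarrow> nat" and \<sigma> :: "nat \<Rightarrow> complex \<times> 'a" and l
      assume \<psi>: "strict_mono \<psi>" and \<sigma>: "\<forall>k. \<sigma> k \<in> upper_half_plane \<times> S"
        and l: "l \<in> upper_half_plane \<times> S" and lim: "\<sigma> \<longlonglongrightarrow> l"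
      have mem: "0 < Im (fst (\<sigma> k))" "snd (\<sigma> k) \<in> S" "0 < Im (fst l)" "snd l \<in> S" for k
        using \<sigma> l by (auto simp: mem_Times_iff upper_half_plane_def)
      have "(\<lambda>k. H (N (\<psi> k) (snd (\<sigma> k))) (fst (\<sigma> k))) \<longlonglongrightarrow> H (M (snd l)) (fst l)"
      proof (rule direct[OF _ _ _ mem(1,3) tendsto_fst[OF lim]])
        fix \<phi> assume \<phi>: "\<phi> \<in> A"
        show "(\<lambda>k. LINT x|N (\<psi> k) (snd (\<sigma> k)). \<phi> x) \<longlonglongrightarrow> (LINT x|M (snd l). \<phi> x)"
          using test[rule_format, OF \<phi>] mem \<psi> tendsto_snd[OF lim]
          unfolding locally_uniform_limit_iff_sequences[OF cont[OF \<phi>]] by auto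
      qed (use mem N M in auto)
      then show "(\<lambda>k. case \<sigma> k of (z, \<tau>) \<Rightarrow> H (N (\<psi> k) \<tau>) z) \<longlonglongrightarrow> (case l of (z, \<tau>) \<Rightarrow> H (M \<tau>) z)"
        by (simp add: case_prod_unfold)
    qed
  next
    assume H: ?H
    show ?test
    proof
      fix \<phi> assume \<phi>: "\<phi> \<in> A"
      show "locally_uniform_limit S (\<lambda>n \<tau>. LINT x|N n \<tau>. \<phi> x) (\<lambda>\<tau>. LINT x|M \<tau>. \<phi> x)"
        unfolding locally_uniform_limit_iff_sequences[OF cont[OF \<phi>]]
      proof (intro allI impI)
        fix \<psi> :: "nat \<Rightarrow> nat" and \<tau> l
        assume \<psi>: "strict_mono \<psi>" and \<tau>: "\<forall>k. \<tau> k \<in> S" "l \<in> S" "\<tau> \<longlonglongrightarrow> l"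
        show "(\<lambda>k. LINT x|N (\<psi> k) (\<tau> k). \<phi> x) \<longlonglongrightarrow> (LINT x|M l. \<phi> x)"
        proof (rule inverse[OF _ _ _ \<phi>])
          fix z :: complex assume "0 < Im z"
          then show "(\<lambda>k. H (N (\<psi> k) (\<tau> k)) z) \<longlonglongrightarrow> H (M l) z"
            using H[unfolded locally_uniform_limit_iff_sequences[OF cont_H], rule_format, OF \<psi>,
                of "\<lambda>k. (z, \<tau> k)" "(z, l)"] \<tau> tendsto_Pair[OF tendsto_const[of z] \<tau>(3)]
            by (auto simp: upper_half_plane_def)
        qed (use N M \<tau> in auto)
      qed
    qed
  qed
qed

lemma continuous_on_F_transform:
  fixes M :: "'a::metric_space \<Rightarrow> real measure"
  assumes "\<And>\<tau>. \<tau> \<in> S \<Longrightarrow> real_distribution (M \<tau>)"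
    and "\<And>\<phi>::real \<Rightarrow> real. continuous_on UNIV \<phi> \<Longrightarrow> bounded (range \<phi>) \<Longrightarrow>
      continuous_on S (\<lambda>\<tau>. LINT x|M \<tau>. \<phi> x)"
  shows "continuous_on (upper_half_plane \<times> S) (\<lambda>(z, \<tau>). F_transform (M \<tau>) z)"
  by (rule continuous_on_transform_family[where P = real_distribution
        and A = "{\<phi>. continuous_on UNIV \<phi> \<and> bounded (range \<phi>)}"])
    (use assms weak_imp_F_transform in auto)

lemma weak_limit_iff_F_transform:
  fixes M :: "'a::heine_borel \<Rightarrow> real measure"
  assumes "\<And>n \<tau>. \<tau> \<in> S \<Longrightarrow> real_distribution (N n \<tau>)" "\<And>\<tau>. \<tau> \<in> S \<Longrightarrow> real_distribution (M \<tau>)"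
    and "\<And>\<phi>::real \<Rightarrow> real. continuous_on UNIV \<phi> \<Longrightarrow> bounded (range \<phi>) \<Longrightarrow>
      continuous_on S (\<lambda>\<tau>. LINT x|M \<tau>. \<phi> x)"
  shows "weak_limit_locally_uniform S N M \<longleftrightarrow>
    locally_uniform_limit (upper_half_plane \<times> S)
      (\<lambda>n (z, \<tau>). F_transform (N n \<tau>) z) (\<lambda>(z, \<tau>). F_transform (M \<tau>) z)"
proof -
  let ?A = "{\<phi> :: real \<Rightarrow> real. continuous_on UNIV \<phi> \<and> bounded (range \<phi>)}"
  have "(\<forall>\<phi>\<in>?A. locally_uniform_limit S (\<lambda>n \<tau>. LINT x|N n \<tau>. \<phi> x) (\<lambda>\<tau>. LINT x|M \<tau>. \<phi> x)) \<longleftrightarrow>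
    locally_uniform_limit (upper_half_plane \<times> S)
      (\<lambda>n (z, \<tau>). F_transform (N n \<tau>) z) (\<lambda>(z, \<tau>). F_transform (M \<tau>) z)"
    by (rule test_limit_iff_transform_limit[where P = real_distribution])
      (use assms weak_imp_F_transform F_transform_imp_weak in auto)
  then show ?thesis by (simp add: weak_limit_locally_uniform_def imp_conjL)
qed

lemma vague_limit_iff_Cauchy_transform:
  fixes M :: "'a::heine_borel \<Rightarrow> real measure"
  assumes "\<And>n \<tau>. \<tau> \<in> S \<Longrightarrow> finite_borel_measure (N n \<tau>) \<and> measure (N n \<tau>) UNIV \<le> C"
    and "\<And>\<tau>. \<tau> \<in> S \<Longrightarrow> finite_borel_measure (M \<tau>) \<and> measure (M \<tau>) UNIV \<le> C"
    and "\<And>\<phi>::real \<Rightarrow> real. continuous_on UNIV \<phi> \<Longrightarrow> compact (closure {x. \<phi> x \<noteq> 0}) \<Longrightarrow>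
      continuous_on S (\<lambda>\<tau>. LINT x|M \<tau>. \<phi> x)"
  shows "vague_limit_locally_uniform S N M \<longleftrightarrow>
    locally_uniform_limit (upper_half_plane \<times> S)
      (\<lambda>n (z, \<tau>). Cauchy_transform (N n \<tau>) z) (\<lambda>(z, \<tau>). Cauchy_transform (M \<tau>) z)"
proof -
  let ?A = "{\<phi> :: real \<Rightarrow> real. continuous_on UNIV \<phi> \<and> compact (closure {x. \<phi> x \<noteq> 0})}"
  let ?P = "\<lambda>\<mu>. finite_borel_measure \<mu> \<and> measure \<mu> UNIV \<le> C"
  have "(\<forall>\<phi>\<in>?A. locally_uniform_limit S (\<lambda>n \<tau>. LINT x|N n \<tau>. \<phi> x) (\<lambda>\<tau>. LINT x|M \<tau>. \<phi> x)) \<longleftrightarrow>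
    locally_uniform_limit (upper_half_plane \<times> S)
      (\<lambda>n (z, \<tau>). Cauchy_transform (N n \<tau>) z) (\<lambda>(z, \<tau>). Cauchy_transform (M \<tau>) z)"
  proof (rule test_limit_iff_transform_limit[where P = ?P])
    fix \<mu> :: "nat \<Rightarrow> real measure" and \<mu>' \<zeta> z
    assume "\<And>k. ?P (\<mu> k)" "?P \<mu>'" "\<And>k. 0 < Im (\<zeta> k)" "0 < Im z" "\<zeta> \<longlonglongrightarrow> z"
      "\<And>\<phi>. \<phi> \<in> ?A \<Longrightarrow> (\<lambda>k. LINT x|\<mu> k. \<phi> x) \<longlonglongrightarrow> (LINT x|\<mu>'. \<phi> x)"
    then show "(\<lambda>k. Cauchy_transform (\<mu> k) (\<zeta> k)) \<longlonglongrightarrow> Cauchy_transform \<mu>' z"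
      by (intro vague_conv_imp_Cauchy_transform[where C = C]) (auto simp: vague_conv_def)
  next
    fix \<mu> :: "nat \<Rightarrow> real measure" and \<mu>' \<phi>
    assume "\<And>k. ?P (\<mu> k)" "?P \<mu>'" "\<phi> \<in> ?A"
      "\<And>z. 0 < Im z \<Longrightarrow> (\<lambda>k. Cauchy_transform (\<mu> k) z) \<longlonglongrightarrow> Cauchy_transform \<mu>' z"
    then have "vague_conv \<mu> \<mu>'"
      by (intro Cauchy_transform_imp_vague_conv[where C = C]) auto
    then show "(\<lambda>k. LINT x|\<mu> k. \<phi> x) \<longlonglongrightarrow> (LINT x|\<mu>'. \<phi> x)"
      using \<open>\<phi> \<in> ?A\<close> by (simp add: vague_conv_def)
  qed (use assms in auto)
  then show ?thesis by (simp add: vague_limit_locally_uniform_def imp_conjL)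
qed

text \<open>On the imaginary axis \<open>z G(z) = 1 + a / z + B / z\<^sup>2\<close>, where \<open>a\<close> is the mean and \<open>B\<close> tends to
  the second moment. Comparing powers of \<open>1 / z\<close> in \<open>F(z) G(z) = 1\<close> yields first \<open>c = a\<close> and then
  \<open>k\<close>.\<close>

lemma variance_eq_limit_of_remainder:
  fixes c k :: real and R :: "nat \<Rightarrow> complex"
  defines "z \<equiv> \<lambda>n. \<i> * of_real (real (Suc n))"
  assumes \<mu>: "real_distribution \<mu>" "finite_second_moment \<mu>"
    and F: "\<And>n. F_transform \<mu> (z n) = z n - of_real c + R n"
    and R: "(\<lambda>n. z n * R n) \<longlonglongrightarrow> - of_real k"
  shows "variance_of \<mu> = k"
proof -
  interpret real_distribution \<mu> by fact
  have int2: "integrable \<mu> (\<lambda>x. x\<^sup>2)"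
    using \<mu>(2) by (simp add: finite_second_moment_def)
  have int1: "integrable \<mu> (\<lambda>x. x)"
    by (rule square_integrable_imp_integrable[OF _ int2]) simp
  define a where "a = (LINT x|\<mu>. x)"
  define b where "b = (LINT x|\<mu>. x\<^sup>2)"
  define B where "B n = (LINT x|\<mu>. of_real (x\<^sup>2) * (z n / (z n - of_real x)))" for n
  have z: "Im (z n) > 0" "z n \<noteq> 0" for n
  proof -
    show "Im (z n) > 0" by (simp add: z_def)
    then show "z n \<noteq> 0" by fastforce
  qed
  have norm_le: "norm (z n / (z n - of_real x)) \<le> 1" for n x
  proof -
    have "norm (z n) \<le> norm (z n - of_real x)"
      using norm_diff_of_real_ge[of "z n" x] by (simp add: z_def norm_mult del: of_nat_Suc)
    then show ?thesis
      using kernel_nonzero[OF z(1)] by (simp add: norm_divide)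
  qed
  have inv_z: "(\<lambda>n. 1 / z n) \<longlonglongrightarrow> 0"
  proof (rule Lim_null_comparison)
    show "\<forall>\<^sub>F n in sequentially. norm (1 / z n) \<le> inverse (real (Suc n))"
      by (simp add: z_def norm_divide norm_mult inverse_eq_divide del: of_nat_Suc)
  qed (rule LIMSEQ_inverse_real_of_nat)
  have meas [measurable]: "(\<lambda>x. 1 / (z n - complex_of_real x)) \<in> borel_measurable \<mu>" for n
    using z(1) by (simp add: kernel_measurable measurable_cong_sets[OF events_eq_borel refl])
  have meas' [measurable]: "(\<lambda>x. complex_of_real (x\<^sup>2) * (z n / (z n - complex_of_real x))) \<in> borel_measurable \<mu>" for n
  proof -
    have "(\<lambda>x. complex_of_real (x\<^sup>2) * (z n * (1 / (z n - complex_of_real x)))) \<in> borel_measurable \<mu>"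
      by measurable
    then show ?thesis by simp
  qed
  have dom: "norm (of_real (x\<^sup>2) * (z n / (z n - of_real x))) \<le> x\<^sup>2" for n x
    using mult_left_mono[OF norm_le[of n x], of "x\<^sup>2"] by (simp add: norm_mult norm_divide norm_power)
  have intB: "integrable \<mu> (\<lambda>x. of_real (x\<^sup>2) * (z n / (z n - of_real x)))" for n
    by (rule Bochner_Integration.integrable_bound[OF int2 meas']) (use dom in simp)
  have B: "B \<longlonglongrightarrow> of_real b"
  proof -
    have "B \<longlonglongrightarrow> (LINT x|\<mu>. complex_of_real (x\<^sup>2))"
      unfolding B_def
    proof (rule integral_dominated_convergence[OF _ meas' int2])
      show "AE x in \<mu>. (\<lambda>n. of_real (x\<^sup>2) * (z n / (z n - of_real x))) \<longlonglongrightarrow> complex_of_real (x\<^sup>2)"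
      proof (intro AE_I2)
        fix x
        have "(\<lambda>n. of_real (x\<^sup>2) * (1 / (1 - of_real x * (1 / z n)))) \<longlonglongrightarrow> complex_of_real (x\<^sup>2) * (1 / (1 - of_real x * 0))"
          by (intro tendsto_intros inv_z) auto
        moreover have "1 / (1 - of_real x * (1 / z n)) = z n / (z n - of_real x)" for n
          using z(2)[of n] kernel_nonzero[OF z(1), of n x] by (simp add: field_simps)
        ultimately have "(\<lambda>n. of_real (x\<^sup>2) * (z n / (z n - of_real x))) \<longlonglongrightarrow> complex_of_real (x\<^sup>2) * (1 / (1 - of_real x * 0))"
          by (simp only:)
        then show "(\<lambda>n. of_real (x\<^sup>2) * (z n / (z n - of_real x))) \<longlonglongrightarrow> complex_of_real (x\<^sup>2)"
          by simp
      qed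
    qed (use dom in auto)
    then show ?thesis by (simp add: b_def del: of_real_power)
  qed
  have G: "z n * Cauchy_transform \<mu> (z n) = 1 + of_real a / z n + B n / (z n)\<^sup>2" for n
  proof -
    have "z n * Cauchy_transform \<mu> (z n) = (LINT x|\<mu>. z n * (1 / (z n - of_real x)))"
      by (simp only: Cauchy_transform_def integral_mult_right_zero)
    also have "\<dots> = (LINT x|\<mu>. 1 + of_real x * (1 / z n) + of_real (x\<^sup>2) * (z n / (z n - of_real x)) * (1 / (z n)\<^sup>2))"
      using z(2)[of n] kernel_nonzero[OF z(1), of n]
      by (intro Bochner_Integration.integral_cong) (auto simp: field_simps power2_eq_square)
    also have "\<dots> = 1 + of_real a * (1 / z n) + B n * (1 / (z n)\<^sup>2)"
    proof -
      have i1: "integrable \<mu> (\<lambda>x. 1 :: complex)" by simp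
      have i2: "integrable \<mu> (\<lambda>x. complex_of_real x * (1 / z n))"
        using int1 by (intro integrable_mult_left integrable_of_real)
      have i3: "integrable \<mu> (\<lambda>x. of_real (x\<^sup>2) * (z n / (z n - of_real x)) * (1 / (z n)\<^sup>2))"
        by (intro integrable_mult_left intB)
      have "(LINT x|\<mu>. 1 :: complex) = 1"
        using prob_space by simp
      then show ?thesis
        unfolding Bochner_Integration.integral_add[OF Bochner_Integration.integrable_add[OF i1 i2] i3]
          Bochner_Integration.integral_add[OF i1 i2] integral_mult_left_zero integral_complex_of_real a_def B_def
        by simp
    qed
    finally show ?thesis by simp
  qed
  define Q where "Q n = z n * R n" for n
  have Q: "Q \<longlonglongrightarrow> - of_real k" using R by (simp add: Q_def[abs_def])
  have expansion: "(of_real a - of_real c) + (B n + Q n - of_real c * of_real a) * (1 / z n)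
      + (Q n * of_real a - of_real c * B n) * (1 / z n)\<^sup>2 + Q n * B n * (1 / z n) ^ 3 = 0" for n
  proof -
    have "F_transform \<mu> (z n) * (z n * Cauchy_transform \<mu> (z n)) = z n"
      using Cauchy_transform_nonzero[OF z(1)] by (simp add: F_transform_def)
    then have "(z n - of_real c + Q n / z n) * (1 + of_real a / z n + B n / (z n)\<^sup>2) = z n"
      using z(2) by (simp add: F G Q_def)
    then show ?thesis
      using z(2)[of n] by (simp add: field_simps power2_eq_square power3_eq_cube)
  qed
  have "(\<lambda>n. (of_real a - of_real c) + (B n + Q n - of_real c * of_real a) * (1 / z n)
      + (Q n * of_real a - of_real c * B n) * (1 / z n)\<^sup>2 + Q n * B n * (1 / z n) ^ 3)
    \<longlonglongrightarrow> (of_real a - of_real c) + (of_real b + - of_real k - of_real c * of_real a) * 0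
      + (- of_real k * of_real a - of_real c * of_real b) * 0\<^sup>2 + - of_real k * of_real b * (0::complex) ^ 3"
    by (intro tendsto_intros B Q inv_z)
  then have ac: "a = c"
    unfolding expansion by (simp add: LIMSEQ_const_iff flip: of_real_diff)
  have expansion': "(B n + Q n - of_real a * of_real a)
      + (Q n * of_real a - of_real a * B n) * (1 / z n) + Q n * B n * (1 / z n)\<^sup>2 = 0" for n
    using expansion[of n, folded ac] z(2)[of n] by (simp add: field_simps power2_eq_square power3_eq_cube)
  have "(\<lambda>n. (B n + Q n - of_real a * of_real a)
      + (Q n * of_real a - of_real a * B n) * (1 / z n) + Q n * B n * (1 / z n)\<^sup>2)
    \<longlonglongrightarrow> (of_real b + - of_real k - of_real a * of_real a)
      + (- of_real k * of_real a - of_real a * of_real b) * 0 + - of_real k * of_real b * (0::complex)\<^sup>2"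
    by (intro tendsto_intros B Q inv_z)
  then have "complex_of_real b + - of_real k - of_real a * of_real a = 0"
    unfolding expansion' by (simp add: LIMSEQ_const_iff)
  then have "k = b - a\<^sup>2"
    by (simp add: power2_eq_square complex_eq_iff)
  moreover have "variance_of \<mu> = b - a\<^sup>2"
    unfolding variance_of_def a_def b_def using variance_eq[OF int1 int2] by simp
  ultimately show ?thesis by simp
qed

section \<open>Gronwall's inequality for an atomless measure\<close>

context finite_borel_measure
begin

lemma measure_Icc_atomless:
  assumes "measure M {s} = 0" "s \<le> t"
  shows "measure M {s..t} = cdf M t - cdf M s"
proof -
  have "{s..t} = {s} \<union> {s<..t}" using assms(2) by auto
  then have "measure M {s..t} = measure M {s} + measure M {s<..t}"
    using finite_measure_Union[OF sets_M sets_M, of "{s}" "{s<..t}"] by auto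
  then show ?thesis
    using assms cdf_diff_eq[of s t] by (cases "s = t") auto
qed

lemma continuous_set_integrable:
  fixes u :: "real \<Rightarrow> real"
  assumes "continuous_on {s..t} u"
  shows "set_integrable M {s..t} u"
proof -
  have "bounded (u ` {s..t})"
    using assms by (intro compact_imp_bounded compact_continuous_image) auto
  then obtain B where B: "\<And>x. x \<in> {s..t} \<Longrightarrow> \<bar>u x\<bar> \<le> B"
    by (metis bounded_iff real_norm_def imageI)
  have "(\<lambda>x. indicator {s..t} x *\<^sub>R u x) \<in> borel_measurable M"
    using borel_measurable_continuous_on_indicator[OF _ assms]
    by (simp add: measurable_cong_sets[OF M_is_borel refl])
  then show ?thesis
    unfolding set_integrable_def
    using B by (intro integrable_bounded[where B = "max 0 B"]) (auto simp: indicator_def le_max_iff_disj)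
qed

lemma set_integral_le_bound:
  fixes u :: "real \<Rightarrow> real"
  assumes "continuous_on {s..t} u" "\<And>x. x \<in> {s..t} \<Longrightarrow> u x \<le> B"
  shows "(LINT x:{s..t}|M. u x) \<le> B * measure M {s..t}"
proof -
  have "(LINT x:{s..t}|M. u x) \<le> (LINT x:{s..t}|M. B)"
    using assms continuous_set_integrable[of s t "\<lambda>_. B"]
    by (intro set_integral_mono continuous_set_integrable) auto
  also have "\<dots> = B * measure M {s..t}"
    using sets_M[of "{s..t}"] by (simp add: set_lebesgue_integral_def borel_UNIV mult.commute)
  finally show ?thesis .
qed

lemma set_integral_split_atomless:
  fixes u :: "real \<Rightarrow> real"
  assumes "continuous_on {s..t} u" "r \<in> {s..t}" "measure M {r} = 0"
  shows "(LINT x:{s..t}|M. u x) = (LINT x:{s..r}|M. u x) + (LINT x:{r..t}|M. u x)"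
proof -
  have "{s..t} = {s..r} \<union> {r..t}" using assms(2) by auto
  moreover have "(LINT x:{s..r} \<union> {r..t}|M. u x) = (LINT x:{s..r}|M. u x) + (LINT x:{r..t}|M. u x)"
  proof (rule set_integral_Un_AE)
    have "AE x in M. x \<noteq> r"
      using assms(3) by (intro AE_I[of _ _ "{r}"]) (auto simp: emeasure_eq_measure)
    then show "AE x in M. \<not> (x \<in> {s..r} \<and> x \<in> {r..t})"
      by eventually_elim auto
    show "set_integrable M {s..r} u" "set_integrable M {r..t} u"
      using assms by (auto intro!: continuous_set_integrable intro: continuous_on_subset)
  qed auto
  ultimately show ?thesis by simp
qed

text \<open>The tail mass \<open>\<nu>[r, b]\<close> is continuous in \<open>r\<close> as \<open>\<nu>\<close> has no atoms. A piece of \<open>[a, b]\<close> whose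
  mass times \<open>c\<close> is \<open>1/2\<close> can therefore be cut off; on it, the supremum of \<open>u\<close> is at most half of
  itself plus a contribution of the part already treated. The factorial is crude, but it depends
  on \<open>\<nu>\<close> only through a bound on its mass.\<close>

lemma gronwall_atomless:
  fixes u :: "real \<Rightarrow> real"
  assumes "a \<le> b" and "continuous_on {a..b} u" and "\<And>r. r \<in> {a..b} \<Longrightarrow> measure M {r} = 0"
    and "\<And>r. r \<in> {a..b} \<Longrightarrow> 0 \<le> u r"
    and "0 \<le> c" and "0 \<le> e"
    and "\<And>s. s \<in> {a..b} \<Longrightarrow> u s \<le> e + c * (LINT r:{s..b}|M. u r)"
    and "c * measure M {a..b} \<le> real N / 2"
  shows "\<forall>s\<in>{a..b}. u s \<le> fact (Suc N) * e"
  using assms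
proof (induction N arbitrary: a)
  case 0
  obtain s0 where s0: "s0 \<in> {a..b}" "\<And>s. s \<in> {a..b} \<Longrightarrow> u s \<le> u s0"
    using continuous_attains_sup[of "{a..b}" u] 0 by auto
  have "(LINT r:{s0..b}|M. u r) \<le> u s0 * measure M {s0..b}"
    using 0 s0 by (intro set_integral_le_bound) (auto intro: continuous_on_subset)
  also have "\<dots> \<le> u s0 * measure M {a..b}"
    using 0 s0 by (intro mult_left_mono finite_measure_mono) auto
  finally have "c * (LINT r:{s0..b}|M. u r) \<le> c * (u s0 * measure M {a..b})"
    using 0 by (intro mult_left_mono) auto
  also have "\<dots> = u s0 * (c * measure M {a..b})" by (simp add: ac_simps)
  also have "\<dots> \<le> 0"
    by (rule mult_nonneg_nonpos[OF 0(4)[OF s0(1)]]) (use 0(8) in simp)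
  finally have "u s0 \<le> e" using 0(7)[OF s0(1)] by simp
  then show ?case using s0(2) by force
next
  case (Suc N)
  show ?case
  proof (cases "c * measure M {a..b} \<le> real N / 2")
    case True
    have "fact (Suc N) * e \<le> fact (Suc (Suc N)) * e"
      using Suc.prems(6) by (intro mult_right_mono fact_mono) auto
    then show ?thesis
      using Suc.IH[of a] Suc.prems True order_trans by blast
  next
    case False
    have "continuous_on {a..b} (\<lambda>r. cdf M r)"
      using Suc.prems(3) by (intro continuous_at_imp_continuous_on) (auto simp: isCont_cdf)
    then have "continuous_on {a..b} (\<lambda>r. c * (cdf M b - cdf M r))"
      by (intro continuous_intros)
    then obtain a' where a': "a \<le> a'" "a' \<le> b" "c * (cdf M b - cdf M a') = real N / 2"
      using IVT2'[of "\<lambda>r. c * (cdf M b - cdf M r)" b "real N / 2" a] False Suc.prems(1)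
        measure_Icc_atomless[of a b] Suc.prems(3)[of a] by auto
    have m: "measure M {s..t} = cdf M t - cdf M s" if "a \<le> s" "s \<le> t" "t \<le> b" for s t
      using Suc.prems(3)[of s] that by (intro measure_Icc_atomless) auto
    \<comment> \<open>the bound that the induction hypothesis provides on \<open>[a', b]\<close>\<close>
    define Q where "Q = fact (Suc N) * e"
    have Q: "e \<le> Q"
      using Suc.prems(6) mult_right_mono[OF fact_ge_1, of e "Suc N"] by (simp add: Q_def del: fact_Suc)
    have "\<forall>s\<in>{a'..b}. u s \<le> Q"
      unfolding Q_def using Suc.prems a' m[of a' b]
      by (intro Suc.IH) (auto intro: continuous_on_subset)
    then have right: "\<And>s. s \<in> {a'..b} \<Longrightarrow> u s \<le> Q" by blast
    have cont: "continuous_on {a..a'} u"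
      using Suc.prems(2) by (rule continuous_on_subset) (use a' in auto)
    obtain s0 where s0: "s0 \<in> {a..a'}" "\<And>s. s \<in> {a..a'} \<Longrightarrow> u s \<le> u s0"
      using continuous_attains_sup[OF _ _ cont] a' by auto
    have us0: "0 \<le> u s0" using Suc.prems(4) s0(1) a' by auto
    have "(LINT r:{s0..b}|M. u r) = (LINT r:{s0..a'}|M. u r) + (LINT r:{a'..b}|M. u r)"
      using s0(1) a' Suc.prems(3)[of a'] continuous_on_subset[OF Suc.prems(2), of "{s0..b}"]
      by (intro set_integral_split_atomless) auto
    also have "(LINT r:{s0..a'}|M. u r) \<le> u s0 * measure M {s0..a'}"
      using s0 continuous_on_subset[OF cont] by (intro set_integral_le_bound) auto
    also have "(LINT r:{a'..b}|M. u r) \<le> Q * measure M {a'..b}"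
      using right continuous_on_subset[OF Suc.prems(2)] a' by (intro set_integral_le_bound) auto
    finally have "c * (LINT r:{s0..b}|M. u r) \<le> c * (u s0 * measure M {s0..a'} + Q * measure M {a'..b})"
      using Suc.prems(5) by (intro mult_left_mono) auto
    also have "\<dots> = u s0 * (c * measure M {s0..a'}) + Q * (c * measure M {a'..b})"
      by (simp add: algebra_simps)
    also have "c * measure M {a'..b} = real N / 2"
      using a' m[of a' b] by simp
    also have "u s0 * (c * measure M {s0..a'}) + Q * (real N / 2) \<le> u s0 * (1 / 2) + Q * (real N / 2)"
    proof -
      have "c * measure M {s0..a'} \<le> c * measure M {a..a'}"
        using s0(1) Suc.prems(5) by (intro mult_left_mono finite_measure_mono) auto
      also have "\<dots> = c * measure M {a..b} - c * (cdf M b - cdf M a')"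
        unfolding right_diff_distrib[symmetric] using a' m[of a a'] m[of a b] by simp
      also have "\<dots> \<le> 1 / 2"
        using a'(3) Suc.prems(8) by simp
      finally show ?thesis using us0 by (intro add_right_mono mult_left_mono)
    qed
    finally have "u s0 \<le> e + (u s0 * (1 / 2) + Q * (real N / 2))"
      using Suc.prems(7)[of s0] s0(1) a' by auto
    then have "u s0 \<le> 2 * e + real N * Q" by (simp add: field_simps)
    also have "\<dots> \<le> real (N + 2) * Q"
      using Q by (simp add: algebra_simps)
    also have "\<dots> = fact (Suc (Suc N)) * e"
      by (simp add: Q_def algebra_simps)
    finally have left: "u s0 \<le> fact (Suc (Suc N)) * e" .
    have "Q \<le> fact (Suc (Suc N)) * e"
      unfolding Q_def using Suc.prems(6) by (intro mult_right_mono fact_mono) auto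
    then show ?thesis
      using left s0(2) right by (metis atLeastAtMost_iff le_cases order_trans)
  qed
qed

text \<open>Reflecting time reduces an inequality with integrals over \<open>[0, s]\<close> to the previous one.\<close>

lemma gronwall_forward_zero:
  fixes u :: "real \<Rightarrow> real"
  assumes "0 \<le> b" and cont: "continuous_on {0..b} u" and atom: "\<And>r. r \<in> {0..b} \<Longrightarrow> measure M {r} = 0"
    and nonneg: "\<And>r. r \<in> {0..b} \<Longrightarrow> 0 \<le> u r" and "0 \<le> c"
    and ineq: "\<And>s. s \<in> {0..b} \<Longrightarrow> u s \<le> c * (LINT r:{0..s}|M. u r)"
    and s: "s \<in> {0..b}"
  shows "u s = 0"
proof -
  have refl_meas [measurable]: "uminus \<in> measurable M (borel :: real measure)"
    by (rule borel_measurable_uminus[OF measurable_ident_sets[OF M_is_borel]])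
  interpret R: finite_borel_measure "distr M borel uminus"
    by (intro finite_borel_measure.intro finite_measure_distr)
      (auto simp: finite_borel_measure_axioms_def measurable_ident_sets[OF M_is_borel])
  obtain N where N: "c * measure (distr M borel uminus) {-b..0} \<le> real N / 2"
    using real_arch_simple[of "2 * (c * measure (distr M borel uminus) {-b..0})"] by (auto simp: field_simps)
  have "\<forall>r\<in>{-b..0}. u (- r) \<le> fact (Suc N) * 0"
  proof (rule R.gronwall_atomless[OF _ _ _ _ \<open>0 \<le> c\<close> _ _ N])
    show "continuous_on {- b..0} (\<lambda>r. u (- r))"
      by (rule continuous_on_compose2[OF cont]) (auto intro!: continuous_intros)
    fix r assume r: "r \<in> {- b..0}"
    have "measure (distr M borel uminus) {r} = measure M (uminus -` {r} \<inter> space M)"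
      using refl_meas by (rule measure_distr) simp
    also have "uminus -` {r} \<inter> space M = {- r}"
      by (force simp: borel_UNIV)
    finally show "measure (distr M borel uminus) {r} = 0"
      using atom[of "- r"] r by simp
    show "0 \<le> u (- r)" using nonneg r by auto
    have "(LINT x:{r..0}|distr M borel uminus. u (- x)) = (LINT x:{0..-r}|M. u x)"
    proof -
      have "(\<lambda>x. indicator {r..0} x *\<^sub>R u (- x)) \<in> borel_measurable borel"
        using r by (intro borel_measurable_continuous_on_indicator continuous_on_compose2[OF cont])
          (auto intro!: continuous_intros)
      then have "(LINT x:{r..0}|distr M borel uminus. u (- x)) = (LINT x|M. indicator {r..0} (- x) *\<^sub>R u (- (- x)))"
        unfolding set_lebesgue_integral_def by (intro integral_distr refl_meas)
      also have "\<dots> = (LINT x:{0..-r}|M. u x)"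
        unfolding set_lebesgue_integral_def
        by (intro Bochner_Integration.integral_cong) (auto simp: indicator_def)
      finally show ?thesis .
    qed
    then show "u (- r) \<le> 0 + c * (LINT x:{r..0}|distr M borel uminus. u (- x))"
      using ineq[of "- r"] r by auto
  qed (use assms in auto)
  from bspec[OF this, of "- s"] have "u s \<le> 0" using s by auto
  then show ?thesis using nonneg[OF s] by simp
qed

end

section \<open>The integral equation of a reverse evolution family\<close>

abbreviation slice :: "real \<Rightarrow> real \<Rightarrow> (real \<times> real) set" where
  "slice s t \<equiv> UNIV \<times> {s..t}"

lemma closed_slice: "closed (slice s t)"
  by (intro closed_Times) auto

text \<open>A generator restricted to the times \<open>[0, T]\<close>, as a finite measure on the plane whose second
  coordinate is time.\<close>

locale atomless_in_time = finite_measure L for L :: "(real \<times> real) measure" +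
  fixes T :: real
  assumes sets_L: "sets L = sets borel"
    and T_nonneg: "0 \<le> T"
    and atomless: "t \<in> {0..T} \<Longrightarrow> measure L (UNIV \<times> {t}) = 0"
begin

lemma space_L: "space L = UNIV"
  using sets_eq_imp_space_eq[OF sets_L] by simp

lemma sets_slice: "slice s t \<in> sets L"
  unfolding sets_L using closed_slice by (rule borel_closed)

lemma slice_set_integrable:
  fixes h :: "real \<times> real \<Rightarrow> 'b::{banach,second_countable_topology}"
  assumes "continuous_on (slice s t) h" "\<And>p. p \<in> slice s t \<Longrightarrow> norm (h p) \<le> B"
  shows "set_integrable L (slice s t) h"
proof -
  have "(\<lambda>p. indicator (slice s t) p *\<^sub>R h p) \<in> borel_measurable L"
    using borel_measurable_continuous_on_indicator[OF borel_closed[OF closed_slice] assms(1)]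
    by (simp add: measurable_cong_sets[OF sets_L refl])
  then show ?thesis
    unfolding set_integrable_def
    using assms(2) by (intro integrable_bounded[where B = "max 0 B"]) (auto simp: indicator_def le_max_iff_disj)
qed

lemma slice_integral_norm_le:
  fixes h :: "real \<times> real \<Rightarrow> 'b::{banach,second_countable_topology}"
  assumes "continuous_on (slice s t) h" "\<And>p. p \<in> slice s t \<Longrightarrow> norm (h p) \<le> B"
  shows "norm (LINT p:slice s t|L. h p) \<le> B * measure L (slice s t)"
proof -
  have int: "set_integrable L (slice s t) h"
    by (rule slice_set_integrable[OF assms])
  have "norm (LINT p:slice s t|L. h p) \<le> (LINT p:slice s t|L. norm (h p))"
    using int by (rule set_integral_norm_bound)
  also have "\<dots> \<le> (LINT p:slice s t|L. B)"
    using int assms(2) slice_set_integrable[of s t "\<lambda>_. B" "\<bar>B\<bar>"]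
    by (intro set_integral_mono set_integrable_norm) auto
  also have "\<dots> = B * measure L (slice s t)"
    using sets_slice by (simp add: set_lebesgue_integral_def space_L mult.commute)
  finally show ?thesis .
qed

lemma slice_integral_split:
  fixes h :: "real \<times> real \<Rightarrow> 'b::{banach,second_countable_topology}"
  assumes "0 \<le> s" "s \<le> r" "r \<le> t" "t \<le> T"
    and "continuous_on (slice s t) h" "\<And>p. p \<in> slice s t \<Longrightarrow> norm (h p) \<le> B"
  shows "(LINT p:slice s t|L. h p) = (LINT p:slice s r|L. h p) + (LINT p:slice r t|L. h p)"
proof -
  have "slice s t = slice s r \<union> slice r t" using assms(2,3) by auto
  moreover have "(LINT p:slice s r \<union> slice r t|L. h p) = (LINT p:slice s r|L. h p) + (LINT p:slice r t|L. h p)"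
  proof (rule set_integral_Un_AE)
    have "AE p in L. p \<notin> slice r r"
      using assms(1-4) atomless[of r] sets_slice[of r r] by (intro AE_I[of _ _ "slice r r"]) (auto simp: emeasure_eq_measure)
    then show "AE p in L. \<not> (p \<in> slice s r \<and> p \<in> slice r t)"
      by eventually_elim auto
    show "set_integrable L (slice s r) h" "set_integrable L (slice r t) h"
      using assms by (auto intro!: slice_set_integrable[where B = B] intro: continuous_on_subset)
  qed (rule sets_slice)+
  ultimately show ?thesis by simp
qed

lemma slice_integral_empty_interior:
  fixes h :: "real \<times> real \<Rightarrow> complex"
  assumes "t \<in> {0..T}"
  shows "(LINT p:slice t t|L. h p) = 0"
proof -
  have "AE p in L. p \<notin> slice t t"
    using assms atomless[of t] sets_slice[of t t] by (intro AE_I[of _ _ "slice t t"]) (auto simp: emeasure_eq_measure)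
  then have "AE p in L. indicator (slice t t) p *\<^sub>R h p = 0"
    by eventually_elim auto
  then show ?thesis
    unfolding set_lebesgue_integral_def by (simp add: integral_eq_zero_AE)
qed

lemma measure_slice_le: "measure L (slice s t) \<le> measure L UNIV"
  using finite_measure_mono[of "slice s t" UNIV] sets_L by simp

lemma measure_slice_split:
  assumes "0 \<le> s" "s \<le> r" "r \<le> t" "t \<le> T"
  shows "measure L (slice s t) = measure L (slice s r) + measure L (slice r t)"
  using slice_integral_split[OF assms, of "\<lambda>_. 1 :: real" 1] sets_slice
  by (simp add: set_lebesgue_integral_def space_L)

text \<open>The error of a step function approximation in time: it is summed against the masses of the
  slices, so that it does not grow with the number of slices.\<close>

lemma slice_integral_step_approx:
  fixes h :: "real \<times> real \<Rightarrow> complex"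
  assumes a: "mono a" "\<And>j. a j \<in> {0..T}"
    and h: "continuous_on (slice (a 0) (a N)) h" "\<And>p. p \<in> slice (a 0) (a N) \<Longrightarrow> norm (h p) \<le> B"
    and g: "\<And>j. j < N \<Longrightarrow> continuous_on (slice (a j) (a (Suc j))) (g j)"
      "\<And>j p. j < N \<Longrightarrow> p \<in> slice (a j) (a (Suc j)) \<Longrightarrow> norm (g j p) \<le> B"
    and close: "\<And>j p. j < N \<Longrightarrow> p \<in> slice (a j) (a (Suc j)) \<Longrightarrow> norm (h p - g j p) \<le> \<omega>"
  shows "norm ((LINT p:slice (a 0) (a N)|L. h p) - (\<Sum>j<N. LINT p:slice (a j) (a (Suc j))|L. g j p))
    \<le> \<omega> * measure L (slice (a 0) (a N))"
  using h g close
proof (induction N)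
  case 0
  then show ?case
    using slice_integral_empty_interior[OF a(2)[of 0]] atomless[OF a(2)[of 0]] by simp
next
  case (Suc N)
  have le: "a 0 \<le> a N" "a N \<le> a (Suc N)" "a 0 \<le> a (Suc N)"
    using a(1) by (auto simp: mono_def)
  have sub: "slice (a 0) (a N) \<subseteq> slice (a 0) (a (Suc N))" "slice (a N) (a (Suc N)) \<subseteq> slice (a 0) (a (Suc N))"
    using le by auto
  have pos: "0 \<le> a 0" "a (Suc N) \<le> T" using a(2)[of 0] a(2)[of "Suc N"] by auto
  have IH: "norm ((LINT p:slice (a 0) (a N)|L. h p) - (\<Sum>j<N. LINT p:slice (a j) (a (Suc j))|L. g j p))
    \<le> \<omega> * measure L (slice (a 0) (a N))"
    using Suc.prems sub by (intro Suc.IH) (auto intro: continuous_on_subset)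
  have cont: "continuous_on (slice (a N) (a (Suc N))) h"
    using Suc.prems(1) sub(2) by (rule continuous_on_subset)
  have "(LINT p:slice (a N) (a (Suc N))|L. h p) - (LINT p:slice (a N) (a (Suc N))|L. g N p)
      = (LINT p:slice (a N) (a (Suc N))|L. h p - g N p)"
    using Suc.prems sub(2)
    by (intro set_integral_diff(2)[symmetric] slice_set_integrable[where B = B] cont) auto
  also have "norm \<dots> \<le> \<omega> * measure L (slice (a N) (a (Suc N)))"
    using Suc.prems cont by (intro slice_integral_norm_le continuous_on_diff) auto
  finally have last: "norm ((LINT p:slice (a N) (a (Suc N))|L. h p) - (LINT p:slice (a N) (a (Suc N))|L. g N p))
      \<le> \<omega> * measure L (slice (a N) (a (Suc N)))" .
  have "(LINT p:slice (a 0) (a (Suc N))|L. h p)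
      = (LINT p:slice (a 0) (a N)|L. h p) + (LINT p:slice (a N) (a (Suc N))|L. h p)"
    using Suc.prems le pos by (intro slice_integral_split[where B = B]) auto
  moreover have "measure L (slice (a 0) (a (Suc N))) = measure L (slice (a 0) (a N)) + measure L (slice (a N) (a (Suc N)))"
    using le pos by (intro measure_slice_split) auto
  ultimately show ?case
    using norm_triangle_le[OF add_mono[OF IH last]] by (simp add: algebra_simps)
qed

definition time_marginal :: "real measure" where
  "time_marginal = distr L borel snd"

lemma snd_measurable [measurable]: "snd \<in> measurable L (borel :: real measure)"
  unfolding measurable_cong_sets[OF sets_L refl] borel_prod[symmetric] by measurable

lemma finite_borel_time_marginal: "finite_borel_measure time_marginal"
  unfolding time_marginal_def
  by (intro finite_borel_measure.intro finite_measure_distr) (auto simp: finite_borel_measure_axioms_def)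

lemma measure_time_marginal:
  assumes "A \<in> sets borel"
  shows "measure time_marginal A = measure L (UNIV \<times> A)"
proof -
  have "snd -` A = (UNIV \<times> A :: (real \<times> real) set)" by auto
  then show ?thesis
    unfolding time_marginal_def using assms by (simp add: measure_distr space_L)
qed

lemma integral_time_marginal:
  fixes u :: "real \<Rightarrow> real"
  assumes "continuous_on {s..t} u"
  shows "(LINT r:{s..t}|time_marginal. u r) = (LINT p:slice s t|L. u (snd p))"
proof -
  have "(LINT r:{s..t}|time_marginal. u r) = (LINT p|L. indicator {s..t} (snd p) *\<^sub>R u (snd p))"
    unfolding set_lebesgue_integral_def time_marginal_def
    using borel_measurable_continuous_on_indicator[OF _ assms] by (intro integral_distr) auto
  also have "\<dots> = (LINT p:slice s t|L. u (snd p))"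
    unfolding set_lebesgue_integral_def
    by (intro Bochner_Integration.integral_cong) (auto simp: indicator_def)
  finally show ?thesis .
qed

end

text \<open>The properties of a reverse evolution family \<open>f\<close> on \<open>[0, T]\<close> that the convergence proof
  uses; \<open>L\<close> is the generator on \<open>\<real> \<times> [0, T]\<close> and \<open>m\<close> the drift.\<close>

locale loewner_flow = atomless_in_time +
  fixes m :: "real \<Rightarrow> real" and f :: "real \<Rightarrow> real \<Rightarrow> complex \<Rightarrow> complex"
  assumes m_0: "m 0 = 0"
    and m_continuous: "continuous_on {0..T} m"
    and f_continuous: "continuous_on (upper_half_plane \<times> ordered_pairs {0..T}) (\<lambda>(z, s, t). f s t z)"
    and Im_f: "0 \<le> s \<Longrightarrow> s \<le> t \<Longrightarrow> t \<le> T \<Longrightarrow> 0 < Im z \<Longrightarrow> Im z \<le> Im (f s t z)"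
    and f_comp: "0 \<le> s \<Longrightarrow> s \<le> t \<Longrightarrow> t \<le> u \<Longrightarrow> u \<le> T \<Longrightarrow> 0 < Im z \<Longrightarrow> f s u z = f s t (f t u z)"
    and equation: "0 \<le> s \<Longrightarrow> s \<le> t \<Longrightarrow> t \<le> T \<Longrightarrow> 0 < Im z \<Longrightarrow>
      f s t z = z - of_real (m t) + of_real (m s) + (LINT p:slice s t|L. 1 / (of_real (fst p) - f (snd p) t z))"
begin

lemma flow_continuous_in_time:
  assumes "0 \<le> s" "t \<le> T" "0 < Im z"
  shows "continuous_on {s..t} (\<lambda>r. f r t z)"
proof -
  have "continuous_on {s..t} (\<lambda>r. (\<lambda>(z, s, t). f s t z) (z, r, t))"
    using assms by (intro continuous_on_compose2[OF f_continuous])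
      (auto simp: upper_half_plane_def ordered_pairs_def intro!: continuous_intros)
  then show ?thesis by simp
qed

end

lemma reverse_kernel_eq: "1 / (complex_of_real x - w) = - (1 / (w - of_real x))"
  using minus_divide_right[of 1 "w - of_real x"] by simp

lemma reverse_kernel_norm_le:
  assumes "0 < y" "y \<le> Im w"
  shows "norm (1 / (complex_of_real x - w)) \<le> 1 / y"
proof -
  have "norm (1 / (complex_of_real x - w)) = norm (1 / (w - of_real x))"
    unfolding reverse_kernel_eq by (rule norm_minus_cancel)
  also have "\<dots> \<le> 1 / Im w"
    using assms by (intro norm_kernel_le) auto
  also have "\<dots> \<le> 1 / y"
    using assms by (intro divide_left_mono mult_pos_pos) auto
  finally show ?thesis .
qed

lemma reverse_kernel_diff_le:
  assumes "0 < y" "y \<le> Im z" "y \<le> Im w"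
  shows "norm (1 / (complex_of_real x - z) - 1 / (complex_of_real x - w)) \<le> norm (z - w) / y\<^sup>2"
proof -
  have "1 / (complex_of_real x - z) - 1 / (complex_of_real x - w) = - (1 / (z - of_real x) - 1 / (w - of_real x))"
    unfolding reverse_kernel_eq by (rule minus_diff_minus)
  then show ?thesis
    using norm_kernel_diff_le[OF assms, of x] by (simp only: norm_minus_cancel)
qed

lemma reverse_kernel_nonzero: "0 < Im w \<Longrightarrow> complex_of_real x - w \<noteq> 0"
  by (auto simp: complex_eq_iff)

lemma continuous_on_reverse_kernel:
  assumes "continuous_on {s..t} w" "\<And>r. r \<in> {s..t} \<Longrightarrow> 0 < Im (w r)"
  shows "continuous_on (slice s t) (\<lambda>p. 1 / (complex_of_real (fst p) - w (snd p)))"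
  using assms(2) reverse_kernel_nonzero
  by (intro continuous_intros continuous_on_compose2[OF assms(1)]) auto

text \<open>Up to the sign, the Cauchy transform of the marginal \<open>\<kappa>\<^sub>t\<close>; the sign is that of the kernel in
  the integral equation.\<close>

definition marginal_transform :: "(real \<times> real) measure \<Rightarrow> real \<Rightarrow> complex \<Rightarrow> complex" where
  "marginal_transform L t w = (LINT p:slice 0 t|L. 1 / (of_real (fst p) - w))"

context atomless_in_time
begin

text \<open>The Lipschitz estimate for the integral term of the equation, in the form that Gronwall's
  inequality for the time marginal needs.\<close>

lemma kernel_integral_diff_le:
  assumes v: "continuous_on {s..t} v" "\<And>r. r \<in> {s..t} \<Longrightarrow> y \<le> Im (v r)"
    and w: "continuous_on {s..t} w" "\<And>r. r \<in> {s..t} \<Longrightarrow> y \<le> Im (w r)" and y: "0 < y"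
  shows "norm ((LINT p:slice s t|L. 1 / (of_real (fst p) - v (snd p))) -
      (LINT p:slice s t|L. 1 / (of_real (fst p) - w (snd p))))
    \<le> 1 / y\<^sup>2 * (LINT r:{s..t}|time_marginal. norm (v r - w r))"
proof -
  define k where "k v p = 1 / (complex_of_real (fst p) - v (snd p))" for v and p :: "real \<times> real"
  have int: "set_integrable L (slice s t) (k v)"
    if "continuous_on {s..t} v" "\<And>r. r \<in> {s..t} \<Longrightarrow> y \<le> Im (v r)" for v
    unfolding k_def using that y
    by (intro slice_set_integrable[where B = "1 / y"] continuous_on_reverse_kernel reverse_kernel_norm_le) force+
  have int_diff: "set_integrable L (slice s t) (\<lambda>p. k v p - k w p)"
    using int[OF v] int[OF w] by (rule set_integral_diff(1))
  have cont: "continuous_on {s..t} (\<lambda>r. norm (v r - w r))"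
    using v w by (intro continuous_intros)
  have "(LINT p:slice s t|L. k v p) - (LINT p:slice s t|L. k w p) = (LINT p:slice s t|L. k v p - k w p)"
    using int[OF v] int[OF w] by (rule set_integral_diff(2)[symmetric])
  also have "norm \<dots> \<le> (LINT p:slice s t|L. norm (k v p - k w p))"
    using int_diff by (rule set_integral_norm_bound)
  also have "\<dots> \<le> (LINT p:slice s t|L. 1 / y\<^sup>2 * norm (v (snd p) - w (snd p)))"
  proof (rule set_integral_mono)
    show "set_integrable L (slice s t) (\<lambda>p. norm (k v p - k w p))"
      using int_diff by (rule set_integrable_norm)
    have "bounded ((\<lambda>r. norm (v r - w r)) ` {s..t})"
      using cont by (intro compact_imp_bounded compact_continuous_image) auto
    then obtain B where "\<forall>x\<in>(\<lambda>r. norm (v r - w r)) ` {s..t}. norm x \<le> B"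
      unfolding bounded_iff by blast
    then have "norm (norm (v r - w r)) \<le> B" if "r \<in> {s..t}" for r
      using that by blast
    then show "set_integrable L (slice s t) (\<lambda>p. 1 / y\<^sup>2 * norm (v (snd p) - w (snd p)))"
      by (intro set_integrable_mult_right slice_set_integrable[where B = B] continuous_on_compose2[OF cont])
        (auto intro!: continuous_intros)
    show "norm (k v p - k w p) \<le> 1 / y\<^sup>2 * norm (v (snd p) - w (snd p))" if "p \<in> slice s t" for p
      unfolding k_def using reverse_kernel_diff_le[OF y v(2) w(2), of "snd p" "snd p" "fst p"] that by auto
  qed
  also have "\<dots> = 1 / y\<^sup>2 * (LINT p:slice s t|L. norm (v (snd p) - w (snd p)))"
    by (rule set_integral_mult_right)
  also have "(LINT p:slice s t|L. norm (v (snd p) - w (snd p))) = (LINT r:{s..t}|time_marginal. norm (v r - w r))"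
    using integral_time_marginal[OF cont] by (rule sym)
  finally show ?thesis unfolding k_def .
qed

lemma marginal_transform_increment:
  assumes "0 \<le> s" "s \<le> t" "t \<le> T" "0 < Im w"
  shows "(LINT p:slice s t|L. 1 / (of_real (fst p) - w)) = marginal_transform L t w - marginal_transform L s w"
  unfolding marginal_transform_def
  using assms slice_integral_split[of 0 s t "\<lambda>p. 1 / (of_real (fst p) - w)" "1 / Im w"]
    continuous_on_reverse_kernel[of 0 t "\<lambda>_. w"] reverse_kernel_norm_le[of "Im w" w]
  by auto

end

context loewner_flow
begin

lemma Im_flow_ge:
  assumes "0 < y" "y \<le> Im z" "0 \<le> s" "s \<le> t" "t \<le> T"
  shows "y \<le> Im (f s t z)"
  using Im_f[of s t z] assms by linarith

lemma flow_kernel: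
  assumes "0 < y" "y \<le> Im z" "0 \<le> s" "t \<le> T"
  shows "continuous_on (slice s t) (\<lambda>p. 1 / (of_real (fst p) - f (snd p) t z))"
    and "\<And>p. p \<in> slice s t \<Longrightarrow> norm (1 / (of_real (fst p) - f (snd p) t z)) \<le> 1 / y"
proof -
  have Im: "y \<le> Im (f r t z)" if "r \<in> {s..t}" for r
    using Im_flow_ge[OF assms(1,2), of r t] that assms by auto
  show "continuous_on (slice s t) (\<lambda>p. 1 / (of_real (fst p) - f (snd p) t z))"
    using Im assms by (intro continuous_on_reverse_kernel flow_continuous_in_time) force+
  show "norm (1 / (of_real (fst p) - f (snd p) t z)) \<le> 1 / y" if "p \<in> slice s t" for p
    using Im[of "snd p"] that assms(1) by (intro reverse_kernel_norm_le) auto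
qed

text \<open>This bound is the same for all families whose generators have bounded mass, and it becomes
  arbitrarily good high up in the half-plane.\<close>

lemma flow_minus_drift_le:
  assumes "0 < y" "y \<le> Im z" "0 \<le> s" "s \<le> t" "t \<le> T"
  shows "norm (f s t z - (z - of_real (m t) + of_real (m s))) \<le> measure L (slice s t) / y"
  using slice_integral_norm_le[OF flow_kernel[OF assms(1,2,3,5)]] equation[OF assms(3,4,5)] assms(1,2)
  by simp

lemma flow_same_time: "t \<in> {0..T} \<Longrightarrow> 0 < Im z \<Longrightarrow> f t t z = z"
  using flow_minus_drift_le[of "Im z" z t t] atomless[of t] by simp

text \<open>If the values at time \<open>0\<close> agree, then \<open>z - w\<close> cancels against integrals over \<open>[0, t]\<close>, and
  the difference at time \<open>s\<close> is left as an integral over \<open>[0, s]\<close>. Gronwall's inequality forces it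
  to vanish up to time \<open>t\<close>, where it equals \<open>z - w\<close>.\<close>

lemma flow_injective:
  assumes t: "0 \<le> t" "t \<le> T" and z: "0 < Im z" "0 < Im w" and eq: "f 0 t z = f 0 t w"
  shows "z = w"
proof -
  interpret \<nu>: finite_borel_measure time_marginal
    by (rule finite_borel_time_marginal)
  define y where "y = min (Im z) (Im w)"
  have y: "0 < y" "y \<le> Im z" "y \<le> Im w" using z by (auto simp: y_def)
  define k where "k v p = 1 / (complex_of_real (fst p) - f (snd p) t v)" for v and p :: "real \<times> real"
  define u where "u r = norm (f r t z - f r t w)" for r
  have cont_u: "continuous_on {s..t} u" if "0 \<le> s" for s
    unfolding u_def using that t z by (intro continuous_intros flow_continuous_in_time)
  have k: "continuous_on (slice s r) (k v)" "\<And>p. p \<in> slice s r \<Longrightarrow> norm (k v p) \<le> 1 / y"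
    if "v \<in> {z, w}" "0 \<le> s" "r \<le> t" for v s r
  proof -
    have sub: "slice s r \<subseteq> slice s t" using that(3) by auto
    have v: "y \<le> Im v" using that(1) y by auto
    show "continuous_on (slice s r) (k v)"
      unfolding k_def using flow_kernel(1)[OF y(1) v that(2) t(2)] sub by (rule continuous_on_subset)
    show "norm (k v p) \<le> 1 / y" if "p \<in> slice s r" for p
      unfolding k_def using flow_kernel(2)[OF y(1) v \<open>0 \<le> s\<close> t(2)] sub that by blast
  qed
  have "u s \<le> 1 / y\<^sup>2 * (LINT r:{0..s}|time_marginal. u r)" if s: "s \<in> {0..t}" for s
  proof -
    have eqs: "f r t v = v - of_real (m t) + of_real (m r) + (LINT p:slice r t|L. k v p)"
      if "v \<in> {z, w}" "r \<in> {0..t}" for v r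
      unfolding k_def using that t z by (intro equation) auto
    have split: "(LINT p:slice 0 t|L. k v p) = (LINT p:slice 0 s|L. k v p) + (LINT p:slice s t|L. k v p)"
      if "v \<in> {z, w}" for v
      using s t k[OF that] by (intro slice_integral_split[where B = "1 / y"]) auto
    have "f s t z - f s t w = z + (LINT p:slice s t|L. k z p) - (w + (LINT p:slice s t|L. k w p))"
      using eqs[of z s] eqs[of w s] s by simp
    also have "\<dots> = (LINT p:slice 0 s|L. k w p) - (LINT p:slice 0 s|L. k z p)"
    proof -
      have "z + ((LINT p:slice 0 s|L. k z p) + (LINT p:slice s t|L. k z p))
        = w + ((LINT p:slice 0 s|L. k w p) + (LINT p:slice s t|L. k w p))"
        using eq eqs[of z 0] eqs[of w 0] split[of z] split[of w] t by simp
      then show ?thesis by (simp add: algebra_simps)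
    qed
    finally have "u s = norm ((LINT p:slice 0 s|L. k w p) - (LINT p:slice 0 s|L. k z p))"
      by (simp add: u_def)
    also have "\<dots> \<le> 1 / y\<^sup>2 * (LINT r:{0..s}|time_marginal. norm (f r t w - f r t z))"
      unfolding k_def
    proof (rule kernel_integral_diff_le[OF _ _ _ _ y(1)])
      show "continuous_on {0..s} (\<lambda>r. f r t w)" "continuous_on {0..s} (\<lambda>r. f r t z)"
        using s t z by (auto intro: continuous_on_subset[OF flow_continuous_in_time[of 0 t]])
    qed (use s t Im_flow_ge[OF y(1)] y in auto)
    finally show ?thesis by (simp add: u_def norm_minus_commute)
  qed
  then have "u t = 0"
    using t cont_u[of 0] atomless
    by (intro \<nu>.gronwall_forward_zero[of t u "1 / y\<^sup>2"]) (auto simp: u_def measure_time_marginal)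
  then show ?thesis
    using flow_same_time[of t] t z by (simp add: u_def)
qed

end

section \<open>Stability of the integral equation\<close>

text \<open>The multiples of \<open>d\<close> clamped to \<open>[s, t]\<close>. One number of steps then serves all \<open>s \<le> t \<le> T\<close>;
  surplus steps have length zero.\<close>

definition time_grid :: "real \<Rightarrow> real \<Rightarrow> real \<Rightarrow> nat \<Rightarrow> real" where
  "time_grid s t d j = max s (min (real j * d) t)"

lemma time_grid_props:
  assumes "0 \<le> s" "s \<le> t" "0 < d" "t \<le> real N * d"
  shows "time_grid s t d 0 = s" "time_grid s t d N = t" "mono (time_grid s t d)"
    "time_grid s t d j \<in> {s..t}" "time_grid s t d (Suc j) - time_grid s t d j \<le> d"
proof -
  show "time_grid s t d 0 = s" "time_grid s t d N = t" "time_grid s t d j \<in> {s..t}"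
    using assms by (auto simp: time_grid_def)
  show "mono (time_grid s t d)"
    unfolding time_grid_def using assms(3)
    by (intro monoI max.mono order_refl min.mono mult_right_mono) auto
  have "real (Suc j) * d = real j * d + d" by (simp add: algebra_simps)
  then show "time_grid s t d (Suc j) - time_grid s t d j \<le> d"
    using assms(3) unfolding time_grid_def by linarith
qed

text \<open>With \<open>v\<close> frozen on each step, the integral depends on the measure only through increments in
  time of its marginal transform at finitely many points.\<close>

lemma (in atomless_in_time) kernel_integral_grid_approx:
  assumes v: "continuous_on {s..t} v" "\<And>r. r \<in> {s..t} \<Longrightarrow> y \<le> Im (v r)" and y: "0 < y"
    and st: "0 \<le> s" "s \<le> t" "t \<le> T" and d: "0 < d" "t \<le> real N * d"
    and osc: "\<And>r r'. r \<in> {s..t} \<Longrightarrow> r' \<in> {s..t} \<Longrightarrow> \<bar>r - r'\<bar> \<le> d \<Longrightarrow> norm (v r - v r') \<le> \<omega>"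
    and mass: "measure L UNIV \<le> C"
  defines "a \<equiv> time_grid s t d"
  shows "norm ((LINT p:slice s t|L. 1 / (of_real (fst p) - v (snd p))) -
      (\<Sum>j<N. marginal_transform L (a (Suc j)) (v (a j)) - marginal_transform L (a j) (v (a j))))
    \<le> \<omega> / y\<^sup>2 * C"
proof -
  note grid = time_grid_props[OF st(1,2) d]
  have a: "a 0 = s" "a N = t" "mono a" "\<And>j. a j \<in> {s..t}" "\<And>j. a (Suc j) - a j \<le> d" "\<And>j. a j \<le> a (Suc j)"
    using grid by (auto simp: a_def mono_def)
  have a_T: "a j \<in> {0..T}" for j using a(4)[of j] st by auto
  have \<omega>: "0 \<le> \<omega>"
    using osc[of s s] st d by simp
  have "norm ((LINT p:slice (a 0) (a N)|L. 1 / (of_real (fst p) - v (snd p))) -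
      (\<Sum>j<N. LINT p:slice (a j) (a (Suc j))|L. 1 / (of_real (fst p) - v (a j))))
    \<le> \<omega> / y\<^sup>2 * measure L (slice (a 0) (a N))"
  proof (rule slice_integral_step_approx[OF a(3) a_T, where B = "1 / y"])
    show "continuous_on (slice (a 0) (a N)) (\<lambda>p. 1 / (complex_of_real (fst p) - v (snd p)))"
      unfolding a using v y by (intro continuous_on_reverse_kernel) force+
    show "norm (1 / (complex_of_real (fst p) - v (snd p))) \<le> 1 / y" if "p \<in> slice (a 0) (a N)" for p
      using that v(2) y unfolding a by (intro reverse_kernel_norm_le) auto
    show "continuous_on (slice (a j) (a (Suc j))) (\<lambda>p. 1 / (complex_of_real (fst p) - v (a j)))" for j
      using v(2)[OF a(4)] y by (intro continuous_on_reverse_kernel[where w = "\<lambda>_. v (a j)"]) (auto intro: less_le_trans)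
    show "norm (1 / (complex_of_real (fst p) - v (a j))) \<le> 1 / y" for p :: "real \<times> real" and j
      using v(2)[OF a(4)] y by (intro reverse_kernel_norm_le)
    fix j p assume p: "p \<in> slice (a j) (a (Suc j))"
    have snd_p: "snd p \<in> {s..t}" "\<bar>snd p - a j\<bar> \<le> d"
      using p a(4)[of j] a(4)[of "Suc j"] a(5)[of j] by auto
    have "norm (1 / (complex_of_real (fst p) - v (snd p)) - 1 / (of_real (fst p) - v (a j)))
        \<le> norm (v (snd p) - v (a j)) / y\<^sup>2"
      by (rule reverse_kernel_diff_le[OF y v(2)[OF snd_p(1)] v(2)[OF a(4)]])
    also have "\<dots> \<le> \<omega> / y\<^sup>2"
      using osc[OF snd_p(1) a(4) snd_p(2)] by (intro divide_right_mono) auto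
    finally show "norm (1 / (complex_of_real (fst p) - v (snd p)) - 1 / (of_real (fst p) - v (a j))) \<le> \<omega> / y\<^sup>2" .
  qed
  also have "\<dots> \<le> \<omega> / y\<^sup>2 * C"
    using \<omega> order_trans[OF measure_slice_le mass] by (intro mult_left_mono) auto
  also have "(\<Sum>j<N. LINT p:slice (a j) (a (Suc j))|L. 1 / (of_real (fst p) - v (a j)))
      = (\<Sum>j<N. marginal_transform L (a (Suc j)) (v (a j)) - marginal_transform L (a j) (v (a j)))"
    using a_T a(6) v(2)[OF a(4)] y
    by (intro sum.cong refl marginal_transform_increment) (auto intro: less_le_trans)
  finally show ?thesis unfolding a .
qed

text \<open>The integral equation over one step expresses the increment of \<open>f\<close> at \<open>z\<close> by an integral in
  which \<open>f\<close> is close to \<open>z\<close>. Replacing it by \<open>z\<close> and summing recovers the marginal transform, and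
  the drift terms telescope.\<close>

lemma (in loewner_flow) marginal_transform_grid_approx:
  assumes y: "0 < y" "y \<le> Im z" and t: "0 \<le> t" "t \<le> T" and d: "0 < d" "t \<le> real N * d"
    and near: "\<And>r u. 0 \<le> r \<Longrightarrow> r \<le> u \<Longrightarrow> u \<le> T \<Longrightarrow> u - r \<le> d \<Longrightarrow> norm (f r u z - z) \<le> \<omega>"
    and mass: "measure L UNIV \<le> C"
  defines "a \<equiv> time_grid 0 t d"
  shows "norm (marginal_transform L t z - (of_real (m t) + (\<Sum>j<N. f (a j) (a (Suc j)) z - z)))
    \<le> \<omega> / y\<^sup>2 * C"
proof -
  note grid = time_grid_props[OF order_refl t(1) d]
  have a: "a 0 = 0" "a N = t" "mono a" "\<And>j. a j \<in> {0..t}" "\<And>j. a (Suc j) - a j \<le> d" "\<And>j. a j \<le> a (Suc j)"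
    using grid by (auto simp: a_def mono_def)
  have a_T: "a j \<in> {0..T}" for j using a(4)[of j] t by auto
  have \<omega>: "0 \<le> \<omega>"
    using order_trans[OF norm_ge_zero near[of 0 0]] T_nonneg d(1) by simp
  have z: "0 < Im z" using y by linarith
  define g where "g j p = 1 / (complex_of_real (fst p) - f (snd p) (a (Suc j)) z)" for j and p :: "real \<times> real"
  have "norm ((LINT p:slice (a 0) (a N)|L. 1 / (of_real (fst p) - z)) -
      (\<Sum>j<N. LINT p:slice (a j) (a (Suc j))|L. g j p))
    \<le> \<omega> / y\<^sup>2 * measure L (slice (a 0) (a N))"
  proof (rule slice_integral_step_approx[OF a(3) a_T, where B = "1 / y"])
    show "continuous_on (slice (a 0) (a N)) (\<lambda>p. 1 / (complex_of_real (fst p) - z))"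
      using z by (intro continuous_on_reverse_kernel[where w = "\<lambda>_. z"]) auto
    show "norm (1 / (complex_of_real (fst p) - z)) \<le> 1 / y" for p :: "real \<times> real"
      using y by (intro reverse_kernel_norm_le)
    show "continuous_on (slice (a j) (a (Suc j))) (g j)"
      "\<And>p. p \<in> slice (a j) (a (Suc j)) \<Longrightarrow> norm (g j p) \<le> 1 / y" for j
      unfolding g_def using flow_kernel[OF y, of "a j" "a (Suc j)"] a_T[of j] a_T[of "Suc j"] by auto
    fix j p assume p: "p \<in> slice (a j) (a (Suc j))"
    have snd_p: "0 \<le> snd p" "snd p \<le> a (Suc j)" "a (Suc j) - snd p \<le> d"
      using p a_T[of j] a(5)[of j] by auto
    have "norm (1 / (complex_of_real (fst p) - z) - g j p) \<le> norm (z - f (snd p) (a (Suc j)) z) / y\<^sup>2"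
      unfolding g_def using Im_flow_ge[OF y snd_p(1,2)] a_T[of "Suc j"] y
      by (intro reverse_kernel_diff_le) auto
    also have "\<dots> \<le> \<omega> / y\<^sup>2"
      using near[OF snd_p(1,2) _ snd_p(3)] a_T[of "Suc j"]
      by (intro divide_right_mono) (auto simp: norm_minus_commute)
    finally show "norm (1 / (complex_of_real (fst p) - z) - g j p) \<le> \<omega> / y\<^sup>2" .
  qed
  also have "\<dots> \<le> \<omega> / y\<^sup>2 * C"
    using \<omega> order_trans[OF measure_slice_le mass] by (intro mult_left_mono) auto
  also have "(\<Sum>j<N. LINT p:slice (a j) (a (Suc j))|L. g j p)
      = (\<Sum>j<N. (f (a j) (a (Suc j)) z - z) + (of_real (m (a (Suc j))) - of_real (m (a j))))"
  proof (intro sum.cong refl)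
    fix j
    show "(LINT p:slice (a j) (a (Suc j))|L. g j p)
        = (f (a j) (a (Suc j)) z - z) + (of_real (m (a (Suc j))) - of_real (m (a j)))"
      unfolding g_def using equation[of "a j" "a (Suc j)" z] a_T[of j] a_T[of "Suc j"] a(6)[of j] z by auto
  qed
  also have "\<dots> = (\<Sum>j<N. f (a j) (a (Suc j)) z - z) + (of_real (m (a N)) - of_real (m (a 0)))"
    unfolding sum.distrib by (subst sum_lessThan_telescope) simp
  also have "\<dots> = of_real (m t) + (\<Sum>j<N. f (a j) (a (Suc j)) z - z)"
    unfolding a m_0 by simp
  finally show ?thesis unfolding a marginal_transform_def .
qed

text \<open>The hypothesis compares the generators along the known flow \<open>f'\<close> only. Exchanging \<open>f\<close> for
  \<open>f'\<close> inside the integral against \<open>L\<close> is left to Gronwall's inequality, with a constant depending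
  only on \<open>C\<close> and \<open>y\<close>.\<close>

lemma flow_stability:
  assumes F: "loewner_flow L T m f" and G: "loewner_flow L' T m' f'"
    and y: "0 < y" "y \<le> Im z" and t: "t \<in> {0..T}"
    and mass: "measure L UNIV \<le> C" "C / y\<^sup>2 \<le> real N / 2"
    and data: "\<And>s. s \<in> {0..t} \<Longrightarrow> \<bar>m t - m' t\<bar> + \<bar>m s - m' s\<bar> +
      norm ((LINT p:slice s t|L. 1 / (of_real (fst p) - f' (snd p) t z)) -
        (LINT p:slice s t|L'. 1 / (of_real (fst p) - f' (snd p) t z))) \<le> \<eta>"
    and s: "s \<in> {0..t}"
  shows "norm (f s t z - f' s t z) \<le> fact (Suc N) * \<eta>"
proof -
  interpret F: loewner_flow L T m f by fact
  interpret G: loewner_flow L' T m' f' by fact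
  interpret \<nu>: finite_borel_measure F.time_marginal by (rule F.finite_borel_time_marginal)
  have z: "0 < Im z" using y by linarith
  have cont: "continuous_on {0..t} (\<lambda>r. f r t z)" "continuous_on {0..t} (\<lambda>r. f' r t z)"
    using t z by (auto intro!: F.flow_continuous_in_time G.flow_continuous_in_time)
  have "\<forall>s\<in>{0..t}. norm (f s t z - f' s t z) \<le> fact (Suc N) * \<eta>"
  proof (rule \<nu>.gronwall_atomless[where c = "1 / y\<^sup>2"])
    show "continuous_on {0..t} (\<lambda>s. norm (f s t z - f' s t z))"
      using cont by (intro continuous_intros)
    show "measure F.time_marginal {r} = 0" if "r \<in> {0..t}" for r
      using that t F.atomless[of r] by (simp add: F.measure_time_marginal)
    show "0 \<le> \<eta>" using data[OF s] by (smt (verit) norm_ge_zero)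
    have "measure F.time_marginal {0..t} \<le> C"
      using F.measure_slice_le[of 0 t] mass(1) by (simp add: F.measure_time_marginal)
    then have "1 / y\<^sup>2 * measure F.time_marginal {0..t} \<le> C / y\<^sup>2"
      by (simp add: divide_right_mono)
    then show "1 / y\<^sup>2 * measure F.time_marginal {0..t} \<le> real N / 2"
      using mass(2) by linarith
    fix s assume s: "s \<in> {0..t}"
    define I where "I M v = (LINT p:slice s t|M. 1 / (complex_of_real (fst p) - v (snd p) t z))"
      for M :: "(real \<times> real) measure" and v
    have "f s t z - f' s t z = of_real (m' t - m t) + of_real (m s - m' s) + (I L f' - I L' f') + (I L f - I L f')"
      using F.equation[of s t z] G.equation[of s t z] s t z by (simp add: I_def)
    also have "norm \<dots> \<le> \<bar>m t - m' t\<bar> + \<bar>m s - m' s\<bar> + norm (I L f' - I L' f') + norm (I L f - I L f')"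
      by (intro norm_triangle_le add_mono order_refl) (simp_all only: norm_of_real abs_minus_commute order_refl)
    also have "\<dots> \<le> \<eta> + 1 / y\<^sup>2 * (LINT r:{s..t}|F.time_marginal. norm (f r t z - f' r t z))"
    proof (rule add_mono)
      show "\<bar>m t - m' t\<bar> + \<bar>m s - m' s\<bar> + norm (I L f' - I L' f') \<le> \<eta>"
        unfolding I_def by (rule data[OF s])
      have sub: "{s..t} \<subseteq> {0..t}" using s by auto
      show "norm (I L f - I L f') \<le> 1 / y\<^sup>2 * (LINT r:{s..t}|F.time_marginal. norm (f r t z - f' r t z))"
        unfolding I_def using s t y F.Im_flow_ge[OF y] G.Im_flow_ge[OF y]
        by (intro F.kernel_integral_diff_le continuous_on_subset[OF cont(1) sub] continuous_on_subset[OF cont(2) sub]) auto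
    qed
    finally show "norm (f s t z - f' s t z)
        \<le> \<eta> + 1 / y\<^sup>2 * (LINT r:{s..t}|F.time_marginal. norm (f r t z - f' r t z))" .
  qed (use t in auto)
  then show ?thesis using s by blast
qed

section \<open>Convergence of flows on a compact time interval\<close>

lemma compact_subset_upper_half_plane:
  assumes "compact Z" "Z \<subseteq> upper_half_plane"
  obtains y where "0 < y" "\<And>z. z \<in> Z \<Longrightarrow> y \<le> Im z"
proof (cases "Z = {}")
  case True
  then show ?thesis by (intro that[of 1]) auto
next
  case False
  obtain z0 where z0: "z0 \<in> Z" "\<forall>z\<in>Z. Im z0 \<le> Im z"
    using continuous_attains_inf[OF assms(1) False continuous_on_Im[OF continuous_on_id]] by auto
  then show ?thesis
    using assms(2) by (intro that[of "Im z0"]) (auto simp: upper_half_plane_def)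
qed

lemma compact_ordered_pairs: "compact (ordered_pairs {0..T})"
proof -
  have "ordered_pairs {0..T} = ({0..T} \<times> {0..T}) \<inter> {p. fst p \<le> snd p}"
    by (auto simp: ordered_pairs_def)
  moreover have "closed {p :: real \<times> real. fst p \<le> snd p}"
    by (intro closed_Collect_le continuous_intros)
  ultimately show ?thesis
    by (simp add: compact_Int_closed compact_Times)
qed

lemma compact_fst_image: "compact D \<Longrightarrow> compact (fst ` D)"
  by (rule compact_continuous_image[OF continuous_on_fst[OF continuous_on_id]])

lemma norm_diff_triangle_3:
  fixes a b c d :: complex
  shows "norm (a - d) \<le> norm (a - b) + norm (b - c) + norm (d - c)"
  using norm_triangle_ineq4[of "(a - b) + (b - c)" "d - c"] norm_triangle_ineq[of "a - b" "b - c"] by simp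

text \<open>A fine grid has to serve all \<open>z\<close> in a compact set and all final times \<open>t\<close>, so that the
  modulus of continuity in \<open>r\<close> must not depend on them.\<close>

lemma (in loewner_flow) flow_equicontinuous_in_time:
  assumes Z: "compact Z" "Z \<subseteq> upper_half_plane" and "0 < \<omega>"
  obtains d where "0 < d" "\<And>z r r' t. z \<in> Z \<Longrightarrow> r \<in> {0..t} \<Longrightarrow> r' \<in> {0..t} \<Longrightarrow> t \<le> T \<Longrightarrow> \<bar>r - r'\<bar> \<le> d \<Longrightarrow>
    norm (f r t z - f r' t z) \<le> \<omega>"
proof -
  define E where "E = Z \<times> ordered_pairs {0..T}"
  have E: "compact E" "E \<subseteq> upper_half_plane \<times> ordered_pairs {0..T}"
    using Z compact_ordered_pairs by (auto simp: E_def intro: compact_Times)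
  have "uniformly_continuous_on E (\<lambda>(z, s, t). f s t z)"
    using continuous_on_subset[OF f_continuous E(2)] E(1) by (rule compact_uniformly_continuous)
  then obtain \<delta> where \<delta>: "0 < \<delta>" "\<And>p q. p \<in> E \<Longrightarrow> q \<in> E \<Longrightarrow> dist q p < \<delta> \<Longrightarrow>
      dist ((\<lambda>(z, s, t). f s t z) q) ((\<lambda>(z, s, t). f s t z) p) < \<omega>"
    using \<open>0 < \<omega>\<close> unfolding uniformly_continuous_on_def by blast
  show ?thesis
  proof (rule that[of "\<delta> / 2"])
    fix z r r' t assume "z \<in> Z" "r \<in> {0..t}" "r' \<in> {0..t}" "t \<le> T" and r: "\<bar>r - r'\<bar> \<le> \<delta> / 2"
    then have "(z, r, t) \<in> E" "(z, r', t) \<in> E" by (auto simp: E_def ordered_pairs_def)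
    moreover have "dist (z, r, t) (z, r', t) < \<delta>"
      using r \<delta>(1) by (simp add: dist_Pair_Pair dist_real_def)
    ultimately show "norm (f r t z - f r' t z) \<le> \<omega>"
      using \<delta>(2)[of "(z, r', t)" "(z, r, t)"] by (simp add: dist_norm)
  qed (use \<delta>(1) in simp)
qed

text \<open>One bound \<open>C\<close> for the masses of all generators; this is what the hypothesis on the variances
  provides on \<open>[0, T]\<close>.\<close>

locale flow_sequence =
  fixes Ls :: "nat \<Rightarrow> (real \<times> real) measure" and T :: real and mn fn L m f and C :: real
  assumes F: "\<And>n. loewner_flow (Ls n) T (mn n) (fn n)" and G: "loewner_flow L T m f"
    and mass: "\<And>n. measure (Ls n) UNIV \<le> C" "measure L UNIV \<le> C"
begin

sublocale G: loewner_flow L T m f by (rule G)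

abbreviation "drift_limit \<equiv> uniform_limit {0..T} mn m sequentially"

abbreviation "marginal_limit \<equiv> locally_uniform_limit (upper_half_plane \<times> {0..T})
  (\<lambda>n (w, t). marginal_transform (Ls n) t w) (\<lambda>(w, t). marginal_transform L t w)"

abbreviation "chain_limit \<equiv> locally_uniform_limit (upper_half_plane \<times> {0..T})
  (\<lambda>n (z, t). fn n 0 t z) (\<lambda>(z, t). f 0 t z)"

abbreviation "evolution_limit \<equiv> locally_uniform_limit (upper_half_plane \<times> ordered_pairs {0..T})
  (\<lambda>n (z, s, t). fn n s t z) (\<lambda>(z, s, t). f s t z)"

lemma C_nonneg: "0 \<le> C"
  using mass(2) measure_nonneg order_trans by blast

text \<open>By the stability estimate, the two generators have to be compared along the limit flow. Its
  continuity on a compact set provides a grid on which freezing costs little for all generators at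
  once, and on this grid only finitely many marginal transforms at points of a compact set \<open>W\<close> are
  involved.\<close>

lemma evolution_limit_of_generator_limit:
  assumes m: drift_limit and J: marginal_limit
  shows evolution_limit
  unfolding locally_uniform_limit_def uniform_limit_iff
proof (intro allI impI)
  fix D :: "(complex \<times> real \<times> real) set" and e :: real
  assume D: "compact D" "D \<subseteq> upper_half_plane \<times> ordered_pairs {0..T}" and e: "0 < e"
  define Z where "Z = fst ` D"
  have Z: "compact Z" "Z \<subseteq> upper_half_plane"
    using D compact_fst_image by (auto simp: Z_def)
  obtain y where y: "0 < y" "\<And>z. z \<in> Z \<Longrightarrow> y \<le> Im z"
    using compact_subset_upper_half_plane[OF Z] by blast
  obtain N0 where "2 * (C / y\<^sup>2) \<le> real N0"
    using real_arch_simple by blast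
  then have N0: "C / y\<^sup>2 \<le> real N0 / 2" by linarith
  \<comment> \<open>\<open>\<eta>\<close> is what the stability estimate may receive; it is split into sixths: two for the drifts, one
    for each grid approximation, and two for the marginal transforms\<close>
  define \<eta> where "\<eta> = e / (2 * fact (Suc N0))"
  have \<eta>: "0 < \<eta>" "fact (Suc N0) * \<eta> = e / 2"
    using e by (auto simp: \<eta>_def simp del: fact_Suc)
  \<comment> \<open>\<open>C + 1\<close> instead of \<open>C\<close> because \<open>C\<close> may be zero\<close>
  define \<omega> where "\<omega> = \<eta> * y\<^sup>2 / (6 * (C + 1))"
  have \<omega>: "0 < \<omega>" "\<omega> / y\<^sup>2 * C \<le> \<eta> / 6"
    using \<eta>(1) y(1) C_nonneg by (auto simp: \<omega>_def field_simps add_pos_nonneg)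
  obtain d where d: "0 < d" and osc: "\<And>z r r' t. z \<in> Z \<Longrightarrow> r \<in> {0..t} \<Longrightarrow> r' \<in> {0..t} \<Longrightarrow> t \<le> T \<Longrightarrow>
      \<bar>r - r'\<bar> \<le> d \<Longrightarrow> norm (f r t z - f r' t z) \<le> \<omega>"
    using G.flow_equicontinuous_in_time[OF Z \<omega>(1)] by blast
  obtain N where "T / d \<le> real N" using real_arch_simple by blast
  then have N: "T \<le> real N * d" using d by (simp add: field_simps)
  define \<epsilon> where "\<epsilon> = \<eta> / (6 * (real N + 1))"
  have \<epsilon>: "0 < \<epsilon>" "real N * (2 * \<epsilon>) \<le> \<eta> / 3"
    using \<eta>(1) by (auto simp: \<epsilon>_def field_simps)
  define W where "W = (\<lambda>(z, s, t). f s t z) ` (Z \<times> ordered_pairs {0..T})"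
  have W: "compact W" "W \<subseteq> upper_half_plane"
  proof -
    have sub: "Z \<times> ordered_pairs {0..T} \<subseteq> upper_half_plane \<times> ordered_pairs {0..T}" using Z(2) by blast
    show "compact W"
      unfolding W_def using continuous_on_subset[OF G.f_continuous sub] compact_Times[OF Z(1) compact_ordered_pairs]
      by (rule compact_continuous_image)
    show "W \<subseteq> upper_half_plane"
    proof
      fix w assume "w \<in> W"
      then obtain z s t where "w = f s t z" "z \<in> Z" "(s, t) \<in> ordered_pairs {0..T}"
        by (auto simp: W_def)
      then show "w \<in> upper_half_plane"
        using G.Im_flow_ge[OF y(1) y(2), of z s t] y(1) by (auto simp: ordered_pairs_def upper_half_plane_def)
    qed
  qed
  have "\<forall>\<^sub>F n in sequentially. \<forall>t\<in>{0..T}. dist (mn n t) (m t) < \<eta> / 6"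
    by (rule uniform_limitD[OF m]) (use \<eta>(1) in simp)
  moreover have "\<forall>\<^sub>F n in sequentially. \<forall>x\<in>W \<times> {0..T}.
      dist ((\<lambda>(w, t). marginal_transform (Ls n) t w) x) ((\<lambda>(w, t). marginal_transform L t w) x) < \<epsilon>"
    using W \<epsilon>(1) by (intro locally_uniform_limitD[OF J]) (auto intro: compact_Times)
  ultimately show "\<forall>\<^sub>F n in sequentially. \<forall>x\<in>D. dist (case x of (z, s, t) \<Rightarrow> fn n s t z) (case x of (z, s, t) \<Rightarrow> f s t z) < e"
  proof eventually_elim
    case (elim n)
    interpret F: loewner_flow "Ls n" T "mn n" "fn n" by (rule F)
    define \<Delta> where "\<Delta> r w = marginal_transform (Ls n) r w - marginal_transform L r w" for r w
    have \<Delta>: "norm (\<Delta> r w) \<le> \<epsilon>" if "w \<in> W" "r \<in> {0..T}" for r w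
      using elim(2) that by (fastforce simp: \<Delta>_def dist_norm intro: less_imp_le)
    show ?case
    proof
      fix x assume "x \<in> D"
      then obtain z s t where x: "x = (z, s, t)" "z \<in> Z" "0 \<le> s" "s \<le> t" "t \<le> T"
        using D(2) by (cases x) (force simp: Z_def ordered_pairs_def)
      have z: "y \<le> Im z" "0 < Im z" using y x(2) by force+
      have "norm (fn n s t z - f s t z) \<le> fact (Suc N0) * \<eta>"
      proof (rule flow_stability[OF F G y(1) z(1) _ mass(1) N0])
        fix s assume s: "s \<in> {0..t}"
        define a where "a = time_grid s t d"
        define v where "v r = f r t z" for r
        have a: "a j \<in> {s..t}" for j
          using s x d N by (auto simp: a_def time_grid_def)
        have v: "continuous_on {s..t} v" "\<And>r. r \<in> {s..t} \<Longrightarrow> y \<le> Im (v r)"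
          unfolding v_def using s x z G.Im_flow_ge[OF y(1) z(1)] by (auto intro!: G.flow_continuous_in_time)
        have osc_v: "norm (v r - v r') \<le> \<omega>" if "r \<in> {s..t}" "r' \<in> {s..t}" "\<bar>r - r'\<bar> \<le> d" for r r'
          unfolding v_def using osc[OF x(2) _ _ x(5) that(3)] that s by auto
        define S where "S M = (\<Sum>j<N. marginal_transform M (a (Suc j)) (v (a j)) - marginal_transform M (a j) (v (a j)))" for M
        define I where "I M = (LINT p:slice s t|M. 1 / (complex_of_real (fst p) - v (snd p)))" for M :: "(real \<times> real) measure"
        have "norm (I (Ls n) - S (Ls n)) \<le> \<omega> / y\<^sup>2 * C" "norm (I L - S L) \<le> \<omega> / y\<^sup>2 * C"
          unfolding I_def S_def a_def using s x N d mass
          by (intro F.kernel_integral_grid_approx G.kernel_integral_grid_approx v y(1) osc_v; auto)+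
        then have approx: "norm (I (Ls n) - S (Ls n)) \<le> \<eta> / 6" "norm (I L - S L) \<le> \<eta> / 6"
          using \<omega>(2) by linarith+
        have "S (Ls n) - S L = (\<Sum>j<N. \<Delta> (a (Suc j)) (v (a j)) - \<Delta> (a j) (v (a j)))"
          unfolding S_def sum_subtractf[symmetric] by (simp add: \<Delta>_def algebra_simps)
        also have "norm \<dots> \<le> (\<Sum>j<N. 2 * \<epsilon>)"
        proof (rule sum_norm_le)
          fix j
          have "v (a j) \<in> W"
            using a[of j] s x by (force simp: W_def v_def ordered_pairs_def)
          moreover have "a j \<in> {0..T}" "a (Suc j) \<in> {0..T}"
            using a[of j] a[of "Suc j"] s x by auto
          ultimately show "norm (\<Delta> (a (Suc j)) (v (a j)) - \<Delta> (a j) (v (a j))) \<le> 2 * \<epsilon>"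
            using norm_triangle_le_diff[OF add_mono[OF \<Delta> \<Delta>]] by simp
        qed
        finally have "norm (S (Ls n) - S L) \<le> \<eta> / 3" using \<epsilon>(2) by simp
        moreover have "\<bar>mn n t - m t\<bar> \<le> \<eta> / 6" "\<bar>mn n s - m s\<bar> \<le> \<eta> / 6"
          using elim(1) s x by (auto simp: dist_real_def intro: less_imp_le)
        ultimately show "\<bar>mn n t - m t\<bar> + \<bar>mn n s - m s\<bar> +
            norm ((LINT p:slice s t|Ls n. 1 / (of_real (fst p) - f (snd p) t z)) -
              (LINT p:slice s t|L. 1 / (of_real (fst p) - f (snd p) t z))) \<le> \<eta>"
          using approx norm_diff_triangle_3[of "I (Ls n)" "I L" "S (Ls n)" "S L"]
          unfolding I_def v_def by linarith
      qed (use x in auto)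
      then show "dist (case x of (z, s, t) \<Rightarrow> fn n s t z) (case x of (z, s, t) \<Rightarrow> f s t z) < e"
        using \<eta>(2) e by (simp add: x(1) dist_norm)
    qed
  qed
qed

text \<open>The grid approximation is used for the limit and for every large \<open>n\<close> with the same grid:
  uniform closeness of the flows transfers the smallness of the steps from the limit flow.\<close>

lemma marginal_limit_of_evolution_limit:
  assumes m: drift_limit and lim: evolution_limit
  shows marginal_limit
  unfolding locally_uniform_limit_def uniform_limit_iff
proof (intro allI impI)
  fix D :: "(complex \<times> real) set" and e :: real
  assume D: "compact D" "D \<subseteq> upper_half_plane \<times> {0..T}" and e: "0 < e"
  define Z where "Z = fst ` D"
  have Z: "compact Z" "Z \<subseteq> upper_half_plane"
    using D compact_fst_image by (auto simp: Z_def)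
  obtain y where y: "0 < y" "\<And>z. z \<in> Z \<Longrightarrow> y \<le> Im z"
    using compact_subset_upper_half_plane[OF Z] by blast
  define \<omega> where "\<omega> = e * y\<^sup>2 / (6 * (C + 1))"
  have \<omega>: "0 < \<omega>" "\<omega> / y\<^sup>2 * C \<le> e / 6"
    using e y(1) C_nonneg by (auto simp: \<omega>_def field_simps add_pos_nonneg)
  \<comment> \<open>half of \<open>\<omega>\<close> for the steps of the limit flow, the other half for the distance of the flows\<close>
  obtain d where d: "0 < d" and osc: "\<And>z r r' t. z \<in> Z \<Longrightarrow> r \<in> {0..t} \<Longrightarrow> r' \<in> {0..t} \<Longrightarrow> t \<le> T \<Longrightarrow>
      \<bar>r - r'\<bar> \<le> d \<Longrightarrow> norm (f r t z - f r' t z) \<le> \<omega> / 2"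
    using G.flow_equicontinuous_in_time[OF Z half_gt_zero[OF \<omega>(1)]] by blast
  obtain N where "T / d \<le> real N" using real_arch_simple by blast
  then have N: "T \<le> real N * d" using d by (simp add: field_simps)
  define \<epsilon> where "\<epsilon> = min (\<omega> / 2) (e / (6 * (real N + 1)))"
  have \<epsilon>: "0 < \<epsilon>" "\<epsilon> \<le> \<omega> / 2" "real N * \<epsilon> \<le> e / 6"
  proof -
    show "0 < \<epsilon>" using \<omega>(1) e by (simp add: \<epsilon>_def add_nonneg_pos)
    show "\<epsilon> \<le> \<omega> / 2" unfolding \<epsilon>_def by (rule min.cobounded1)
    have "real N * \<epsilon> \<le> real N * (e / (6 * (real N + 1)))"
      by (intro mult_left_mono) (auto simp: \<epsilon>_def)
    also have "\<dots> \<le> e / 6" using e by (simp add: field_simps)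
    finally show "real N * \<epsilon> \<le> e / 6" .
  qed
  have near: "norm (f r u z - z) \<le> \<omega> / 2" if "z \<in> Z" "0 \<le> r" "r \<le> u" "u \<le> T" "u - r \<le> d" for r u z
    using osc[of z r u u] G.flow_same_time[of u z] that less_le_trans[OF y(1) y(2)] by auto
  have "\<forall>\<^sub>F n in sequentially. \<forall>t\<in>{0..T}. dist (mn n t) (m t) < e / 6"
    by (rule uniform_limitD[OF m]) (use e in simp)
  moreover have "\<forall>\<^sub>F n in sequentially. \<forall>x\<in>Z \<times> ordered_pairs {0..T}.
      dist ((\<lambda>(z, s, t). fn n s t z) x) ((\<lambda>(z, s, t). f s t z) x) < \<epsilon>"
    using Z compact_ordered_pairs \<epsilon>(1) by (intro locally_uniform_limitD[OF lim]) (auto intro: compact_Times)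
  ultimately show "\<forall>\<^sub>F n in sequentially. \<forall>x\<in>D. dist (case x of (w, t) \<Rightarrow> marginal_transform (Ls n) t w)
      (case x of (w, t) \<Rightarrow> marginal_transform L t w) < e"
  proof eventually_elim
    case (elim n)
    interpret F: loewner_flow "Ls n" T "mn n" "fn n" by (rule F)
    show ?case
    proof
      fix x assume "x \<in> D"
      then obtain z t where x: "x = (z, t)" "z \<in> Z" "0 \<le> t" "t \<le> T"
        using D(2) by (cases x) (force simp: Z_def)
      have z: "y \<le> Im z" using y(2) x(2) by blast
      have close: "norm (fn n r u z - f r u z) \<le> \<epsilon>" if "0 \<le> r" "r \<le> u" "u \<le> T" for r u
        using elim(2) that x(2) by (fastforce simp: ordered_pairs_def dist_norm intro: less_imp_le)
      have near_f: "norm (f r u z - z) \<le> \<omega>" if "0 \<le> r" "r \<le> u" "u \<le> T" "u - r \<le> d" for r u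
        using near[OF x(2) that] \<omega>(1) by linarith
      have near_fn: "norm (fn n r u z - z) \<le> \<omega>" if "0 \<le> r" "r \<le> u" "u \<le> T" "u - r \<le> d" for r u
        using near[OF x(2) that] close[OF that(1-3)] \<epsilon>(2)
          norm_triangle_ineq[of "fn n r u z - f r u z" "f r u z - z"] by simp
      define a where "a = time_grid 0 t d"
      have t_N: "t \<le> real N * d" using x(4) N by linarith
      have a: "0 \<le> a j" "a j \<le> a (Suc j)" "a (Suc j) \<le> T" for j
        using time_grid_props(3)[OF order_refl x(3) d t_N] time_grid_props(4)[OF order_refl x(3) d t_N] x(4)
        by (auto simp: a_def mono_def intro: order_trans)
      define S where "S m f = complex_of_real (m t) + (\<Sum>j<N. f (a j) (a (Suc j)) z - z)"
        for m :: "real \<Rightarrow> real" and f :: "real \<Rightarrow> real \<Rightarrow> complex \<Rightarrow> complex"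
      have approx: "norm (marginal_transform (Ls n) t z - S (mn n) (fn n)) \<le> e / 6"
        "norm (marginal_transform L t z - S m f) \<le> e / 6"
        using F.marginal_transform_grid_approx[OF y(1) z x(3,4) d t_N near_fn mass(1)]
          G.marginal_transform_grid_approx[OF y(1) z x(3,4) d t_N near_f mass(2)] \<omega>(2)
        unfolding S_def a_def by linarith+
      have "S (mn n) (fn n) - S m f = of_real (mn n t - m t) + (\<Sum>j<N. fn n (a j) (a (Suc j)) z - f (a j) (a (Suc j)) z)"
        by (simp add: S_def sum_subtractf)
      also have "norm \<dots> \<le> e / 6 + real N * \<epsilon>"
      proof (rule norm_triangle_le[OF add_mono])
        show "norm (complex_of_real (mn n t - m t)) \<le> e / 6"
          unfolding norm_of_real using elim(1) x by (auto simp: dist_real_def intro: less_imp_le)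
        have "norm (\<Sum>j<N. fn n (a j) (a (Suc j)) z - f (a j) (a (Suc j)) z) \<le> (\<Sum>j<N. \<epsilon>)"
          using a by (intro sum_norm_le close)
        then show "norm (\<Sum>j<N. fn n (a j) (a (Suc j)) z - f (a j) (a (Suc j)) z) \<le> real N * \<epsilon>"
          by simp
      qed
      finally have "norm (S (mn n) (fn n) - S m f) \<le> e / 3" using \<epsilon>(3) by simp
      then show "dist (case x of (w, t) \<Rightarrow> marginal_transform (Ls n) t w)
          (case x of (w, t) \<Rightarrow> marginal_transform L t w) < e"
        using approx e norm_diff_triangle_3[of "marginal_transform (Ls n) t z" "marginal_transform L t z"
            "S (mn n) (fn n)" "S m f"] by (simp add: x(1) dist_norm)
    qed
  qed
qed

text \<open>The drift is \<open>z - f 0 t z\<close> up to an error of order \<open>1 / Im z\<close> that is uniform in \<open>n\<close> and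
  \<open>t\<close>; a single point \<open>z\<close> high on the imaginary axis suffices for a given precision.\<close>

lemma drift_limit_of_chain_limit:
  assumes lim: chain_limit
  shows drift_limit
  unfolding uniform_limit_iff
proof (intro allI impI)
  fix e :: real assume e: "0 < e"
  define y where "y = 4 * (C + 1) / e"
  have y: "0 < y" "C / y \<le> e / 4"
    using e C_nonneg by (auto simp: y_def field_simps add_pos_nonneg)
  define z where "z = \<i> * complex_of_real y"
  have z: "Im z = y" "z \<in> upper_half_plane"
    using y(1) by (auto simp: z_def upper_half_plane_def)
  have "\<forall>\<^sub>F n in sequentially. \<forall>x\<in>{z} \<times> {0..T}. dist ((\<lambda>(z, t). fn n 0 t z) x) ((\<lambda>(z, t). f 0 t z) x) < e / 4"
    using z e by (intro locally_uniform_limitD[OF lim]) (auto intro: compact_Times)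
  then show "\<forall>\<^sub>F n in sequentially. \<forall>t\<in>{0..T}. dist (mn n t) (m t) < e"
  proof eventually_elim
    case (elim n)
    interpret F: loewner_flow "Ls n" T "mn n" "fn n" by (rule F)
    show ?case
    proof
      fix t assume t: "t \<in> {0..T}"
      have "measure (Ls n) (slice 0 t) \<le> C" "measure L (slice 0 t) \<le> C"
        using F.measure_slice_le[of 0 t] G.measure_slice_le[of 0 t] mass(1)[of n] mass(2) by linarith+
      then have le: "measure (Ls n) (slice 0 t) / y \<le> e / 4" "measure L (slice 0 t) / y \<le> e / 4"
        using y divide_right_mono[of _ C y] by (meson less_imp_le order_trans)+
      define A where "A = fn n 0 t z - (z - of_real (mn n t) + of_real (mn n 0))"
      define B where "B = f 0 t z - (z - of_real (m t) + of_real (m 0))"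
      have "norm A \<le> e / 4"
        unfolding A_def by (rule order_trans[OF F.flow_minus_drift_le[OF y(1)] le(1)]) (use z(1) t in auto)
      moreover have "norm B \<le> e / 4"
        unfolding B_def by (rule order_trans[OF G.flow_minus_drift_le[OF y(1)] le(2)]) (use z(1) t in auto)
      moreover have "norm (fn n 0 t z - f 0 t z) < e / 4"
        using elim t by (auto simp: dist_norm)
      moreover have "complex_of_real (mn n t - m t) = A - B - (fn n 0 t z - f 0 t z)"
        by (simp add: A_def B_def F.m_0 G.m_0)
      then have "\<bar>mn n t - m t\<bar> = norm (A - B - (fn n 0 t z - f 0 t z))"
        by (metis norm_of_real)
      then have "\<bar>mn n t - m t\<bar> \<le> norm A + norm B + norm (fn n 0 t z - f 0 t z)"
        using norm_triangle_ineq4[of "A - B" "fn n 0 t z - f 0 t z"] norm_triangle_ineq4[of A B] by linarith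
      ultimately show "dist (mn n t) (m t) < e"
        by (simp add: dist_real_def)
    qed
  qed
qed

text \<open>Along convergent parameters, the values of \<open>fn n\<close> are bounded because the drifts converge. A
  limit point \<open>l'\<close> satisfies \<open>f 0 s l' = f 0 t z = f 0 s (f s t z)\<close>, and \<open>f 0 s\<close> is injective.\<close>

lemma evolution_limit_of_chain_limit:
  assumes m: drift_limit and lim: chain_limit
  shows evolution_limit
proof -
  have cont0: "continuous_on (upper_half_plane \<times> {0..T}) (\<lambda>(z, t). f 0 t z)"
  proof -
    have "continuous_on (upper_half_plane \<times> {0..T}) (\<lambda>x. (\<lambda>(z, s, t). f s t z) (fst x, 0, snd x))"
      by (rule continuous_on_compose2[OF G.f_continuous])
        (auto simp: ordered_pairs_def intro!: continuous_intros)
    then show ?thesis by (simp add: case_prod_unfold)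
  qed
  note chain = lim[unfolded locally_uniform_limit_iff_sequences[OF cont0], rule_format]
  show ?thesis
    unfolding locally_uniform_limit_iff_sequences[OF G.f_continuous]
  proof (intro allI impI)
    fix \<phi> :: "nat \<Rightarrow> nat" and \<tau> :: "nat \<Rightarrow> complex \<times> real \<times> real" and l
    assume \<phi>: "strict_mono \<phi>" and \<tau>: "\<forall>k. \<tau> k \<in> upper_half_plane \<times> ordered_pairs {0..T}"
      and l: "l \<in> upper_half_plane \<times> ordered_pairs {0..T}" and conv: "\<tau> \<longlonglongrightarrow> l"
    obtain z s t where zst: "l = (z, s, t)" by (cases l) auto
    have z: "0 < Im z" "0 \<le> s" "s \<le> t" "t \<le> T"
      using l by (auto simp: zst upper_half_plane_def ordered_pairs_def)
    define \<zeta> where "\<zeta> k = fst (\<tau> k)" for k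
    define \<sigma> where "\<sigma> k = fst (snd (\<tau> k))" for k
    define \<theta> where "\<theta> k = snd (snd (\<tau> k))" for k
    have \<tau>_eq: "\<tau> k = (\<zeta> k, \<sigma> k, \<theta> k)" for k by (simp add: \<zeta>_def \<sigma>_def \<theta>_def)
    have mem: "0 < Im (\<zeta> k)" "0 \<le> \<sigma> k" "\<sigma> k \<le> \<theta> k" "\<theta> k \<le> T" for k
      using \<tau>[rule_format, of k] by (auto simp: \<tau>_eq upper_half_plane_def ordered_pairs_def)
    have lims: "\<zeta> \<longlonglongrightarrow> z" "\<sigma> \<longlonglongrightarrow> s" "\<theta> \<longlonglongrightarrow> t"
      using tendsto_fst[OF conv] tendsto_fst[OF tendsto_snd[OF conv]] tendsto_snd[OF tendsto_snd[OF conv]]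
      by (simp_all add: \<zeta>_def[abs_def] \<sigma>_def[abs_def] \<theta>_def[abs_def] zst)
    define w where "w k = fn (\<phi> k) (\<sigma> k) (\<theta> k) (\<zeta> k)" for k
    have Im_w: "Im (\<zeta> k) \<le> Im (w k)" for k
      unfolding w_def using loewner_flow.Im_f[OF F] mem by auto
    have "w \<longlonglongrightarrow> f s t z"
    proof (rule bounded_unique_limit_point)
      have "locally_uniform_limit {0..T} mn m"
        unfolding locally_uniform_limit_def by (intro allI impI uniform_limit_on_subset[OF m])
      note drift = this[unfolded locally_uniform_limit_iff_sequences[OF G.m_continuous], rule_format, OF \<phi>]
      have drift_lims: "(\<lambda>k. mn (\<phi> k) (\<sigma> k)) \<longlonglongrightarrow> m s" "(\<lambda>k. mn (\<phi> k) (\<theta> k)) \<longlonglongrightarrow> m t"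
      proof -
        show "(\<lambda>k. mn (\<phi> k) (\<sigma> k)) \<longlonglongrightarrow> m s"
        proof (rule drift[OF _ _ lims(2)])
          show "\<sigma> k \<in> {0..T}" for k using mem[of k] by auto
        qed (use z in auto)
        show "(\<lambda>k. mn (\<phi> k) (\<theta> k)) \<longlonglongrightarrow> m t"
        proof (rule drift[OF _ _ lims(3)])
          show "\<theta> k \<in> {0..T}" for k using mem[of k] by auto
        qed (use z in auto)
      qed
      define b where "b k = \<zeta> k - of_real (mn (\<phi> k) (\<theta> k)) + of_real (mn (\<phi> k) (\<sigma> k))" for k
      have "b \<longlonglongrightarrow> z - of_real (m t) + of_real (m s)"
        unfolding b_def by (intro tendsto_intros lims drift_lims)
      then have "bounded (range b)" by (rule convergent_imp_bounded)
      then obtain B where B: "\<And>k. norm (b k) \<le> B"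
        unfolding bounded_iff by auto
      have "(\<lambda>k. C / Im (\<zeta> k)) \<longlonglongrightarrow> C / Im z"
        using z by (intro tendsto_intros lims) auto
      then have "bounded (range (\<lambda>k. C / Im (\<zeta> k)))" by (rule convergent_imp_bounded)
      then obtain B' where B': "\<And>k. norm (C / Im (\<zeta> k)) \<le> B'"
        unfolding bounded_iff by auto
      have "norm (w k) \<le> B + B'" for k
      proof -
        have "norm (w k - b k) \<le> measure (Ls (\<phi> k)) (slice (\<sigma> k) (\<theta> k)) / Im (\<zeta> k)"
          unfolding w_def b_def using mem by (intro loewner_flow.flow_minus_drift_le[OF F]) auto
        also have "\<dots> \<le> C / Im (\<zeta> k)"
        proof (rule divide_right_mono)
          interpret Fk: loewner_flow "Ls (\<phi> k)" T "mn (\<phi> k)" "fn (\<phi> k)" by (rule F)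
          show "measure (Ls (\<phi> k)) (slice (\<sigma> k) (\<theta> k)) \<le> C"
            by (rule order_trans[OF Fk.measure_slice_le mass(1)])
        qed (use mem[of k] in simp)
        also have "\<dots> \<le> B'" using B'[of k] unfolding real_norm_def by linarith
        finally show ?thesis
          using B[of k] norm_triangle_ineq[of "w k - b k" "b k"] by simp
      qed
      then show "bounded (range w)" unfolding bounded_iff by auto
    next
      fix r :: "nat \<Rightarrow> nat" and l'
      assume r: "strict_mono r" and l': "(w \<circ> r) \<longlonglongrightarrow> l'"
      have r_lims: "(\<lambda>k. \<zeta> (r k)) \<longlonglongrightarrow> z" "(\<lambda>k. \<sigma> (r k)) \<longlonglongrightarrow> s" "(\<lambda>k. \<theta> (r k)) \<longlonglongrightarrow> t"
        using lims[THEN LIMSEQ_subseq_LIMSEQ[OF _ r]] by (simp_all add: comp_def)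
      have Im_l': "Im z \<le> Im l'"
        using tendsto_Im[OF r_lims(1)] tendsto_Im[OF l'] Im_w by (intro LIMSEQ_le[of "\<lambda>k. Im (\<zeta> (r k))" _ "\<lambda>k. Im ((w \<circ> r) k)"]) auto
      have \<phi>r: "strict_mono (\<phi> \<circ> r)" using \<phi> r by (rule strict_mono_o)
      have lim1: "(\<lambda>k. case (w (r k), \<sigma> (r k)) of (z, t) \<Rightarrow> fn ((\<phi> \<circ> r) k) 0 t z) \<longlonglongrightarrow> (case (l', s) of (z, t) \<Rightarrow> f 0 t z)"
      proof (rule chain[OF \<phi>r, of "\<lambda>k. (w (r k), \<sigma> (r k))" "(l', s)"])
        show "(w (r k), \<sigma> (r k)) \<in> upper_half_plane \<times> {0..T}" for k
          using mem[of "r k"] Im_w[of "r k"] by (auto simp: upper_half_plane_def)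
        show "(l', s) \<in> upper_half_plane \<times> {0..T}"
          using Im_l' z by (auto simp: upper_half_plane_def)
        show "(\<lambda>k. (w (r k), \<sigma> (r k))) \<longlonglongrightarrow> (l', s)"
          using l' by (intro tendsto_Pair r_lims) (simp add: comp_def)
      qed
      have lim2: "(\<lambda>k. case (\<zeta> (r k), \<theta> (r k)) of (z, t) \<Rightarrow> fn ((\<phi> \<circ> r) k) 0 t z) \<longlonglongrightarrow> (case (z, t) of (z, t) \<Rightarrow> f 0 t z)"
      proof (rule chain[OF \<phi>r, of "\<lambda>k. (\<zeta> (r k), \<theta> (r k))" "(z, t)"])
        show "(\<zeta> (r k), \<theta> (r k)) \<in> upper_half_plane \<times> {0..T}" for k
          using mem[of "r k"] by (auto simp: upper_half_plane_def)
        show "(z, t) \<in> upper_half_plane \<times> {0..T}"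
          using z by (auto simp: upper_half_plane_def)
        show "(\<lambda>k. (\<zeta> (r k), \<theta> (r k))) \<longlonglongrightarrow> (z, t)"
          by (intro tendsto_Pair r_lims)
      qed
      have same: "fn (\<phi> (r k)) 0 (\<sigma> (r k)) (w (r k)) = fn (\<phi> (r k)) 0 (\<theta> (r k)) (\<zeta> (r k))" for k
        unfolding w_def by (rule loewner_flow.f_comp[OF F, symmetric]) (use mem[of "r k"] in auto)
      have "f 0 s l' = f 0 t z"
        using LIMSEQ_unique[OF lim1[unfolded comp_def prod.case same] lim2[unfolded comp_def prod.case]] .
      also have "\<dots> = f 0 s (f s t z)"
        by (rule G.f_comp) (use z in auto)
      finally show "l' = f s t z"
        by (rule G.flow_injective[of s, rotated 4]) (use z Im_l' G.Im_f[of s t z] in auto)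
    qed
    then show "(\<lambda>k. case \<tau> k of (z, s, t) \<Rightarrow> fn (\<phi> k) s t z) \<longlonglongrightarrow> (case l of (z, s, t) \<Rightarrow> f s t z)"
      by (simp add: \<tau>_eq zst w_def[abs_def])
  qed
qed

end

section \<open>Restricting a reduced generator to a compact time interval\<close>

lemma sets_restrict_UNIV: "sets (restrict_space M (UNIV \<times> UNIV)) = sets M"
  by (auto simp: sets_restrict_space)

context atomless_in_time
begin

lemma sets_L_restrict: "sets L = sets (restrict_space borel (UNIV \<times> UNIV))"
  by (simp only: sets_L sets_restrict_UNIV)

lemma kappa_measurable: "fst \<in> measurable (restrict_space L (slice 0 t)) (borel :: real measure)"
proof -
  have "fst \<in> measurable L (borel :: real measure)"
    unfolding measurable_cong_sets[OF sets_L refl] borel_prod[symmetric] by measurable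
  then show ?thesis by (rule measurable_restrict_space1)
qed

lemma finite_borel_kappa: "finite_borel_measure (kappa L t)"
proof (intro finite_borel_measure.intro)
  have "emeasure (kappa L t) UNIV = emeasure L (slice 0 t)"
    using emeasure_kappa[OF sets_L_restrict, of t UNIV] by simp
  then show "finite_measure (kappa L t)"
    by (intro finite_measureI) (simp add: kappa_def)
qed (simp add: finite_borel_measure_axioms_def kappa_def)

lemma measure_kappa_le: "measure (kappa L t) UNIV \<le> measure L UNIV"
  using emeasure_kappa[OF sets_L_restrict, of t UNIV] measure_slice_le[of 0 t]
  by (simp add: measure_def)

lemma integral_kappa:
  fixes \<phi> :: "real \<Rightarrow> 'b::{banach,second_countable_topology}"
  assumes "\<phi> \<in> borel_measurable borel"
  shows "(LINT x|kappa L t. \<phi> x) = (LINT p:slice 0 t|L. \<phi> (fst p))"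
proof -
  have "(LINT x|kappa L t. \<phi> x) = (LINT p|restrict_space L (slice 0 t). \<phi> (fst p))"
    unfolding kappa_def by (rule integral_distr[OF kappa_measurable assms])
  also have "\<dots> = (LINT p:slice 0 t|L. \<phi> (fst p))"
    unfolding set_lebesgue_integral_def using sets_slice by (intro integral_restrict_space) (simp add: space_L)
  finally show ?thesis .
qed

lemma Cauchy_transform_kappa:
  assumes "0 < Im z"
  shows "Cauchy_transform (kappa L t) z = - marginal_transform L t z"
proof -
  have "Cauchy_transform (kappa L t) z = (LINT p:slice 0 t|L. 1 / (z - of_real (fst p)))"
    unfolding Cauchy_transform_def using assms by (intro integral_kappa kernel_measurable)
  also have "\<dots> = - marginal_transform L t z"
    unfolding marginal_transform_def reverse_kernel_eq set_lebesgue_integral_def by simp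
  finally show ?thesis .
qed

text \<open>The increments in \<open>t\<close> are controlled by the distribution function of the time marginal,
  which is continuous because single times carry no mass.\<close>

lemma continuous_on_integral_kappa:
  fixes \<phi> :: "real \<Rightarrow> real"
  assumes \<phi>: "continuous_on UNIV \<phi>" "\<And>x. \<bar>\<phi> x\<bar> \<le> B"
  shows "continuous_on {0..T} (\<lambda>t. LINT x|kappa L t. \<phi> x)"
proof -
  interpret \<nu>: finite_borel_measure time_marginal by (rule finite_borel_time_marginal)
  define g where "g = cdf time_marginal"
  have atom: "measure time_marginal {t} = 0" if "t \<in> {0..T}" for t
    using that atomless by (simp add: measure_time_marginal)
  have g: "continuous_on {0..T} g"
    unfolding g_def using atom \<nu>.isCont_cdf by (intro continuous_at_imp_continuous_on) auto
  have increment: "\<bar>(LINT x|kappa L t. \<phi> x) - (LINT x|kappa L s. \<phi> x)\<bar> \<le> B * \<bar>g t - g s\<bar>"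
    if "0 \<le> s" "s \<le> t" "t \<le> T" for s t
  proof -
    have cont: "continuous_on A (\<lambda>p :: real \<times> real. \<phi> (fst p))" for A
      by (rule continuous_on_compose2[OF \<phi>(1)]) (auto intro!: continuous_intros)
    have meas: "\<phi> \<in> borel_measurable borel" using \<phi>(1) by (rule borel_measurable_continuous_onI)
    have "(LINT x|kappa L t. \<phi> x) - (LINT x|kappa L s. \<phi> x) = (LINT p:slice s t|L. \<phi> (fst p))"
      using slice_integral_split[of 0 s t "\<lambda>p. \<phi> (fst p)" B] that cont \<phi>(2)
      by (simp add: integral_kappa[OF meas])
    also have "norm \<dots> \<le> B * measure L (slice s t)"
      using \<phi>(2) by (intro slice_integral_norm_le cont) auto
    also have "measure L (slice s t) = g t - g s"
      using \<nu>.measure_Icc_atomless[OF atom that(2)] that by (simp add: measure_time_marginal g_def)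
    finally show ?thesis
      using \<nu>.cdf_nondecreasing[OF that(2)] by (simp add: g_def)
  qed
  have B: "0 \<le> B" using \<phi>(2)[of 0] by linarith
  show ?thesis
    unfolding continuous_on_def
  proof
    fix t assume t: "t \<in> {0..T}"
    have "((\<lambda>s. B * \<bar>g s - g t\<bar>) \<longlongrightarrow> B * \<bar>g t - g t\<bar>) (at t within {0..T})"
      using g t by (intro tendsto_intros) (simp add: continuous_on_def)
    then have lim: "((\<lambda>s. B * \<bar>g s - g t\<bar>) \<longlongrightarrow> 0) (at t within {0..T})" by simp
    have le: "\<bar>(LINT x|kappa L s. \<phi> x) - (LINT x|kappa L t. \<phi> x)\<bar> \<le> B * \<bar>g s - g t\<bar>" if "s \<in> {0..T}" for s
      using increment[of s t] increment[of t s] t that by (cases "s \<le> t") (auto simp: abs_minus_commute)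
    have "((\<lambda>s. (LINT x|kappa L s. \<phi> x) - (LINT x|kappa L t. \<phi> x)) \<longlongrightarrow> 0) (at t within {0..T})"
      using le by (intro Lim_null_comparison[OF _ lim]) (auto simp: eventually_at_filter)
    then show "((\<lambda>s. LINT x|kappa L s. \<phi> x) \<longlongrightarrow> (LINT x|kappa L t. \<phi> x)) (at t within {0..T})"
      by (rule LIM_zero_cancel)
  qed
qed

end

text \<open>A generator lives on the subspace \<open>\<real> \<times> I\<close> of the plane and may have infinite mass.
  Transporting its restriction to the whole plane gives a finite measure with the Borel sets of
  the plane.\<close>

definition restrict_generator :: "(real \<times> real) measure \<Rightarrow> real \<Rightarrow> (real \<times> real) measure" where
  "restrict_generator K T = distr (restrict_space K (slice 0 T)) borel (\<lambda>p. p)"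

lemma time_interval_Icc:
  assumes "time_interval I" "T \<in> I"
  shows "0 \<le> T" "{0..T} \<subseteq> I"
  using assms unfolding time_interval_def by auto

locale generator_on =
  fixes I :: "real set" and K :: "(real \<times> real) measure" and T :: real
  assumes sets_K: "sets K = sets (restrict_space borel (UNIV \<times> I))"
    and T: "0 \<le> T" "{0..T} \<subseteq> I"
    and K_finite: "emeasure K (slice 0 T) < \<infinity>"
begin

lemma space_K: "space K = UNIV \<times> I"
  using sets_eq_imp_space_eq[OF sets_K] by (simp add: space_restrict_space)

lemma sets_K_slice: "t \<le> T \<Longrightarrow> 0 \<le> s \<Longrightarrow> slice s t \<in> sets K"
proof -
  assume "t \<le> T" "0 \<le> s"
  then have "slice s t = (UNIV \<times> I) \<inter> slice s t" using T by force
  then show ?thesis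
    unfolding sets_K sets_restrict_space using borel_closed[OF closed_slice] by (metis image_eqI)
qed

lemma restrict_measurable: "(\<lambda>p. p) \<in> measurable (restrict_space K (slice 0 T)) borel"
proof -
  have "(\<lambda>p. p) \<in> measurable (restrict_space borel (UNIV \<times> I)) (borel :: (real \<times> real) measure)"
    by (rule measurable_restrict_space1) simp
  then have "(\<lambda>p. p) \<in> measurable K (borel :: (real \<times> real) measure)"
    by (simp add: measurable_cong_sets[OF sets_K refl])
  then show ?thesis by (rule measurable_restrict_space1)
qed

lemma emeasure_restrict_generator:
  assumes "A \<in> sets borel"
  shows "emeasure (restrict_generator K T) A = emeasure K (A \<inter> slice 0 T)"
proof -
  have "emeasure (restrict_generator K T) A
      = emeasure (restrict_space K (slice 0 T)) (A \<inter> space (restrict_space K (slice 0 T)))"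
    unfolding restrict_generator_def using emeasure_distr[OF restrict_measurable assms] by simp
  also have "A \<inter> space (restrict_space K (slice 0 T)) = A \<inter> slice 0 T"
    using T by (auto simp: space_restrict_space space_K)
  also have "emeasure (restrict_space K (slice 0 T)) (A \<inter> slice 0 T) = emeasure K (A \<inter> slice 0 T)"
    using sets_K_slice[of T 0] T by (intro emeasure_restrict_space) (auto simp: sets.Int_space_eq2)
  finally show ?thesis .
qed

lemma integral_restrict_generator:
  fixes h :: "real \<times> real \<Rightarrow> complex"
  assumes "0 \<le> s" "t \<le> T" "continuous_on (slice s t) h"
  shows "(LINT p:slice s t|restrict_generator K T. h p) = (LINT p:slice s t|K. h p)"
proof -
  have "(LINT p:slice s t|restrict_generator K T. h p)
      = (LINT p|restrict_space K (slice 0 T). indicator (slice s t) p *\<^sub>R h p)"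
    unfolding set_lebesgue_integral_def restrict_generator_def
    using borel_measurable_continuous_on_indicator[OF borel_closed[OF closed_slice] assms(3)]
    by (rule integral_distr[OF restrict_measurable])
  also have "\<dots> = (LINT p|K. indicator (slice 0 T) p *\<^sub>R (indicator (slice s t) p *\<^sub>R h p))"
    using sets_K_slice[of T 0] T by (intro integral_restrict_space) (auto simp: sets.Int_space_eq2)
  also have "\<dots> = (LINT p:slice s t|K. h p)"
    unfolding set_lebesgue_integral_def
    using assms by (intro Bochner_Integration.integral_cong) (auto simp: indicator_def)
  finally show ?thesis .
qed

lemma kappa_restrict_generator:
  assumes "0 \<le> t" "t \<le> T"
  shows "kappa (restrict_generator K T) t = kappa K t"
proof (rule measure_eqI)
  show "sets (kappa (restrict_generator K T) t) = sets (kappa K t)"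
    by (simp add: kappa_def)
  fix B assume "B \<in> sets (kappa (restrict_generator K T) t)"
  then have B: "B \<in> sets borel" by (simp add: kappa_def)
  have sets_L: "sets (restrict_generator K T) = sets (restrict_space borel (UNIV \<times> UNIV))"
    by (simp only: restrict_generator_def sets_distr sets_restrict_UNIV)
  have "emeasure (kappa (restrict_generator K T) t) B = emeasure (restrict_generator K T) (B \<times> {0..t})"
    by (rule emeasure_kappa[OF sets_L subset_UNIV B])
  also have "\<dots> = emeasure K ((B \<times> {0..t}) \<inter> slice 0 T)"
  proof (rule emeasure_restrict_generator)
    show "B \<times> {0..t} \<in> sets borel"
      unfolding borel_prod[symmetric] using B by auto
  qed
  also have "(B \<times> {0..t}) \<inter> slice 0 T = B \<times> {0..t}" using assms by auto
  also have "emeasure K (B \<times> {0..t}) = emeasure (kappa K t) B"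
    by (rule emeasure_kappa[OF sets_K _ B, symmetric]) (use assms T in auto)
  finally show "emeasure (kappa (restrict_generator K T) t) B = emeasure (kappa K t) B" .
qed

end

lemma hemigroup_props:
  assumes M: "monotone_hemigroup I M"
  shows hemigroup_distribution: "(s, t) \<in> ordered_pairs I \<Longrightarrow> real_distribution (M s t)"
    and hemigroup_REF_comp: "s \<in> I \<Longrightarrow> t \<in> I \<Longrightarrow> u \<in> I \<Longrightarrow> s \<le> t \<Longrightarrow> t \<le> u \<Longrightarrow> 0 < Im z \<Longrightarrow>
      REF M s u z = REF M s t (REF M t u z)"
    and hemigroup_weakly_continuous: "continuous_on UNIV \<phi> \<Longrightarrow> bounded (range \<phi>) \<Longrightarrow>
      continuous_on (ordered_pairs I) (\<lambda>p. LINT x|M (fst p) (snd p). (\<phi> x :: real))"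
proof -
  have "\<forall>(s, t)\<in>ordered_pairs I. real_distribution (M s t)"
    using M unfolding monotone_hemigroup_def by (elim conjE)
  then show "(s, t) \<in> ordered_pairs I \<Longrightarrow> real_distribution (M s t)" by blast
next
  have "\<forall>s\<in>I. \<forall>t\<in>I. \<forall>u\<in>I. s \<le> t \<longrightarrow> t \<le> u \<longrightarrow> is_monotone_convolution (M s t) (M t u) (M s u)"
    using M unfolding monotone_hemigroup_def by (elim conjE)
  then show "REF M s u z = REF M s t (REF M t u z)"
    if "s \<in> I" "t \<in> I" "u \<in> I" "s \<le> t" "t \<le> u" "0 < Im z"
    using that unfolding is_monotone_convolution_def REF_def upper_half_plane_def by blast
next
  have "\<forall>\<phi>::real \<Rightarrow> real. continuous_on UNIV \<phi> \<longrightarrow> bounded (range \<phi>) \<longrightarrow>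
      continuous_on (ordered_pairs I) (\<lambda>(s, t). LINT x|M s t. \<phi> x)"
    using M unfolding monotone_hemigroup_def by (elim conjE)
  then show "continuous_on UNIV \<phi> \<Longrightarrow> bounded (range \<phi>) \<Longrightarrow>
      continuous_on (ordered_pairs I) (\<lambda>p. LINT x|M (fst p) (snd p). (\<phi> x :: real))"
    by (simp add: case_prod_unfold)
qed

lemma loewner_flow_of_hemigroup:
  assumes I: "time_interval I" and M: "monotone_hemigroup I M" and gen: "reduced_generator I M m K"
    and T: "T \<in> I"
  shows "loewner_flow (restrict_generator K T) T m (REF M)"
proof -
  note T_props = time_interval_Icc[OF I T]
  have K: "continuous_on I m" "m 0 = 0" "sets K = sets (restrict_space borel (UNIV \<times> I))"
    "\<And>t. t \<in> I \<Longrightarrow> emeasure K (slice 0 t) < \<infinity>" "\<And>t. t \<in> I \<Longrightarrow> emeasure K (UNIV \<times> {t}) = 0"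
    and eq: "\<And>s t z. s \<in> I \<Longrightarrow> t \<in> I \<Longrightarrow> s \<le> t \<Longrightarrow> 0 < Im z \<Longrightarrow> REF M s t z = z - of_real (m t) + of_real (m s) +
          (LINT p:slice s t|K. 1 / (of_real (fst p) - REF M (snd p) t z))"
    using gen unfolding reduced_generator_def ordered_pairs_def upper_half_plane_def by auto
  interpret generator_on I K T
    using K(3,4) T T_props by unfold_locales auto
  have Im: "Im z \<le> Im (REF M s t z)" if "0 \<le> s" "s \<le> t" "t \<le> T" "0 < Im z" for s t z
    unfolding REF_def using that T_props(2)
    by (intro real_distribution.Im_F_transform_ge hemigroup_distribution[OF M]) (auto simp: ordered_pairs_def)
  have sub: "ordered_pairs {0..T} \<subseteq> ordered_pairs I"
    using T_props(2) by (auto simp: ordered_pairs_def)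
  have "continuous_on (upper_half_plane \<times> ordered_pairs {0..T})
      (\<lambda>(z, p). F_transform (M (fst p) (snd p)) z)"
    using sub hemigroup_distribution[OF M] continuous_on_subset[OF hemigroup_weakly_continuous[OF M] sub]
    by (intro continuous_on_F_transform) auto
  then have cont: "continuous_on (upper_half_plane \<times> ordered_pairs {0..T}) (\<lambda>(z, s, t). REF M s t z)"
    by (simp add: case_prod_unfold REF_def)
  have fin: "finite_measure (restrict_generator K T)"
    using emeasure_restrict_generator[of UNIV] K_finite
    by (intro finite_measureI) (auto simp: restrict_generator_def)
  have base: "atomless_in_time (restrict_generator K T) T"
  proof (intro atomless_in_time.intro[OF fin] atomless_in_time_axioms.intro)
    show "measure (restrict_generator K T) (UNIV \<times> {t}) = 0" if "t \<in> {0..T}" for t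
    proof -
      have "(UNIV \<times> {t}) \<inter> slice 0 T = UNIV \<times> {t}" using that by auto
      then have "emeasure (restrict_generator K T) (UNIV \<times> {t}) = emeasure K (UNIV \<times> {t})"
        using emeasure_restrict_generator[of "UNIV \<times> {t}"] borel_closed[OF closed_slice[of t t]] by simp
      then show ?thesis using K(5)[of t] that T_props(2) by (auto simp: measure_def)
    qed
  qed (auto simp: restrict_generator_def T_props)
  show ?thesis
  proof (intro loewner_flow.intro[OF base] loewner_flow_axioms.intro)
    show "continuous_on {0..T} m" using K(1) T_props(2) by (rule continuous_on_subset)
    show "m 0 = 0" by (rule K(2))
    show "REF M s u z = REF M s t (REF M t u z)"
      if "0 \<le> s" "s \<le> t" "t \<le> u" "u \<le> T" "0 < Im z" for s t u z
      using that T_props(2) by (intro hemigroup_REF_comp[OF M]) auto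
    show "REF M s t z = z - of_real (m t) + of_real (m s) +
        (LINT p:slice s t|restrict_generator K T. 1 / (of_real (fst p) - REF M (snd p) t z))"
      if st: "0 \<le> s" "s \<le> t" "t \<le> T" "0 < Im z" for s t z
    proof -
      have "continuous_on {s..t} (\<lambda>r. (\<lambda>(z, s, t). REF M s t z) (z, r, t))"
        using st by (intro continuous_on_compose2[OF cont])
          (auto simp: upper_half_plane_def ordered_pairs_def intro!: continuous_intros)
      then have "continuous_on (slice s t) (\<lambda>p. 1 / (complex_of_real (fst p) - REF M (snd p) t z))"
        using st Im[of _ t z] by (intro continuous_on_reverse_kernel) (auto intro: less_le_trans)
      moreover have "s \<in> I" "t \<in> I" using st T_props(2) by auto
      ultimately show ?thesis
        using integral_restrict_generator[OF st(1,3)] eq[of s t z] st by simp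
    qed
  qed (use Im cont in auto)
qed

text \<open>Let \<open>z\<close> go to infinity along the imaginary axis. Then \<open>z / (x - f r T z)\<close> tends to \<open>-1\<close>,
  because \<open>f r T z - z\<close> stays bounded, and its modulus is at most \<open>1\<close>, because \<open>Im (f r T z) \<ge> Im
  z = |z|\<close>. Hence \<open>z\<close> times the integral term of the equation tends to minus the mass.\<close>

lemma mass_eq_variance:
  assumes "loewner_flow L T m (REF M)" and "real_distribution (M 0 T)" "finite_second_moment (M 0 T)"
    and support: "measure L UNIV = measure L (slice 0 T)"
  shows "measure L UNIV = variance_of (M 0 T)"
proof -
  interpret loewner_flow L T m "REF M" by fact
  define z where "z n = \<i> * complex_of_real (real (Suc n))" for n
  have z: "0 < Im (z n)" "z n \<noteq> 0" "norm (z n) = Im (z n)" "Im (z n) = real (Suc n)" for n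
  proof -
    show Im: "Im (z n) = real (Suc n)" by (simp add: z_def)
    then show "0 < Im (z n)" by simp
    then show "z n \<noteq> 0" by fastforce
    show "norm (z n) = Im (z n)" by (simp add: z_def norm_mult del: of_nat_Suc)
  qed
  define R where "R n = (LINT p:slice 0 T|L. 1 / (of_real (fst p) - REF M (snd p) T (z n)))" for n
  define h where "h n p = z n * (1 / (of_real (fst p) - REF M (snd p) T (z n)))" for n and p :: "real \<times> real"
  have h_le: "norm (h n p) \<le> 1" if "p \<in> slice 0 T" for n p
  proof -
    have "norm (h n p) \<le> norm (z n) * (1 / Im (z n))"
      unfolding h_def norm_mult
      using flow_kernel(2)[OF z(1) order_refl order_refl order_refl that] by (intro mult_left_mono) auto
    also have "\<dots> = 1" using z(1)[of n] by (simp add: z(3))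
    finally show ?thesis .
  qed
  have h_cont: "continuous_on (slice 0 T) (h n)" for n
    unfolding h_def by (intro continuous_on_mult continuous_on_const flow_kernel(1)[OF z(1)]) auto
  have h_lim: "(\<lambda>n. h n p) \<longlonglongrightarrow> -1" if p: "p \<in> slice 0 T" for p
  proof -
    have inv_z: "(\<lambda>n. 1 / z n) \<longlonglongrightarrow> 0"
    proof (rule Lim_null_comparison)
      show "\<forall>\<^sub>F n in sequentially. norm (1 / z n) \<le> inverse (real (Suc n))"
        by (simp add: norm_divide z(3,4) inverse_eq_divide del: of_nat_Suc)
    qed (rule LIMSEQ_inverse_real_of_nat)
    define q where "q n = REF M (snd p) T (z n) - (z n - of_real (m T) + of_real (m (snd p)))" for n
    have q: "norm (q n) \<le> measure L UNIV" for n
    proof -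
      have "norm (q n) \<le> measure L (slice (snd p) T) / Im (z n)"
        unfolding q_def using p by (intro flow_minus_drift_le z(1)) auto
      also have "\<dots> \<le> measure L UNIV / 1"
        using measure_slice_le z(1) by (intro frac_le) (auto simp: z(4))
      finally show ?thesis by simp
    qed
    have "(\<lambda>n. q n * (1 / z n)) \<longlonglongrightarrow> 0"
    proof (rule Lim_null_comparison)
      show "\<forall>\<^sub>F n in sequentially. norm (q n * (1 / z n)) \<le> measure L UNIV * norm (1 / z n)"
        unfolding norm_mult using q by (intro always_eventually allI mult_right_mono) auto
      show "(\<lambda>n. measure L UNIV * norm (1 / z n)) \<longlonglongrightarrow> 0"
        using tendsto_mult_right_zero[OF tendsto_norm_zero[OF inv_z]] .
    qed
    then have "(\<lambda>n. 1 / ((of_real (fst p) + of_real (m T) - of_real (m (snd p))) * (1 / z n) - 1 - q n * (1 / z n)))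
        \<longlonglongrightarrow> 1 / ((of_real (fst p) + of_real (m T) - of_real (m (snd p))) * 0 - 1 - 0)"
      by (intro tendsto_intros inv_z) auto
    moreover have "1 / ((of_real (fst p) + of_real (m T) - of_real (m (snd p))) * (1 / z n) - 1 - q n * (1 / z n)) = h n p" for n
    proof -
      have "(of_real (fst p) + of_real (m T) - of_real (m (snd p))) * (1 / z n) - 1 - q n * (1 / z n)
          = (of_real (fst p) - REF M (snd p) T (z n)) / z n"
        using z(2)[of n] by (simp add: q_def field_simps)
      then show ?thesis by (simp add: h_def)
    qed
    ultimately show ?thesis by simp
  qed
  have "(\<lambda>n. LINT p|L. indicator (slice 0 T) p *\<^sub>R h n p) \<longlonglongrightarrow> (LINT p|L. indicator (slice 0 T) p *\<^sub>R (-1))"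
  proof (rule integral_dominated_convergence[where w = "\<lambda>_. 1"])
    show "(\<lambda>p. indicator (slice 0 T) p *\<^sub>R h n p) \<in> borel_measurable L" for n
      using slice_set_integrable[OF h_cont h_le] by (auto simp: set_integrable_def)
    show "(\<lambda>p. indicator (slice 0 T) p *\<^sub>R (-1 :: complex)) \<in> borel_measurable L"
      using slice_set_integrable[of 0 T "\<lambda>_. -1 :: complex" 1] by (auto simp: set_integrable_def)
    show "AE p in L. (\<lambda>n. indicator (slice 0 T) p *\<^sub>R h n p) \<longlonglongrightarrow> indicator (slice 0 T) p *\<^sub>R (-1)"
    proof (rule AE_I2)
      show "(\<lambda>n. indicator (slice 0 T) p *\<^sub>R h n p) \<longlonglongrightarrow> indicator (slice 0 T) p *\<^sub>R (-1)" for p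
        using h_lim[of p] by (cases "p \<in> slice 0 T") auto
    qed
    show "AE p in L. norm (indicator (slice 0 T) p *\<^sub>R h n p) \<le> 1" for n
    proof (rule AE_I2)
      show "norm (indicator (slice 0 T) p *\<^sub>R h n p) \<le> 1" for p
        using h_le[of p n] by (cases "p \<in> slice 0 T") auto
    qed
  qed simp
  moreover have "(LINT p|L. indicator (slice 0 T) p *\<^sub>R h n p) = z n * R n" for n
    unfolding R_def h_def set_lebesgue_integral_def
    by (simp only: mult_scaleR_right[symmetric] integral_mult_right_zero)
  moreover have "(LINT p|L. indicator (slice 0 T) p *\<^sub>R (-1 :: complex)) = - of_real (measure L (slice 0 T))"
    using sets_slice[of 0 T] by (simp add: space_L scaleR_conv_of_real)
  ultimately have lim: "(\<lambda>n. z n * R n) \<longlonglongrightarrow> - of_real (measure L (slice 0 T))" by simp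
  have "variance_of (M 0 T) = measure L (slice 0 T)"
  proof (rule variance_eq_limit_of_remainder[OF assms(2,3)])
    show "F_transform (M 0 T) (\<i> * of_real (real (Suc n))) = \<i> * of_real (real (Suc n)) - of_real (m T) + R n" for n
      using equation[of 0 T "z n"] T_nonneg z(1) m_0 by (simp add: REF_def R_def z_def del: of_nat_Suc)
    show "(\<lambda>n. \<i> * of_real (real (Suc n)) * R n) \<longlonglongrightarrow> - of_real (measure L (slice 0 T))"
      using lim by (simp add: z_def)
  qed
  then show ?thesis using support by simp
qed

lemma locally_uniform_limit_exhaust:
  assumes sub: "\<And>T. T \<in> J \<Longrightarrow> S' T \<subseteq> S"
    and cover: "\<And>C. compact C \<Longrightarrow> C \<subseteq> S \<Longrightarrow> \<exists>T\<in>J. C \<subseteq> S' T"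
  shows "locally_uniform_limit S g h \<longleftrightarrow> (\<forall>T\<in>J. locally_uniform_limit (S' T) g h)"
  unfolding locally_uniform_limit_def using assms by (meson order_trans)

lemma compact_subset_time_interval:
  assumes I: "time_interval I" and C: "compact C" "C \<subseteq> I"
  shows "\<exists>T\<in>I. C \<subseteq> {0..T}"
proof (cases "C = {}")
  case True
  have "0 \<in> I" using I by (auto simp: time_interval_def)
  then show ?thesis using True by auto
next
  case False
  obtain T where "T \<in> C" "\<forall>t\<in>C. t \<le> T"
    using compact_attains_sup[OF C(1) False] by auto
  moreover have "0 \<le> t" if "t \<in> C" for t
    using time_interval_Icc(1)[OF I] that C(2) by blast
  ultimately show ?thesis using C(2) by (intro bexI[of _ T]) auto
qed

lemma exhaust_time:
  assumes I: "time_interval I"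
  shows "locally_uniform_limit I g h \<longleftrightarrow> (\<forall>T\<in>I. locally_uniform_limit {0..T} g h)"
  using time_interval_Icc(2)[OF I] compact_subset_time_interval[OF I]
  by (rule locally_uniform_limit_exhaust)

lemma exhaust_product_time:
  fixes g :: "nat \<Rightarrow> complex \<times> real \<Rightarrow> 'b::metric_space"
  assumes I: "time_interval I"
  shows "locally_uniform_limit (U \<times> I) g h \<longleftrightarrow> (\<forall>T\<in>I. locally_uniform_limit (U \<times> {0..T}) g h)"
proof (rule locally_uniform_limit_exhaust)
  fix C :: "(complex \<times> real) set" assume C: "compact C" "C \<subseteq> U \<times> I"
  have "compact (snd ` C)"
    by (rule compact_continuous_image[OF continuous_on_snd[OF continuous_on_id] C(1)])
  moreover have "snd ` C \<subseteq> I" using C(2) by force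
  ultimately obtain T where "T \<in> I" "snd ` C \<subseteq> {0..T}"
    using compact_subset_time_interval[OF I, of "snd ` C"] by blast
  then show "\<exists>T\<in>I. C \<subseteq> U \<times> {0..T}"
    using C(2) by (intro bexI[of _ T]) force+
qed (use time_interval_Icc(2)[OF I] in blast)

lemma exhaust_product_ordered_pairs:
  fixes g :: "nat \<Rightarrow> complex \<times> real \<times> real \<Rightarrow> 'b::metric_space"
  assumes I: "time_interval I"
  shows "locally_uniform_limit (U \<times> ordered_pairs I) g h \<longleftrightarrow>
    (\<forall>T\<in>I. locally_uniform_limit (U \<times> ordered_pairs {0..T}) g h)"
proof (rule locally_uniform_limit_exhaust)
  show "U \<times> ordered_pairs {0..T} \<subseteq> U \<times> ordered_pairs I" if "T \<in> I" for T
    using time_interval_Icc(2)[OF I that] by (auto simp: ordered_pairs_def)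
  fix C :: "(complex \<times> real \<times> real) set" assume C: "compact C" "C \<subseteq> U \<times> ordered_pairs I"
  have "compact ((\<lambda>x. snd (snd x)) ` C)"
    by (rule compact_continuous_image[OF continuous_on_snd[OF continuous_on_snd[OF continuous_on_id]] C(1)])
  moreover have "(\<lambda>x. snd (snd x)) ` C \<subseteq> I"
    using C(2) by (auto simp: ordered_pairs_def)
  ultimately obtain T where T: "T \<in> I" "(\<lambda>x. snd (snd x)) ` C \<subseteq> {0..T}"
    using compact_subset_time_interval[OF I] by blast
  have "C \<subseteq> U \<times> ordered_pairs {0..T}"
  proof
    fix x assume "x \<in> C"
    then obtain z s t where x: "x = (z, s, t)" "z \<in> U" "s \<in> I" "s \<le> t"
      using C(2) by (cases x) (auto simp: ordered_pairs_def)
    moreover have "t \<le> T" using T(2) \<open>x \<in> C\<close> x(1) by force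
    ultimately show "x \<in> U \<times> ordered_pairs {0..T}"
      using time_interval_Icc(1)[OF I x(3)] by (auto simp: ordered_pairs_def)
  qed
  then show "\<exists>T\<in>I. C \<subseteq> U \<times> ordered_pairs {0..T}" using T(1) by blast
qed

lemma locally_uniform_limit_uminus:
  fixes g :: "nat \<Rightarrow> 'a::topological_space \<Rightarrow> complex"
  shows "locally_uniform_limit S (\<lambda>n x. - g n x) (\<lambda>x. - h x) \<longleftrightarrow> locally_uniform_limit S g h"
  unfolding locally_uniform_limit_def uniform_limit_iff by (simp add: dist_minus)

lemma locally_uniform_limit_cong:
  assumes "\<And>n x. x \<in> S \<Longrightarrow> g n x = g' n x" "\<And>x. x \<in> S \<Longrightarrow> h x = h' x"
  shows "locally_uniform_limit S g h \<longleftrightarrow> locally_uniform_limit S g' h'"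
proof -
  have "uniform_limit C g h sequentially \<longleftrightarrow> uniform_limit C g' h' sequentially" if "C \<subseteq> S" for C
    using assms subsetD[OF that] by (intro uniform_limit_cong') auto
  then show ?thesis
    unfolding locally_uniform_limit_def by auto
qed

section \<open>Equivalence of the modes of convergence\<close>

text \<open>A chain is its evolution composed with the continuous embedding \<open>(z, t) \<mapsto> (z, 0, t)\<close>, which
  preserves compactness.\<close>

lemma (in flow_sequence) chain_limit_of_evolution_limit:
  assumes lim: evolution_limit
  shows chain_limit
  unfolding locally_uniform_limit_def uniform_limit_iff
proof (intro allI impI)
  fix D :: "(complex \<times> real) set" and e :: real
  assume D: "compact D" "D \<subseteq> upper_half_plane \<times> {0..T}" and e: "0 < e"
  let ?i = "\<lambda>x :: complex \<times> real. (fst x, 0 :: real, snd x)"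
  have "compact (?i ` D)"
    using D(1) by (intro compact_continuous_image continuous_intros)
  moreover have "?i ` D \<subseteq> upper_half_plane \<times> ordered_pairs {0..T}"
    using D(2) by (auto simp: ordered_pairs_def)
  ultimately have "\<forall>\<^sub>F n in sequentially. \<forall>x\<in>?i ` D.
      dist ((\<lambda>(z, s, t). fn n s t z) x) ((\<lambda>(z, s, t). f s t z) x) < e"
    using locally_uniform_limitD[OF lim _ _ e] by blast
  then show "\<forall>\<^sub>F n in sequentially. \<forall>x\<in>D.
      dist (case x of (z, t) \<Rightarrow> fn n 0 t z) (case x of (z, t) \<Rightarrow> f 0 t z) < e"
    by eventually_elim (auto simp: case_prod_unfold)
qed

lemma (in flow_sequence) flow_limits_equivalent:
  "chain_limit \<longleftrightarrow> evolution_limit" "evolution_limit \<longleftrightarrow> drift_limit \<and> marginal_limit"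
  using chain_limit_of_evolution_limit drift_limit_of_chain_limit evolution_limit_of_chain_limit
    marginal_limit_of_evolution_limit evolution_limit_of_generator_limit by blast+

lemma generator_mass_eq_variance:
  assumes I: "time_interval I" and M: "monotone_hemigroup_L2 I M" and gen: "reduced_generator I M m K"
    and T_in: "T \<in> I"
  shows "measure (restrict_generator K T) UNIV = variance_of (M 0 T)"
proof -
  have M': "monotone_hemigroup I M"
    using M by (simp add: monotone_hemigroup_L2_def)
  have pair: "(0, T) \<in> ordered_pairs I"
    using T_in time_interval_Icc[OF I T_in] by (auto simp: ordered_pairs_def)
  have "generator_on I K T"
    using gen T_in time_interval_Icc[OF I T_in] by (simp add: generator_on_def reduced_generator_def)
  then interpret generator_on I K T .
  show ?thesis
  proof (rule mass_eq_variance[OF loewner_flow_of_hemigroup[OF I M' gen T_in]])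
    show "real_distribution (M 0 T)"
      by (rule hemigroup_distribution[OF M' pair])
    show "finite_second_moment (M 0 T)"
      using M pair unfolding monotone_hemigroup_L2_def by blast
    have "emeasure (restrict_generator K T) UNIV = emeasure (restrict_generator K T) (slice 0 T)"
      using borel_closed[OF closed_slice[of 0 T]] by (simp add: emeasure_restrict_generator)
    then show "measure (restrict_generator K T) UNIV = measure (restrict_generator K T) (slice 0 T)"
      by (simp add: measure_def)
  qed
qed

lemma vague_limit_iff_marginal_transform:
  assumes F: "\<And>n. atomless_in_time (Ls n) T" and G: "atomless_in_time L T"
    and mass: "\<And>n. measure (Ls n) UNIV \<le> C" "measure L UNIV \<le> C"
  shows "vague_limit_locally_uniform {0..T} (\<lambda>n t. kappa (Ls n) t) (\<lambda>t. kappa L t) \<longleftrightarrow>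
    locally_uniform_limit (upper_half_plane \<times> {0..T})
        (\<lambda>n (w, t). marginal_transform (Ls n) t w) (\<lambda>(w, t). marginal_transform L t w)"
proof -
  have "vague_limit_locally_uniform {0..T} (\<lambda>n t. kappa (Ls n) t) (\<lambda>t. kappa L t) \<longleftrightarrow>
    locally_uniform_limit (upper_half_plane \<times> {0..T})
        (\<lambda>n (w, t). Cauchy_transform (kappa (Ls n) t) w) (\<lambda>(w, t). Cauchy_transform (kappa L t) w)"
  proof (rule vague_limit_iff_Cauchy_transform)
    show "finite_borel_measure (kappa (Ls n) t) \<and> measure (kappa (Ls n) t) UNIV \<le> C" for n t
      using atomless_in_time.finite_borel_kappa[OF F] atomless_in_time.measure_kappa_le[OF F] mass(1) order_trans
      by blast
    show "finite_borel_measure (kappa L t) \<and> measure (kappa L t) UNIV \<le> C" for t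
      using atomless_in_time.finite_borel_kappa[OF G] atomless_in_time.measure_kappa_le[OF G] mass(2) order_trans
      by blast
    fix \<phi> :: "real \<Rightarrow> real"
    assume \<phi>: "continuous_on UNIV \<phi>" "compact (closure {x. \<phi> x \<noteq> 0})"
    obtain B where "\<And>x. \<bar>\<phi> x\<bar> \<le> B" using bounded_of_compact_support[OF \<phi>] by blast
    then show "continuous_on {0..T} (\<lambda>t. LINT x|kappa L t. \<phi> x)"
      by (rule atomless_in_time.continuous_on_integral_kappa[OF G \<phi>(1)])
  qed
  also have "\<dots> \<longleftrightarrow> locally_uniform_limit (upper_half_plane \<times> {0..T})
      (\<lambda>n x. - (\<lambda>(w, t). marginal_transform (Ls n) t w) x) (\<lambda>x. - (\<lambda>(w, t). marginal_transform L t w) x)"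
    by (rule locally_uniform_limit_cong)
      (auto simp: upper_half_plane_def atomless_in_time.Cauchy_transform_kappa[OF F]
        atomless_in_time.Cauchy_transform_kappa[OF G])
  finally show ?thesis unfolding locally_uniform_limit_uminus .
qed

lemma locally_uniform_limit_compact:
  assumes "compact S"
  shows "locally_uniform_limit S g h \<longleftrightarrow> uniform_limit S g h sequentially"
  unfolding locally_uniform_limit_def using assms by (auto intro: uniform_limit_on_subset)

theorem theorem5p24:
  fixes I :: "real set"
    and M :: "real \<Rightarrow> real \<Rightarrow> real measure"
    and Mn :: "nat \<Rightarrow> real \<Rightarrow> real \<Rightarrow> real measure"
    and m :: "real \<Rightarrow> real"
    and mn :: "nat \<Rightarrow> real \<Rightarrow> real"
    and K :: "(real \<times> real) measure"
    and Kn :: "nat \<Rightarrow> (real \<times> real) measure"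
  assumes "time_interval I"
    and "monotone_hemigroup_L2 I M"
    and "\<And>n. monotone_hemigroup_L2 I (Mn n)"
    and "reduced_generator I M m K"
    and "\<And>n. reduced_generator I (Mn n) (mn n) (Kn n)"
    and "\<And>t. t \<in> I \<Longrightarrow> bdd_above (range (\<lambda>n. variance_of (Mn n 0 t)))"
  shows
    "let c1 = weak_limit_locally_uniform I (\<lambda>n t. Mn n 0 t) (\<lambda>t. M 0 t);
         c2 = weak_limit_locally_uniform (ordered_pairs I)
                (\<lambda>n (s, t). Mn n s t) (\<lambda>(s, t). M s t);
         c3 = locally_uniform_limit (upper_half_plane \<times> I)
                (\<lambda>n (z, t). DLC (Mn n) t z) (\<lambda>(z, t). DLC M t z);
         c4 = locally_uniform_limit (upper_half_plane \<times> ordered_pairs I)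
                (\<lambda>n (z, s, t). REF (Mn n) s t z) (\<lambda>(z, s, t). REF M s t z);
         c5 = (locally_uniform_limit I mn m \<and>
               vague_limit_locally_uniform I (\<lambda>n t. kappa (Kn n) t) (\<lambda>t. kappa K t))
     in (c1 \<longleftrightarrow> c2) \<and> (c2 \<longleftrightarrow> c3) \<and> (c3 \<longleftrightarrow> c4) \<and> (c1 \<longleftrightarrow> c5)"
proof -
  note I = assms(1)
  have M: "monotone_hemigroup I M" and Mn: "\<And>n. monotone_hemigroup I (Mn n)"
    using assms(2,3) by (auto simp: monotone_hemigroup_L2_def)
  define Ls where "Ls T n = restrict_generator (Kn n) T" for T n
  define L where "L T = restrict_generator K T" for T
  have flow_n: "loewner_flow (Ls T n) T (mn n) (REF (Mn n))" if "T \<in> I" for T n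
    unfolding Ls_def by (rule loewner_flow_of_hemigroup[OF I Mn assms(5) that])
  have flow: "loewner_flow (L T) T m (REF M)" if "T \<in> I" for T
    unfolding L_def by (rule loewner_flow_of_hemigroup[OF I M assms(4) that])
  have mass: "\<exists>C. (\<forall>n. measure (Ls T n) UNIV \<le> C) \<and> measure (L T) UNIV \<le> C" if T: "T \<in> I" for T
  proof -
    obtain C where C: "\<And>n. variance_of (Mn n 0 T) \<le> C"
      using assms(6)[OF T] by (auto simp: bdd_above_def)
    have "measure (Ls T n) UNIV \<le> C" for n
      unfolding Ls_def generator_mass_eq_variance[OF I assms(3,5) T] by (rule C)
    then show ?thesis
      by (intro exI[of _ "max C (measure (L T) UNIV)"]) (auto simp: le_max_iff_disj)
  qed

  define chain where "chain T \<longleftrightarrow> locally_uniform_limit (upper_half_plane \<times> {0..T})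
      (\<lambda>n (z, t). REF (Mn n) 0 t z) (\<lambda>(z, t). REF M 0 t z)" for T
  define evolution where "evolution T \<longleftrightarrow> locally_uniform_limit (upper_half_plane \<times> ordered_pairs {0..T})
      (\<lambda>n (z, s, t). REF (Mn n) s t z) (\<lambda>(z, s, t). REF M s t z)" for T
  define generator where "generator T \<longleftrightarrow> uniform_limit {0..T} mn m sequentially \<and>
      vague_limit_locally_uniform {0..T} (\<lambda>n t. kappa (Kn n) t) (\<lambda>t. kappa K t)" for T
  have equiv: "chain T \<longleftrightarrow> evolution T" "evolution T \<longleftrightarrow> generator T" if T: "T \<in> I" for T
  proof -
    obtain C where C: "\<And>n. measure (Ls T n) UNIV \<le> C" "measure (L T) UNIV \<le> C"
      using mass[OF T] by blast
    have gen: "generator_on I K T" "generator_on I (Kn n) T" for n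
      using assms(4) assms(5)[of n] T time_interval_Icc[OF I T]
      by (simp_all add: generator_on_def reduced_generator_def)
    have "vague_limit_locally_uniform {0..T} (\<lambda>n t. kappa (Kn n) t) (\<lambda>t. kappa K t) \<longleftrightarrow>
        vague_limit_locally_uniform {0..T} (\<lambda>n t. kappa (Ls T n) t) (\<lambda>t. kappa (L T) t)"
      unfolding vague_limit_locally_uniform_def
    proof (intro all_cong1 imp_cong refl locally_uniform_limit_cong)
      fix \<phi> :: "real \<Rightarrow> real" and n t
      assume "t \<in> {0..T}"
      then show "(LINT x|kappa (Kn n) t. \<phi> x) = (LINT x|kappa (Ls T n) t. \<phi> x)"
        "(LINT x|kappa K t. \<phi> x) = (LINT x|kappa (L T) t. \<phi> x)"
        using generator_on.kappa_restrict_generator[OF gen(1)] generator_on.kappa_restrict_generator[OF gen(2)]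
        by (auto simp: Ls_def L_def)
    qed
    also have "\<dots> \<longleftrightarrow> locally_uniform_limit (upper_half_plane \<times> {0..T})
        (\<lambda>n (w, t). marginal_transform (Ls T n) t w) (\<lambda>(w, t). marginal_transform (L T) t w)"
      using loewner_flow.axioms(1)[OF flow_n[OF T]] loewner_flow.axioms(1)[OF flow[OF T]] C
      by (rule vague_limit_iff_marginal_transform)
    finally show "chain T \<longleftrightarrow> evolution T" "evolution T \<longleftrightarrow> generator T"
      unfolding chain_def evolution_def generator_def
      using flow_sequence.flow_limits_equivalent[OF flow_sequence.intro[OF flow_n[OF T] flow[OF T] C]] by simp_all
  qed

  have c3: "locally_uniform_limit (upper_half_plane \<times> I)
      (\<lambda>n (z, t). DLC (Mn n) t z) (\<lambda>(z, t). DLC M t z) \<longleftrightarrow> (\<forall>T\<in>I. chain T)"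
    unfolding DLC_def chain_def by (rule exhaust_product_time[OF I])
  have c4: "locally_uniform_limit (upper_half_plane \<times> ordered_pairs I)
      (\<lambda>n (z, s, t). REF (Mn n) s t z) (\<lambda>(z, s, t). REF M s t z) \<longleftrightarrow> (\<forall>T\<in>I. evolution T)"
    unfolding evolution_def by (rule exhaust_product_ordered_pairs[OF I])
  have c5: "locally_uniform_limit I mn m \<and>
      vague_limit_locally_uniform I (\<lambda>n t. kappa (Kn n) t) (\<lambda>t. kappa K t) \<longleftrightarrow> (\<forall>T\<in>I. generator T)"
    unfolding generator_def vague_limit_locally_uniform_def exhaust_time[OF I]
    by (auto simp: locally_uniform_limit_compact)
  have zero_pair: "(0, t) \<in> ordered_pairs I" if "t \<in> I" for t
    using that time_interval_Icc[OF I that] by (auto simp: ordered_pairs_def)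
  have c1: "weak_limit_locally_uniform I (\<lambda>n t. Mn n 0 t) (\<lambda>t. M 0 t) \<longleftrightarrow>
      locally_uniform_limit (upper_half_plane \<times> I) (\<lambda>n (z, t). DLC (Mn n) t z) (\<lambda>(z, t). DLC M t z)"
    unfolding DLC_def REF_def
  proof (rule weak_limit_iff_F_transform)
    fix \<phi> :: "real \<Rightarrow> real"
    assume \<phi>: "continuous_on UNIV \<phi>" "bounded (range \<phi>)"
    have "continuous_on I (\<lambda>t. (\<lambda>p. LINT x|M (fst p) (snd p). \<phi> x) (0, t))"
      by (rule continuous_on_compose2[OF hemigroup_weakly_continuous[OF M \<phi>]])
        (use zero_pair in \<open>auto intro!: continuous_intros\<close>)
    then show "continuous_on I (\<lambda>t. LINT x|M 0 t. \<phi> x)" by simp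
  qed (use zero_pair hemigroup_distribution[OF M] hemigroup_distribution[OF Mn] in auto)
  have c2: "weak_limit_locally_uniform (ordered_pairs I) (\<lambda>n (s, t). Mn n s t) (\<lambda>(s, t). M s t) \<longleftrightarrow>
      locally_uniform_limit (upper_half_plane \<times> ordered_pairs I)
        (\<lambda>n (z, s, t). REF (Mn n) s t z) (\<lambda>(z, s, t). REF M s t z)"
    unfolding REF_def case_prod_unfold
    using weak_limit_iff_F_transform[of "ordered_pairs I" "\<lambda>n p. Mn n (fst p) (snd p)" "\<lambda>p. M (fst p) (snd p)"]
      hemigroup_distribution[OF M] hemigroup_distribution[OF Mn] hemigroup_weakly_continuous[OF M]
    by (auto simp: case_prod_unfold)
  show ?thesis
    unfolding Let_def c1 c2 c3 c4 c5 using equiv by blast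
qed

end
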